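(* Let $X$ be a solution on $[0,T]$, with values in $\Delta_d$, of the system of SDEs $$\mathrm{d}X_i(t)=\Big\{\sum_{j\neq i}\frac{\gamma_{i,j}}{X_i(t)-X_j(t)}+b_i(X(t))\Big\}\mathrm{d}t+\sum_{j=1}^d\sigma_{i,j}(X(t))\,\mathrm{d}W_j(t),\qquad i=1,\dots,d.$$ Suppose that, with $\hat p=6$, there exists a constant $0<\hat C<\infty$ such that $$\sup_{t\in[0,T]}\mathbb{E}[|X(t)|^{\hat p}]+\max_{1\le i<d}\ \sup_{t\in[0,T]}\mathbb{E}\big[|X_i(t)-X_{i+1}(t)|^{-\hat p}\big]<\hat C$$ and $$\mathbb{E}[|X(t)-X(s)|^{\hat p}]\le\hat C|t-s|^{\hat p/2}\quad\text{for all }0\le s<t\le T.$$ Let $X^{(n)}$ be the semi-implicit Euler-Maruyama scheme defined in the context. Then there exists a constant $C>0$, which depends on $d$ (and not on $n$), such that for any $n\in\mathbb{N}$ with $T/n\le1$, $$\sup_{k=1,\dots,n}\mathbb{E}\Big[\big|X(t_k^{(n)})-X^{(n)}(t_k^{(n)})\big|^2\Big]^{1/2}\le\frac{C}{n^{1/2}}$$ and $$\mathbb{E}\Big[\sup_{k=1,\dots,n}\big|X(t_k^{(n)})-X^{(n)}(t_k^{(n)})\big|^2\Big]^{1/2}\le\frac{C}{n^{1/4}}.$$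
   Context: Let $d\ge 2$, $T>0$, $\Delta_d=\{(x_1,\dots,x_d)^*\in\mathbb{R}^d: x_1<x_2<\cdots<x_d\}$, and let $|\cdot|$ be the Euclidean norm. $W=(W_1,\dots,W_d)^*$ is a $d$-dimensional standard Brownian motion on a probability space $(\Omega,\mathcal F,\mathbb P)$ with a filtration $(\mathcal F_t)_{t\ge0}$ satisfying the usual conditions. Standing assumptions: (A1) $X(0)\in\Delta_d$ almost surely; (A2) $\gamma_{i,j}=\gamma_{j,i}\ge0$ are constants for $i\ne j$, with $\gamma_{i,i+1}>0$ for $i=1,\dots,d-1$; (A3) the functions $b_i:\mathbb{R}^d\to\mathbb{R}$ are globally Lipschitz continuous; (A4) the functions $\sigma_{i,j}:\mathbb{R}^d\to\mathbb{R}$ are globally Lipschitz continuous and bounded. Semi-implicit Euler-Maruyama scheme: for $n\in\mathbb{N}$ put $t_k^{(n)}=kT/n$ and $X^{(n)}(0)=X(0)$; for $k=0,\dots,n-1$, $X^{(n)}(t_{k+1}^{(n)})$ is the unique solution in $\Delta_d$ of the system ($i=1,\dots,d$) $$X_i^{(n)}(t_{k+1}^{(n)})=X_i^{(n)}(t_k^{(n)})+\Big\{\sum_{j\ne i}\frac{\gamma_{i,j}}{X_i^{(n)}(t_{k+1}^{(n)})-X_j^{(n)}(t_{k+1}^{(n)})}+b_i\big(X^{(n)}(t_k^{(n)})\big)\Big\}\frac Tn+\sum_{j=1}^d\sigma_{i,j}\big(X^{(n)}(t_k^{(n)})\big)\big\{W_j(t_{k+1}^{(n)})-W_j(t_k^{(n)})\big\}.$$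 (It is known that this system has exactly one solution in $\Delta_d$.) *)

theory Defs
  imports "HOL-Probability.Probability"
begin

text \<open>Points of \<open>\<real>\<^sup>d\<close> have type \<open>real ^ 'd\<close>, where the index type \<open>'d\<close> is an arbitrary finite
  linear order with \<open>CARD('d) = d\<close>; its order plays the role of the order on \<open>{1, ..., d}\<close>.\<close>

definition ordered_chamber :: "(real ^ 'd::{finite,linorder}) set" where
  "ordered_chamber = {x. \<forall>i j. i < j \<longrightarrow> x $ i < x $ j}"

text \<open>The index pairs \<open>(i, i + 1)\<close>.\<close>

definition adjacent :: "('d::{finite,linorder} \<times> 'd) set" where
  "adjacent = {(i, j). i < j \<and> \<not> (\<exists>k. i < k \<and> k < j)}"

section \<open>Brownian motion with respect to a filtration\<close>

text \<open>Time is \<open>[0, \<infinity>)\<close>; the values of \<open>F\<close>, and of every process below, at negative times are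
  irrelevant. The clause on null sets gives both completeness of \<open>M\<close> and the fact that
  \<open>F 0\<close> contains all null sets.\<close>

definition usual_filtration :: "'a measure \<Rightarrow> (real \<Rightarrow> 'a measure) \<Rightarrow> bool" where
  "usual_filtration M F \<longleftrightarrow>
     (\<forall>t\<ge>0. subalgebra M (F t)) \<and>
     (\<forall>s t. 0 \<le> s \<and> s \<le> t \<longrightarrow> sets (F s) \<subseteq> sets (F t)) \<and>
     (\<forall>N\<in>null_sets M. \<forall>A. A \<subseteq> N \<longrightarrow> A \<in> sets (F 0)) \<and>
     (\<forall>t\<ge>0. sets (F t) = (\<Inter>s\<in>{t<..}. sets (F s)))"

definition brownian_motion ::
    "'a measure \<Rightarrow> (real \<Rightarrow> 'a measure) \<Rightarrow> (real \<Rightarrow> 'a \<Rightarrow> real ^ 'd::finite) \<Rightarrow> bool" where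
  "brownian_motion M F W \<longleftrightarrow>
     (AE \<omega> in M. W 0 \<omega> = 0) \<and>
     (AE \<omega> in M. continuous_on {0..} (\<lambda>t. W t \<omega>)) \<and>
     (\<forall>t\<ge>0. W t \<in> borel_measurable (F t)) \<and>
     (\<forall>s t. 0 \<le> s \<and> s < t \<longrightarrow>
        prob_space.indep_set M (sets (F s))
          {(\<lambda>\<omega>. W t \<omega> - W s \<omega>) -` B \<inter> space M | B. B \<in> sets borel} \<and>
        prob_space.indep_vars M (\<lambda>_. borel) (\<lambda>i \<omega>. (W t \<omega> - W s \<omega>) $ i) UNIV \<and>
        (\<forall>i. distributed M lborel (\<lambda>\<omega>. (W t \<omega> - W s \<omega>) $ i)
               (\<lambda>x. ennreal (normal_density 0 (sqrt (t - s)) x))))"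

section \<open>The Ito integral for square-integrable integrands\<close>

text \<open>Simple integrands \<open>\<Sum>k<N. \<xi> k * indicator {s k <.. s (k + 1)}\<close> on \<open>[0, T]\<close>.\<close>

definition simple_integrand ::
    "'a measure \<Rightarrow> (real \<Rightarrow> 'a measure) \<Rightarrow> real \<Rightarrow> nat \<Rightarrow> (nat \<Rightarrow> real) \<Rightarrow> (nat \<Rightarrow> 'a \<Rightarrow> real) \<Rightarrow> bool"
  where
  "simple_integrand M F T N s \<xi> \<longleftrightarrow>
     0 \<le> s 0 \<and> s N \<le> T \<and>
     (\<forall>k<N. s k < s (Suc k) \<and> \<xi> k \<in> borel_measurable (F (s k)) \<and>
        (\<exists>B. \<forall>\<omega>\<in>space M. \<bar>\<xi> k \<omega>\<bar> \<le> B))"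

definition simple_process ::
    "nat \<Rightarrow> (nat \<Rightarrow> real) \<Rightarrow> (nat \<Rightarrow> 'a \<Rightarrow> real) \<Rightarrow> real \<Rightarrow> 'a \<Rightarrow> real" where
  "simple_process N s \<xi> t \<omega> = (\<Sum>k<N. \<xi> k \<omega> * indicator {s k<..s (Suc k)} t)"

definition simple_integral ::
    "(real \<Rightarrow> 'a \<Rightarrow> real) \<Rightarrow> nat \<Rightarrow> (nat \<Rightarrow> real) \<Rightarrow> (nat \<Rightarrow> 'a \<Rightarrow> real) \<Rightarrow> real \<Rightarrow> 'a \<Rightarrow> real" where
  "simple_integral B N s \<xi> t \<omega> =
     (\<Sum>k<N. \<xi> k \<omega> * (B (min t (s (Suc k))) \<omega> - B (min t (s k)) \<omega>))"

text \<open>\<open>ito_integral M F T B H I\<close>: the process \<open>I\<close> is (a version with almost surely continuous paths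
  of) \<open>t \<mapsto> \<integral>\<^sub>0\<^sup>t H dB\<close> on \<open>[0, T]\<close>, that is, the \<open>L\<^sup>2\<close> limit of the integrals of simple integrands that
  approximate \<open>H\<close> in \<open>L\<^sup>2(\<Omega> \<times> [0, T])\<close>. Joint measurability refers to the completed product
  measure because processes are only required to have almost surely continuous paths.\<close>

definition ito_integral ::
    "'a measure \<Rightarrow> (real \<Rightarrow> 'a measure) \<Rightarrow> real \<Rightarrow> (real \<Rightarrow> 'a \<Rightarrow> real) \<Rightarrow> (real \<Rightarrow> 'a \<Rightarrow> real) \<Rightarrow>
     (real \<Rightarrow> 'a \<Rightarrow> real) \<Rightarrow> bool" where
  "ito_integral M F T B H I \<longleftrightarrow>
     (\<forall>t\<in>{0..T}. H t \<in> borel_measurable (F t)) \<and>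
     (\<lambda>(t, \<omega>). H t \<omega>) \<in> borel_measurable (completion (restrict_space lborel {0..T} \<Otimes>\<^sub>M M)) \<and>
     (\<forall>t\<in>{0..T}. I t \<in> borel_measurable (F t)) \<and>
     (AE \<omega> in M. continuous_on {0..T} (\<lambda>t. I t \<omega>)) \<and>
     (\<exists>N s \<xi>.
        (\<forall>m::nat. simple_integrand M F T (N m) (s m) (\<xi> m)) \<and>
        ((\<lambda>m. \<integral>\<^sup>+\<omega>. (\<integral>\<^sup>+t\<in>{0..T}. ennreal ((simple_process (N m) (s m) (\<xi> m) t \<omega> - H t \<omega>)\<^sup>2) \<partial>lborel) \<partial>M)
           \<longlonglongrightarrow> 0) \<and>
        (\<forall>t\<in>{0..T}.
           (\<lambda>m. \<integral>\<^sup>+\<omega>. ennreal ((simple_integral B (N m) (s m) (\<xi> m) t \<omega> - I t \<omega>)\<^sup>2) \<partial>M)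
           \<longlonglongrightarrow> 0))"

section \<open>The particle system and its semi-implicit discretisation\<close>

definition repulsion ::
    "('d::finite \<Rightarrow> 'd \<Rightarrow> real) \<Rightarrow> real ^ 'd::finite \<Rightarrow> 'd \<Rightarrow> real" where
  "repulsion \<gamma> x i = (\<Sum>j\<in>UNIV - {i}. \<gamma> i j / (x $ i - x $ j))"

text \<open>Solutions on \<open>[0, T]\<close> that stay in the chamber. The square-integrable Ito integral is the
  appropriate one here because it is only applied to bounded coefficients \<open>\<sigma>\<close>.\<close>

definition chamber_sde_solution ::
    "'a measure \<Rightarrow> (real \<Rightarrow> 'a measure) \<Rightarrow> (real \<Rightarrow> 'a \<Rightarrow> real ^ 'd::{finite,linorder}) \<Rightarrow> real \<Rightarrow>
     ('d \<Rightarrow> 'd \<Rightarrow> real) \<Rightarrow> ('d \<Rightarrow> real ^ 'd::{finite,linorder} \<Rightarrow> real) \<Rightarrow> ('d \<Rightarrow> 'd \<Rightarrow> real ^ 'd::{finite,linorder} \<Rightarrow> real) \<Rightarrow>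
     (real \<Rightarrow> 'a \<Rightarrow> real ^ 'd::{finite,linorder}) \<Rightarrow> bool" where
  "chamber_sde_solution M F W T \<gamma> b \<sigma> X \<longleftrightarrow>
     (\<forall>t\<in>{0..T}. X t \<in> borel_measurable (F t)) \<and>
     (AE \<omega> in M. continuous_on {0..T} (\<lambda>t. X t \<omega>)) \<and>
     (AE \<omega> in M. \<forall>t\<in>{0..T}. X t \<omega> \<in> ordered_chamber) \<and>
     (\<forall>i. AE \<omega> in M.
        set_integrable lborel {0..T} (\<lambda>t. repulsion \<gamma> (X t \<omega>) i + b i (X t \<omega>))) \<and>
     (\<exists>I. (\<forall>i j. ito_integral M F T (\<lambda>t \<omega>. W t \<omega> $ j) (\<lambda>t \<omega>. \<sigma> i j (X t \<omega>)) (I i j)) \<and>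
          (\<forall>i. AE \<omega> in M. \<forall>t\<in>{0..T}.
             X t \<omega> $ i = X 0 \<omega> $ i
               + (LINT r:{0..t}|lborel. repulsion \<gamma> (X r \<omega>) i + b i (X r \<omega>))
               + (\<Sum>j\<in>UNIV. I i j t \<omega>)))"

definition grid :: "real \<Rightarrow> nat \<Rightarrow> nat \<Rightarrow> real" where
  "grid T n k = real k * T / real n"

text \<open>\<open>semi_implicit_EM \<gamma> b \<sigma> W T X0 n k\<close> is \<open>X\<^sup>(\<^sup>n\<^sup>)(t\<^sub>k)\<close>, started from the random vector \<open>X0\<close>.\<close>

primrec semi_implicit_EM ::
    "('d \<Rightarrow> 'd \<Rightarrow> real) \<Rightarrow> ('d \<Rightarrow> real ^ 'd::{finite,linorder} \<Rightarrow> real) \<Rightarrow> ('d \<Rightarrow> 'd \<Rightarrow> real ^ 'd::{finite,linorder} \<Rightarrow> real) \<Rightarrow>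
     (real \<Rightarrow> 'a \<Rightarrow> real ^ 'd::{finite,linorder}) \<Rightarrow> real \<Rightarrow> ('a \<Rightarrow> real ^ 'd::{finite,linorder}) \<Rightarrow> nat \<Rightarrow> nat \<Rightarrow>
     'a \<Rightarrow> real ^ 'd::{finite,linorder}" where
  "semi_implicit_EM \<gamma> b \<sigma> W T X0 n 0 = X0"
| "semi_implicit_EM \<gamma> b \<sigma> W T X0 n (Suc k) = (\<lambda>\<omega>.
     let x = semi_implicit_EM \<gamma> b \<sigma> W T X0 n k \<omega> in
     THE y. y \<in> ordered_chamber \<and>
       (\<forall>i. y $ i = x $ i + (repulsion \<gamma> y i + b i x) * (T / real n)
              + (\<Sum>j\<in>UNIV. \<sigma> i j x * (W (grid T n (Suc k)) \<omega> $ j - W (grid T n k) \<omega> $ j))))"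

end

theory Submission
  imports Defs
begin

text \<open>Write \<open>f\<close> for the repulsion, \<open>h = T / n\<close> for the step size, \<open>X\<^sub>k\<close> for the solution at the grid point
  \<open>t\<^sub>k = k h\<close>, \<open>Y\<^sub>k\<close> for the scheme and \<open>e\<^sub>k = X\<^sub>k - Y\<^sub>k\<close> for the error.

  The repulsion is the gradient of a concave function, so \<open>(x - y) \<bullet> (f x - f y) \<le> 0\<close> on the chamber
  (\<open>repulsion_monotone\<close>). Therefore the implicit equation \<open>y = z + h f y\<close> has a unique solution in the
  chamber, the minimum of a coercive energy (\<open>implicit_step_exists\<close>), and this solution depends on \<open>z\<close> in
  a nonexpansive way (\<open>implicit_step_contraction\<close>). The repulsion thus drops out of the comparison of the
  scheme with the solution, and what remains are the gaps of the solution, whose inverses have moments.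

  The solution satisfies the same recursion as the scheme up to a perturbation, and the contraction
  property yields \<open>norm (e\<^sub>k\<^sub>+\<^sub>1) \<le> norm (e\<^sub>k + D\<^sub>k + N\<^sub>k)\<close>. Here \<open>D\<^sub>k\<close> consists of a Lipschitz term in \<open>e\<^sub>k\<close> of size \<open>h\<close> and of
  the time integral of \<open>f (X\<^sub>r) - f (X\<^sub>k\<^sub>+\<^sub>1) + b (X\<^sub>r) - b (X\<^sub>k)\<close>. The second moment of the latter is of order \<open>h\<^sup>3\<close>, since a difference
  of inverse gaps is the product of a displacement and of two inverse gaps, each of which has a sixth
  moment (\<open>drift_error_moment\<close>). The noise \<open>N\<^sub>k\<close> is orthogonal to the past, and its second moment given the
  past is of order \<open>h\<close>, because \<open>\<sigma>\<close> is bounded; in the mean it is at most of order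
  \<open>h * expectation ((norm (e\<^sub>k))\<^sup>2) + h\<^sup>2\<close>, because \<open>\<sigma>\<close> is Lipschitz. Both facts follow from \<open>ito_increment\<close>, which extracts
  them from the definition of the Ito integral as a limit in mean square of integrals of step functions.

  Expanding the square gives \<open>(norm (e\<^sub>k\<^sub>+\<^sub>1))\<^sup>2 \<le> (norm (e\<^sub>k))\<^sup>2 + 2 * P\<^sub>k + Q\<^sub>k\<close> with \<open>P\<^sub>k = e\<^sub>k \<bullet> N\<^sub>k\<close>
  (\<open>one_step_error\<close>). Taking expectations removes the martingale difference \<open>P\<^sub>k\<close>, and a discrete Gronwall
  argument shows that the mean square error is of order \<open>h\<close>. For the maximum over all grid points the sum of
  the \<open>P\<^sub>k\<close> has to be controlled uniformly. Its variance is the sum of \<open>n\<close> terms of order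
  \<open>h * expectation ((norm (e\<^sub>k))\<^sup>2)\<close>, hence of order \<open>h\<close>, and by the \<open>L\<^sup>2\<close> maximal inequality \<open>Doob_L2\<close> its maximum is
  of order \<open>sqrt h\<close> in mean. This is the reason for the exponent \<open>1 / 4\<close> (\<open>recursive_maximal_bound\<close>).\<close>

section \<open>Monotonicity of the repulsion\<close>

lemma adjacent_successor:
  fixes i j :: "'d::{finite,linorder}"
  assumes "i < j"
  obtains k where "(i, k) \<in> adjacent" "k \<le> j"
proof
  let ?k = "Min {i<..}"
  have ne: "{i<..} \<noteq> {}" using assms by auto
  have "?k \<in> {i<..}" using ne by (intro Min_in) auto
  then show "(i, ?k) \<in> adjacent"
    unfolding adjacent_def by (auto simp del: Min_gr_iff) (meson Min_le finite greaterThan_iff not_le)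
  show "?k \<le> j" using assms by (intro Min_le) auto
qed

lemma ordered_chamber_adjacentI:
  fixes x :: "real ^ 'd::{finite,linorder}"
  assumes "\<And>a b. (a, b) \<in> adjacent \<Longrightarrow> x $ a < x $ b"
  shows "x \<in> ordered_chamber"
proof -
  have "x $ i < x $ j" if "i < j" for i j
    using that
  proof (induction "card {i<..j}" arbitrary: i rule: less_induct)
    case less
    obtain k where k: "(i, k) \<in> adjacent" "k \<le> j"
      using adjacent_successor[OF less.prems] .
    then have "i < k" by (auto simp: adjacent_def)
    show ?case
    proof (cases "k = j")
      case False
      with k(2) have "k < j" by simp
      moreover have "card {k<..j} < card {i<..j}"
        using \<open>i < k\<close> k(2) by (intro psubset_card_mono) auto
      ultimately have "x $ k < x $ j" using less.hyps by blast
      with assms[OF k(1)] show ?thesis by simp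
    qed (use assms[OF k(1)] in auto)
  qed
  then show ?thesis by (auto simp: ordered_chamber_def)
qed

lemma chamber_distinct:
  "x \<in> ordered_chamber \<Longrightarrow> i \<noteq> j \<Longrightarrow> x $ i \<noteq> x $ j"
  unfolding ordered_chamber_def by (metis (mono_tags, lifting) mem_Collect_eq neq_iff order_less_irrefl)

lemma chamber_nonempty: "(ordered_chamber :: (real ^ 'd::{finite,linorder}) set) \<noteq> {}"
proof -
  have "card {..<i} < card {..<j}" if "i < j" for i j :: "'d::{finite,linorder}"
    using that by (intro psubset_card_mono) auto
  then have "(\<chi> i. real (card {..<i})) \<in> (ordered_chamber :: (real ^ 'd::{finite,linorder}) set)"
    by (auto simp: ordered_chamber_def)
  then show ?thesis by auto
qed

text \<open>The diagonal term is a division by zero and therefore vanishes.\<close>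

lemma repulsion_UNIV: "repulsion \<gamma> x i = (\<Sum>j\<in>UNIV. \<gamma> i j / (x $ i - x $ j))"
proof -
  have "(\<Sum>j\<in>UNIV. \<gamma> i j / (x $ i - x $ j)) = \<gamma> i i / (x $ i - x $ i) + repulsion \<gamma> x i"
    unfolding repulsion_def by (rule sum.remove) auto
  then show ?thesis by simp
qed

text \<open>The repulsion is the gradient of the concave function \<open>\<Sum>\<^sub>i\<^sub><\<^sub>j \<gamma> i j * ln (x $ j - x $ i)\<close>, so it is a
  monotone (decreasing) vector field. Concretely, the symmetry of \<open>\<gamma>\<close> allows one to pair the terms
  \<open>(i, j)\<close> and \<open>(j, i)\<close>, which leaves products \<open>(p - q) * (1 / p - 1 / q)\<close> of gaps \<open>p\<close>, \<open>q\<close> with the same sign.\<close>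

lemma repulsion_monotone:
  fixes x y :: "real ^ 'd::{finite,linorder}"
  assumes \<gamma>: "\<And>i j. i \<noteq> j \<Longrightarrow> \<gamma> i j = \<gamma> j i \<and> \<gamma> i j \<ge> 0"
    and x: "x \<in> ordered_chamber" and y: "y \<in> ordered_chamber"
  shows "(\<Sum>i\<in>UNIV. (x $ i - y $ i) * (repulsion \<gamma> x i - repulsion \<gamma> y i)) \<le> 0" (is "?S \<le> 0")
proof -
  define g where "g i j = \<gamma> i j * (1 / (x $ i - x $ j) - 1 / (y $ i - y $ j))" for i j
  define u where "u i = x $ i - y $ i" for i
  have anti: "g j i = - g i j" for i j
  proof (cases "i = j")
    case False
    have "1 / (x $ j - x $ i) = - (1 / (x $ i - x $ j))" "1 / (y $ j - y $ i) = - (1 / (y $ i - y $ j))"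
      by (metis minus_diff_eq minus_divide_right)+
    then show ?thesis using \<gamma>[OF False] by (simp add: g_def algebra_simps)
  qed (simp add: g_def)
  have S: "?S = (\<Sum>i\<in>UNIV. \<Sum>j\<in>UNIV. u i * g i j)"
    by (simp add: repulsion_UNIV u_def g_def sum_distrib_left sum_subtractf right_diff_distrib)
  also have "\<dots> = (\<Sum>i\<in>UNIV. \<Sum>j\<in>UNIV. - (u j * g i j))"
  proof (subst sum.swap, intro sum.cong refl)
    fix i j show "u j * g j i = - (u j * g i j)" by (simp add: anti[of j i])
  qed
  finally have S': "?S = (\<Sum>i\<in>UNIV. \<Sum>j\<in>UNIV. - (u j * g i j))" .
  have "2 * ?S = (\<Sum>i\<in>UNIV. \<Sum>j\<in>UNIV. (u i - u j) * g i j)"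
    unfolding mult_2 by (subst S, subst S') (simp add: sum.distrib[symmetric] left_diff_distrib)
  also have "\<dots> \<le> 0"
  proof (intro sum_nonpos)
    fix i j :: 'd
    show "(u i - u j) * g i j \<le> 0"
    proof (cases "i = j")
      case False
      define p q where "p = x $ i - x $ j" and "q = y $ i - y $ j"
      have pq: "p * q > 0"
        using x y False unfolding p_def q_def ordered_chamber_def
        by (cases i j rule: linorder_cases) (auto simp: mult_neg_neg)
      then have "p \<noteq> 0" "q \<noteq> 0" by auto
      then have "(p - q) * (1 / p - 1 / q) = - ((p - q)\<^sup>2 / (p * q))"
        by (simp add: field_simps power2_eq_square)
      also have "\<dots> \<le> 0" using pq by simp
      finally have "(p - q) * (1 / p - 1 / q) \<le> 0" .
      then have "\<gamma> i j * ((p - q) * (1 / p - 1 / q)) \<le> 0"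
        using \<gamma>[OF False] by (simp add: mult_nonneg_nonpos)
      moreover have "(u i - u j) * g i j = \<gamma> i j * ((p - q) * (1 / p - 1 / q))"
        unfolding u_def g_def p_def q_def by (simp add: mult.left_commute)
      ultimately show ?thesis by simp
    qed (simp add: g_def)
  qed
  finally show ?thesis by simp
qed

lemma inner_eq_sum: "(x :: real ^ 'd::finite) \<bullet> y = (\<Sum>i\<in>UNIV. x $ i * y $ i)"
  by (simp add: inner_vec_def)

lemma norm_vec_sq: "(norm (x :: real ^ 'd::finite))\<^sup>2 = (\<Sum>i\<in>UNIV. (x $ i)\<^sup>2)"
  by (simp add: norm_eq_sqrt_inner inner_vec_def power2_eq_square sum_nonneg)

section \<open>Solvability of the implicit equation\<close>

text \<open>Solving \<open>x = z + h f(x)\<close> for a monotone \<open>f\<close> does not increase distances: pair the difference of the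
  two equations with \<open>x - y\<close>; the contribution of the repulsion has a favourable sign. This is the
  stability of the scheme, however close its particles are. With \<open>z = z'\<close> it gives uniqueness.\<close>

lemma implicit_step_contraction:
  fixes x y z z' :: "real ^ 'd::{finite,linorder}"
  assumes \<gamma>: "\<And>i j. i \<noteq> j \<Longrightarrow> \<gamma> i j = \<gamma> j i \<and> \<gamma> i j \<ge> 0" and h: "h \<ge> 0"
    and x: "x \<in> ordered_chamber" "\<And>i. x $ i = z $ i + repulsion \<gamma> x i * h"
    and y: "y \<in> ordered_chamber" "\<And>i. y $ i = z' $ i + repulsion \<gamma> y i * h"
  shows "norm (x - y) \<le> norm (z - z')"
proof -
  have "(norm (x - y))\<^sup>2 = (\<Sum>i\<in>UNIV. (x $ i - y $ i) * (x $ i - y $ i))"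
    by (simp only: norm_vec_sq) (simp add: power2_eq_square)
  also have "\<dots> = (\<Sum>i\<in>UNIV. (x $ i - y $ i) * (z $ i - z' $ i)
      + h * ((x $ i - y $ i) * (repulsion \<gamma> x i - repulsion \<gamma> y i)))"
  proof (intro sum.cong refl)
    fix i
    have "x $ i - y $ i = (z $ i - z' $ i) + h * (repulsion \<gamma> x i - repulsion \<gamma> y i)"
      using x(2)[of i] y(2)[of i] by (simp add: algebra_simps)
    then show "(x $ i - y $ i) * (x $ i - y $ i) = (x $ i - y $ i) * (z $ i - z' $ i)
      + h * ((x $ i - y $ i) * (repulsion \<gamma> x i - repulsion \<gamma> y i))"
      by (metis distrib_left mult.left_commute)
  qed
  also have "\<dots> = (x - y) \<bullet> (z - z')
      + h * (\<Sum>i\<in>UNIV. (x $ i - y $ i) * (repulsion \<gamma> x i - repulsion \<gamma> y i))"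
    by (simp add: inner_eq_sum sum.distrib sum_distrib_left)
  also have "\<dots> \<le> (x - y) \<bullet> (z - z')"
    using mult_nonneg_nonpos[OF h repulsion_monotone[OF \<gamma> x(1) y(1)]] by simp
  also have "\<dots> \<le> norm (x - y) * norm (z - z')"
    by (rule norm_cauchy_schwarz)
  finally show ?thesis
    by (metis mult_le_cancel_left_pos norm_ge_zero order_le_less power2_eq_square)
qed

text \<open>At infinity the logarithmic part of the energy below is dominated by its quadratic part.\<close>

lemma log_barrier_bound:
  fixes w :: real
  assumes "w \<noteq> 0" shows "ln (w\<^sup>2) \<le> 2 * \<bar>w\<bar>"
proof -
  have "ln (w\<^sup>2) = 2 * ln \<bar>w\<bar>"
    using assms by (metis abs_0_eq abs_ge_zero ln_realpow of_nat_numeral order_le_less power2_abs)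
  also have "ln \<bar>w\<bar> \<le> \<bar>w\<bar>" using ln_le_minus_one[of "\<bar>w\<bar>"] assms by simp
  finally show ?thesis by simp
qed

text \<open>The function whose critical points in the chamber solve the implicit equation. The logarithm of the
  square needs no knowledge of the sign of the gap. Every pair occurs twice and squaring doubles
  the logarithm, hence the factor \<open>1 / 4\<close>.\<close>

definition log_gas_energy ::
    "('d \<Rightarrow> 'd \<Rightarrow> real) \<Rightarrow> real \<Rightarrow> real ^ 'd::finite \<Rightarrow> real ^ 'd \<Rightarrow> real" where
  "log_gas_energy \<gamma> h z y =
     (norm (y - z))\<^sup>2 / 2 - h / 4 * (\<Sum>i\<in>UNIV. \<Sum>j\<in>UNIV - {i}. \<gamma> i j * ln ((y $ i - y $ j)\<^sup>2))"

text \<open>The particle \<open>k\<close> occurs in the double sum both as \<open>i\<close> and as \<open>j\<close>; because \<open>\<gamma>\<close> is symmetric both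
  occurrences contribute the same amount.\<close>

lemma log_gas_energy_derivative:
  fixes y z :: "real ^ 'd::{finite,linorder}"
  assumes \<gamma>: "\<And>i j. i \<noteq> j \<Longrightarrow> \<gamma> i j = \<gamma> j i \<and> \<gamma> i j \<ge> 0" and y: "y \<in> ordered_chamber"
  shows "((\<lambda>t. log_gas_energy \<gamma> h z (y + t *\<^sub>R axis k 1)) has_real_derivative
           (y $ k - z $ k - h * repulsion \<gamma> y k)) (at 0)"
proof -
  define \<delta> where "\<delta> i = (if i = k then 1 else 0 :: real)" for i
  have ax: "(y + t *\<^sub>R axis k 1) $ i = y $ i + t * \<delta> i" for t i
    by (simp add: \<delta>_def axis_def)
  have E: "log_gas_energy \<gamma> h z (y + t *\<^sub>R axis k 1) =
     (\<Sum>i\<in>UNIV. (y $ i + t * \<delta> i - z $ i)\<^sup>2) / 2 -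
     h / 4 * (\<Sum>i\<in>UNIV. \<Sum>j\<in>UNIV - {i}. \<gamma> i j * ln ((y $ i + t * \<delta> i - (y $ j + t * \<delta> j))\<^sup>2))" for t
    unfolding log_gas_energy_def norm_vec_sq vector_minus_component ax by simp
  have D1: "((\<lambda>t. (\<Sum>i\<in>UNIV. (y $ i + t * \<delta> i - z $ i)\<^sup>2)) has_real_derivative
      (\<Sum>i\<in>UNIV. 2 * (y $ i - z $ i) * \<delta> i)) (at 0)"
    by (auto intro!: derivative_eq_intros sum.cong simp: algebra_simps)
  have D2: "((\<lambda>t. \<gamma> i j * ln ((y $ i + t * \<delta> i - (y $ j + t * \<delta> j))\<^sup>2)) has_real_derivative
      \<gamma> i j * (2 * (\<delta> i - \<delta> j) / (y $ i - y $ j))) (at 0)" if "i \<noteq> j" for i j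
  proof -
    have "y $ i - y $ j \<noteq> 0" using chamber_distinct[OF y that] by simp
    then have "0 < (y $ i - y $ j)\<^sup>2" by simp
    then show ?thesis
      by (auto intro!: derivative_eq_intros simp: divide_simps) (simp add: power2_eq_square algebra_simps)
  qed
  have D3: "((\<lambda>t. (\<Sum>i\<in>UNIV. \<Sum>j\<in>UNIV - {i}. \<gamma> i j * ln ((y $ i + t * \<delta> i - (y $ j + t * \<delta> j))\<^sup>2)))
      has_real_derivative (\<Sum>i\<in>UNIV. \<Sum>j\<in>UNIV - {i}. \<gamma> i j * (2 * (\<delta> i - \<delta> j) / (y $ i - y $ j)))) (at 0)"
    by (intro DERIV_sum D2) auto
  have S1: "(\<Sum>i\<in>UNIV. 2 * (y $ i - z $ i) * \<delta> i) = 2 * (y $ k - z $ k)"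
    by (simp add: \<delta>_def if_distrib[of "\<lambda>x. _ * x"] cong: if_cong)
  have S2: "(\<Sum>i\<in>UNIV. \<Sum>j\<in>UNIV - {i}. \<gamma> i j * (2 * (\<delta> i - \<delta> j) / (y $ i - y $ j))) = 4 * repulsion \<gamma> y k"
  proof -
    define g where "g i j = \<gamma> i j / (y $ i - y $ j)" for i j
    have anti: "g j i = - g i j" for i j
    proof (cases "i = j")
      case False
      have "1 / (y $ j - y $ i) = - (1 / (y $ i - y $ j))"
        by (metis minus_diff_eq minus_divide_right)
      then show ?thesis using \<gamma>[OF False] by (simp add: g_def divide_inverse)
    qed (simp add: g_def)
    have "(\<Sum>i\<in>UNIV. \<Sum>j\<in>UNIV - {i}. \<gamma> i j * (2 * (\<delta> i - \<delta> j) / (y $ i - y $ j)))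
        = (\<Sum>i\<in>UNIV. \<Sum>j\<in>UNIV. \<gamma> i j * (2 * (\<delta> i - \<delta> j) / (y $ i - y $ j)))"
      by (intro sum.cong refl sum.mono_neutral_left) auto
    also have "\<dots> = (\<Sum>i\<in>UNIV. \<Sum>j\<in>UNIV. 2 * (\<delta> i * g i j) - 2 * (\<delta> j * g i j))"
      by (intro sum.cong refl) (simp add: g_def algebra_simps diff_divide_distrib)
    also have "\<dots> = 2 * (\<Sum>i\<in>UNIV. \<Sum>j\<in>UNIV. \<delta> i * g i j) - 2 * (\<Sum>i\<in>UNIV. \<Sum>j\<in>UNIV. \<delta> j * g i j)"
      by (simp add: sum_subtractf sum_distrib_left)
    also have "(\<Sum>i\<in>UNIV. \<Sum>j\<in>UNIV. \<delta> i * g i j) = repulsion \<gamma> y k"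
      unfolding sum_distrib_left[symmetric]
      by (simp add: \<delta>_def g_def repulsion_UNIV if_distrib[of "\<lambda>x. x * _"] cong: if_cong)
    also have "(\<Sum>i\<in>UNIV. \<Sum>j\<in>UNIV. \<delta> j * g i j) = - repulsion \<gamma> y k"
    proof -
      have "(\<Sum>i\<in>UNIV. \<Sum>j\<in>UNIV. \<delta> j * g i j) = (\<Sum>i\<in>UNIV. g i k)"
        by (intro sum.cong refl) (simp add: \<delta>_def if_distrib[of "\<lambda>x. x * _"] cong: if_cong)
      also have "\<dots> = (\<Sum>i\<in>UNIV. - g k i)" by (intro sum.cong refl anti)
      finally show ?thesis by (simp add: repulsion_UNIV g_def sum_negf)
    qed
    finally show ?thesis by simp
  qed
  show ?thesis
    unfolding E using DERIV_diff[OF DERIV_cdivide[OF D1, of 2] DERIV_cmult[OF D3, of "h / 4"]]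
    unfolding S1 S2 by (simp add: algebra_simps add_divide_distrib diff_divide_distrib)
qed

lemma quadratic_growth_bound:
  fixes p \<alpha> \<beta> :: real
  assumes "p\<^sup>2 / 2 \<le> \<alpha> + \<beta> * p" "0 \<le> p" "0 \<le> \<beta>"
  shows "p \<le> 2 * \<beta> + 2 * \<bar>\<alpha>\<bar> + 1"
proof (rule ccontr)
  assume "\<not> ?thesis"
  then have *: "p / 2 - \<beta> \<ge> \<bar>\<alpha>\<bar> + 1 / 2" "p \<ge> 1" using assms by auto
  then have "p * (p / 2 - \<beta>) \<ge> 1 * (\<bar>\<alpha>\<bar> + 1 / 2)" by (intro mult_mono) auto
  moreover have "p * (p / 2 - \<beta>) \<le> \<alpha>" using assms(1) by (simp add: algebra_simps power2_eq_square)
  ultimately show False by simp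
qed

lemma gap_le_norm: "\<bar>(y :: real ^ 'd::finite) $ i - y $ j\<bar> \<le> 2 * norm y"
  using component_le_norm_cart[of y i] component_le_norm_cart[of y j] by linarith

text \<open>The logarithms grow at most linearly, so a bound on the energy first bounds \<open>norm (y - z)\<close>. Then every
  single barrier term with positive weight is bounded too, which keeps the neighbouring particles
  apart. Sublevel sets are thus compact subsets of the open chamber.\<close>

lemma log_gas_energy_coercive:
  fixes z :: "real ^ 'd::{finite,linorder}"
  assumes \<gamma>: "\<And>i j. i \<noteq> j \<Longrightarrow> \<gamma> i j = \<gamma> j i \<and> \<gamma> i j \<ge> 0"
    and \<gamma>_adj: "\<And>i j. (i, j) \<in> adjacent \<Longrightarrow> \<gamma> i j > 0" and h: "h > 0"
  shows "\<exists>R \<epsilon>. (\<forall>a b. \<epsilon> a b > (0 :: real)) \<and>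
    (\<forall>y\<in>ordered_chamber. log_gas_energy \<gamma> h z y \<le> c \<longrightarrow>
       norm (y - z) \<le> R \<and> (\<forall>(a, b)\<in>adjacent. y $ b - y $ a \<ge> \<epsilon> a b))"
proof -
  define \<Gamma> where "\<Gamma> = (\<Sum>i\<in>UNIV. \<Sum>j\<in>UNIV - {i}. \<gamma> i j)"
  define R where "R = 2 * (h * \<Gamma>) + 2 * \<bar>c + h * \<Gamma> * norm z\<bar> + 1"
  define \<kappa> where "\<kappa> a b = 4 * (c + h * \<Gamma> * (R + norm z)) / (h * \<gamma> a b)" for a b
  define \<epsilon> where "\<epsilon> a b = min 1 (exp (- \<kappa> a b))" for a b
  have \<Gamma>0: "\<Gamma> \<ge> 0" unfolding \<Gamma>_def using \<gamma> by (intro sum_nonneg) auto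
  have main: "norm (y - z) \<le> R \<and> (\<forall>(a, b)\<in>adjacent. y $ b - y $ a \<ge> \<epsilon> a b)"
    if y: "y \<in> ordered_chamber" and c: "log_gas_energy \<gamma> h z y \<le> c" for y
  proof -
    have ln_le: "ln ((y $ i - y $ j)\<^sup>2) \<le> 4 * norm y" if "i \<noteq> j" for i j
      using log_barrier_bound[of "y $ i - y $ j"] chamber_distinct[OF y that] gap_le_norm[of y i j] by simp
    (* Subtracting the linear bound makes every barrier term nonnegative, so that each is at most their sum. *)
    define t where "t i j = \<gamma> i j * (4 * norm y - ln ((y $ i - y $ j)\<^sup>2))" for i j
    have t0: "t i j \<ge> 0" if "i \<noteq> j" for i j
      unfolding t_def using \<gamma>[OF that] ln_le[OF that] by simp
    have "(\<Sum>i\<in>UNIV. \<Sum>j\<in>UNIV - {i}. t i j) =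
        \<Gamma> * (4 * norm y) - (\<Sum>i\<in>UNIV. \<Sum>j\<in>UNIV - {i}. \<gamma> i j * ln ((y $ i - y $ j)\<^sup>2))"
      unfolding t_def \<Gamma>_def by (simp only: right_diff_distrib sum_subtractf sum_distrib_right)
    then have "h / 4 * (\<Sum>i\<in>UNIV. \<Sum>j\<in>UNIV - {i}. t i j) = h * \<Gamma> * norm y
        - h / 4 * (\<Sum>i\<in>UNIV. \<Sum>j\<in>UNIV - {i}. \<gamma> i j * ln ((y $ i - y $ j)\<^sup>2))"
      by (simp only: right_diff_distrib)
    then have energy: "(norm (y - z))\<^sup>2 / 2 + h / 4 * (\<Sum>i\<in>UNIV. \<Sum>j\<in>UNIV - {i}. t i j) \<le> c + h * \<Gamma> * norm y"
      using c unfolding log_gas_energy_def by linarith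
    have tsum0: "(\<Sum>i\<in>UNIV. \<Sum>j\<in>UNIV - {i}. t i j) \<ge> 0"
      by (intro sum_nonneg) (use t0 in auto)
    have ny: "norm y \<le> norm (y - z) + norm z"
      using norm_triangle_ineq[of "y - z" z] by simp
    have "h * \<Gamma> * norm y \<le> h * \<Gamma> * (norm (y - z) + norm z)"
      using ny \<Gamma>0 h by (intro mult_left_mono) auto
    moreover have "0 \<le> h / 4 * (\<Sum>i\<in>UNIV. \<Sum>j\<in>UNIV - {i}. t i j)" using tsum0 h by simp
    ultimately have "(norm (y - z))\<^sup>2 / 2 \<le> (c + h * \<Gamma> * norm z) + h * \<Gamma> * norm (y - z)"
      using energy by (simp add: distrib_left)
    then have R: "norm (y - z) \<le> R"
      unfolding R_def by (rule quadratic_growth_bound) (use h \<Gamma>0 in auto)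
    have "y $ b - y $ a \<ge> \<epsilon> a b" if ab: "(a, b) \<in> adjacent" for a b
    proof -
      have lt: "a < b" using ab by (simp add: adjacent_def)
      then have gap: "y $ b - y $ a > 0" using y by (simp add: ordered_chamber_def)
      have "t a b \<le> (\<Sum>j\<in>UNIV - {a}. t a j)"
        by (rule member_le_sum[of b]) (use lt t0[of a] in auto)
      also have "\<dots> \<le> (\<Sum>i\<in>UNIV. \<Sum>j\<in>UNIV - {i}. t i j)"
        by (rule member_le_sum[of a]) (auto intro!: sum_nonneg t0)
      finally have "h / 4 * t a b \<le> h / 4 * (\<Sum>i\<in>UNIV. \<Sum>j\<in>UNIV - {i}. t i j)"
        using h by simp
      also have "\<dots> \<le> c + h * \<Gamma> * norm y" using energy zero_le_power2[of "norm (y - z)"] by linarith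
      also have "\<dots> \<le> c + h * \<Gamma> * (R + norm z)"
        using R ny h \<Gamma>0 by (intro add_left_mono mult_left_mono) auto
      finally have "h / 4 * t a b \<le> c + h * \<Gamma> * (R + norm z)" .
      moreover have "h / 4 * t a b \<ge> h / 4 * (\<gamma> a b * (- ln ((y $ a - y $ b)\<^sup>2)))"
        unfolding t_def using h \<gamma>_adj[OF ab] by (intro mult_left_mono) auto
      ultimately have "h / 4 * (\<gamma> a b * (- ln ((y $ a - y $ b)\<^sup>2))) \<le> c + h * \<Gamma> * (R + norm z)" by linarith
      then have "- ln ((y $ a - y $ b)\<^sup>2) \<le> \<kappa> a b"
        unfolding \<kappa>_def using h \<gamma>_adj[OF ab] by (simp add: field_simps)
      then have "exp (- \<kappa> a b) \<le> exp (ln ((y $ a - y $ b)\<^sup>2))" by simp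
      also have "\<dots> = (y $ b - y $ a)\<^sup>2" using gap by (subst exp_ln) (auto simp: power2_commute)
      finally have e: "exp (- \<kappa> a b) \<le> (y $ b - y $ a)\<^sup>2" .
      show ?thesis
      proof (cases "y $ b - y $ a \<ge> 1")
        case False
        then have "(y $ b - y $ a)\<^sup>2 \<le> y $ b - y $ a"
          using gap by (simp add: power2_eq_square mult_le_cancel_right1)
        with e show ?thesis by (simp add: \<epsilon>_def)
      qed (simp add: \<epsilon>_def)
    qed
    with R show ?thesis by auto
  qed
  moreover have "\<epsilon> a b > 0" for a b by (simp add: \<epsilon>_def)
  ultimately show ?thesis by blast
qed

lemma chamber_along_axis:
  fixes y :: "real ^ 'd::{finite,linorder}"
  assumes y: "y \<in> ordered_chamber"
  obtains \<delta> where "\<delta> > 0" "\<And>t. \<bar>t\<bar> < \<delta> \<Longrightarrow> y + t *\<^sub>R axis k 1 \<in> ordered_chamber"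
proof -
  have "open (ordered_chamber :: (real ^ 'd::{finite,linorder}) set)"
  proof -
    have "ordered_chamber = (\<Inter>(i, j)\<in>{(i :: 'd, j). i < j}. {x :: real ^ 'd::{finite,linorder}. x $ i < x $ j})"
      by (auto simp: ordered_chamber_def)
    also have "open \<dots>"
      by (intro open_INT) (auto intro!: open_Collect_less continuous_intros)
    finally show ?thesis .
  qed
  then obtain e where e: "e > 0" "ball y e \<subseteq> ordered_chamber"
    using y open_contains_ball_eq[of ordered_chamber] by auto
  show thesis
  proof (rule that[OF e(1)])
    fix t :: real assume "\<bar>t\<bar> < e"
    then show "y + t *\<^sub>R axis k 1 \<in> ordered_chamber"
      by (intro subsetD[OF e(2)]) (simp add: dist_norm)
  qed
qed

text \<open>The energy has a minimum in the chamber; the chamber is open, so all partial derivatives vanish there.\<close>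

lemma implicit_step_exists:
  fixes z :: "real ^ 'd::{finite,linorder}"
  assumes \<gamma>: "\<And>i j. i \<noteq> j \<Longrightarrow> \<gamma> i j = \<gamma> j i \<and> \<gamma> i j \<ge> 0"
    and \<gamma>_adj: "\<And>i j. (i, j) \<in> adjacent \<Longrightarrow> \<gamma> i j > 0" and h: "h > 0"
  obtains y where "y \<in> ordered_chamber" "\<And>i. y $ i = z $ i + repulsion \<gamma> y i * h"
proof -
  let ?G = "log_gas_energy \<gamma> h z"
  obtain y0 :: "real ^ 'd::{finite,linorder}" where y0: "y0 \<in> ordered_chamber" using chamber_nonempty by blast
  have "\<exists>R \<epsilon>. (\<forall>a b. \<epsilon> a b > (0 :: real)) \<and>
    (\<forall>y\<in>ordered_chamber. ?G y \<le> ?G y0 \<longrightarrow>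
       norm (y - z) \<le> R \<and> (\<forall>(a, b)\<in>adjacent. y $ b - y $ a \<ge> \<epsilon> a b))"
    by (rule log_gas_energy_coercive) (fact \<gamma> \<gamma>_adj h)+
  then obtain R \<epsilon> where \<epsilon>: "\<And>a b. \<epsilon> a b > (0 :: real)" and
    coercive: "\<forall>y\<in>ordered_chamber. ?G y \<le> ?G y0 \<longrightarrow>
       norm (y - z) \<le> R \<and> (\<forall>(a, b)\<in>adjacent. y $ b - y $ a \<ge> \<epsilon> a b)"
    by blast
  define K where "K = cball z R \<inter> (\<Inter>(a, b)\<in>adjacent. {y. y $ b - y $ a \<ge> \<epsilon> a b})"
  have "compact K" unfolding K_def
    by (intro compact_Int_closed compact_cball closed_INT) (auto intro!: closed_Collect_le continuous_intros)
  have K: "K \<subseteq> ordered_chamber"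
  proof
    fix y assume "y \<in> K"
    show "y \<in> ordered_chamber"
    proof (rule ordered_chamber_adjacentI)
      fix a b :: 'd assume "(a, b) \<in> adjacent"
      with \<open>y \<in> K\<close> have "\<epsilon> a b \<le> y $ b - y $ a" by (auto simp: K_def)
      with \<epsilon>[of a b] show "y $ a < y $ b" by simp
    qed
  qed
  have in_K: "y \<in> K" if "y \<in> ordered_chamber" "?G y \<le> ?G y0" for y
    using coercive that by (auto simp: K_def dist_norm norm_minus_commute)
  have "continuous_on K ?G"
    unfolding log_gas_energy_def
  proof (intro continuous_intros ballI)
    fix y i j assume "y \<in> K" "j \<in> UNIV - {i :: 'd}"
    then show "(y $ i - y $ j)\<^sup>2 \<noteq> 0" using chamber_distinct[of y i j] K by auto
  qed simp
  moreover have "y0 \<in> K" using in_K[OF y0] by simp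
  ultimately obtain y where y: "y \<in> K" "\<And>x. x \<in> K \<Longrightarrow> ?G y \<le> ?G x"
    using continuous_attains_inf[OF \<open>compact K\<close>, of ?G] by auto
  then have yc: "y \<in> ordered_chamber" using K by auto
  have minimal: "?G y \<le> ?G x" if "x \<in> ordered_chamber" for x
    using that in_K[of x] y(2)[of x] y(2)[OF \<open>y0 \<in> K\<close>] by (cases "?G x \<le> ?G y0") auto
  have "y $ k = z $ k + repulsion \<gamma> y k * h" for k
  proof -
    obtain \<delta> where \<delta>: "\<delta> > 0" "\<And>t. \<bar>t\<bar> < \<delta> \<Longrightarrow> y + t *\<^sub>R axis k 1 \<in> ordered_chamber"
      using chamber_along_axis[OF yc] by blast
    have "y $ k - z $ k - h * repulsion \<gamma> y k = 0"
      by (rule DERIV_local_min[OF log_gas_energy_derivative[where \<gamma> = \<gamma> and k = k and h = h and z = z, OF \<gamma> yc] \<delta>(1)])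
         (use \<delta> minimal in auto)
    then show ?thesis by (simp add: algebra_simps)
  qed
  with yc show thesis by (rule that)
qed

definition implicit_step :: "('d \<Rightarrow> 'd \<Rightarrow> real) \<Rightarrow> real \<Rightarrow> real ^ 'd::{finite,linorder} \<Rightarrow> real ^ 'd::{finite,linorder}" where
  "implicit_step \<gamma> h z = (THE y. y \<in> ordered_chamber \<and> (\<forall>i. y $ i = z $ i + repulsion \<gamma> y i * h))"

lemma implicit_step_solves:
  fixes z :: "real ^ 'd::{finite,linorder}"
  assumes \<gamma>: "\<And>i j. i \<noteq> j \<Longrightarrow> \<gamma> i j = \<gamma> j i \<and> \<gamma> i j \<ge> 0"
    and \<gamma>_adj: "\<And>i j. (i, j) \<in> adjacent \<Longrightarrow> \<gamma> i j > 0" and h: "h > 0"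
  shows "implicit_step \<gamma> h z \<in> ordered_chamber"
    "implicit_step \<gamma> h z $ i = z $ i + repulsion \<gamma> (implicit_step \<gamma> h z) i * h"
proof -
  let ?P = "\<lambda>y. y \<in> ordered_chamber \<and> (\<forall>i. y $ i = z $ i + repulsion \<gamma> y i * h)"
  have "\<exists>!y. ?P y"
  proof (rule ex_ex1I)
    show "\<exists>y. ?P y"
      by (rule implicit_step_exists[where \<gamma> = \<gamma> and h = h and z = z]) (fact \<gamma> \<gamma>_adj h | blast)+
    fix x y assume x: "?P x" and y: "?P y"
    have "norm (x - y) \<le> norm (z - z)"
      by (rule implicit_step_contraction[where \<gamma> = \<gamma> and h = h])
         (fact \<gamma> less_imp_le[OF h] x[THEN conjunct1] x[THEN conjunct2, rule_format]
            y[THEN conjunct1] y[THEN conjunct2, rule_format])+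
    then show "x = y" by simp
  qed
  from theI'[OF this] have "?P (implicit_step \<gamma> h z)" unfolding implicit_step_def .
  then show "implicit_step \<gamma> h z \<in> ordered_chamber"
    "implicit_step \<gamma> h z $ i = z $ i + repulsion \<gamma> (implicit_step \<gamma> h z) i * h" by blast+
qed

text \<open>Nonexpansive maps are continuous. This makes the iterates of the scheme adapted.\<close>

lemma implicit_step_measurable:
  assumes \<gamma>: "\<And>i j. i \<noteq> j \<Longrightarrow> \<gamma> i j = \<gamma> j i \<and> \<gamma> i j \<ge> 0"
    and \<gamma>_adj: "\<And>i j. (i, j) \<in> adjacent \<Longrightarrow> \<gamma> i j > 0" and h: "h > 0"
  shows "implicit_step \<gamma> h \<in> borel_measurable borel"
proof (intro borel_measurable_continuous_onI)
  have "1-lipschitz_on UNIV (implicit_step \<gamma> h)"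
  proof (rule lipschitz_onI)
    fix x y
    have "norm (implicit_step \<gamma> h x - implicit_step \<gamma> h y) \<le> norm (x - y)"
      by (intro implicit_step_contraction[where \<gamma> = \<gamma> and h = h] less_imp_le[OF h]
            implicit_step_solves[where \<gamma> = \<gamma> and h = h]) (fact \<gamma> \<gamma>_adj h)+
    then show "dist (implicit_step \<gamma> h x) (implicit_step \<gamma> h y) \<le> 1 * dist x y" by (simp add: dist_norm)
  qed simp
  then show "continuous_on UNIV (implicit_step \<gamma> h)" by (rule lipschitz_on_continuous_on)
qed

text \<open>The explicit part of the drift moves to the starting point, so a step of the scheme is the resolvent of the
  repulsion applied to an explicit Euler-Maruyama step.\<close>

lemma semi_implicit_EM_Suc:
  fixes W :: "real \<Rightarrow> 'a \<Rightarrow> real ^ 'd::{finite,linorder}"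
  shows "semi_implicit_EM \<gamma> b \<sigma> W T X0 n (Suc k) \<omega> = implicit_step \<gamma> (T / real n)
     (\<chi> i. semi_implicit_EM \<gamma> b \<sigma> W T X0 n k \<omega> $ i + b i (semi_implicit_EM \<gamma> b \<sigma> W T X0 n k \<omega>) * (T / real n)
       + (\<Sum>j\<in>UNIV. \<sigma> i j (semi_implicit_EM \<gamma> b \<sigma> W T X0 n k \<omega>) * (W (grid T n (Suc k)) \<omega> $ j - W (grid T n k) \<omega> $ j)))"
proof -
  have eq: "x + (r + c) * h + s = x + c * h + s + r * h" for x r c h s :: real by (simp add: algebra_simps)
  show ?thesis unfolding semi_implicit_EM.simps Let_def implicit_step_def vec_lambda_beta eq ..
qed

section \<open>Regularity of the repulsion in terms of the gaps\<close>

text \<open>The moment hypothesis of the theorem bounds the expectation of this function. It controls the inverse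
  gap of every pair, although only neighbours enter.\<close>

definition gap_energy :: "real ^ 'd::{finite,linorder} \<Rightarrow> real" where
  "gap_energy x = (\<Sum>(a, b)\<in>adjacent. inverse (\<bar>x $ a - x $ b\<bar> ^ 6))"

lemma gap_energy_nonneg: "0 \<le> gap_energy x"
  unfolding gap_energy_def by (intro sum_nonneg) auto

lemma sixth_power_diff_commute: "(a - b) ^ 6 = (b - a :: real) ^ 6"
  by (metis even_numeral minus_diff_eq power_minus_even)

text \<open>The gap of \<open>i < j\<close> is at least the gap between \<open>i\<close> and its successor.\<close>

lemma inverse_gap_le_gap_energy:
  fixes x :: "real ^ 'd::{finite,linorder}"
  assumes x: "x \<in> ordered_chamber" and ij: "i \<noteq> j"
  shows "inverse ((x $ i - x $ j) ^ 6) \<le> gap_energy x"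
proof -
  have *: "inverse ((x $ i - x $ j) ^ 6) \<le> gap_energy x" if ij: "i < j" for i j :: 'd
  proof -
    obtain k where k: "(i, k) \<in> adjacent" "k \<le> j" using adjacent_successor[OF ij] .
    then have "i < k" by (simp add: adjacent_def)
    then have 1: "0 < x $ k - x $ i" "x $ k - x $ i \<le> x $ j - x $ i"
      using x k(2) by (auto simp: ordered_chamber_def order_le_less)
    then have "inverse ((x $ j - x $ i) ^ 6) \<le> inverse ((x $ k - x $ i) ^ 6)"
      by (intro le_imp_inverse_le power_mono zero_less_power) auto
    also have "\<dots> = (case (i, k) of (a, b) \<Rightarrow> inverse (\<bar>x $ a - x $ b\<bar> ^ 6))"
      using sixth_power_diff_commute[of "x $ k" "x $ i"] by simp
    also have "\<dots> \<le> gap_energy x"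
      unfolding gap_energy_def using k(1) by (intro member_le_sum) auto
    finally show ?thesis by (simp only: sixth_power_diff_commute[of "x $ i"])
  qed
  show ?thesis
  proof (cases "i < j")
    case False
    with ij have "j < i" by simp
    from *[OF this] show ?thesis by (simp only: sixth_power_diff_commute[of "x $ i"])
  qed (rule *)
qed

text \<open>A crude arithmetic-geometric mean inequality. It replaces the Hoelder inequality with three
  exponents equal to \<open>3\<close>; constants are irrelevant for the rate.\<close>

lemma product_le_sum_cubes:
  fixes a b c :: real
  assumes "0 \<le> a" "0 \<le> b" "0 \<le> c"
  shows "a * b * c \<le> a ^ 3 + b ^ 3 + c ^ 3"
proof -
  define m where "m = max a (max b c)"
  have m: "a \<le> m" "b \<le> m" "c \<le> m" "m = a \<or> m = b \<or> m = c" by (auto simp: m_def)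
  have "a * b * c \<le> m * m * m" using m assms by (intro mult_mono) auto
  also have "\<dots> \<le> a ^ 3 + b ^ 3 + c ^ 3"
    using m(4) assms by (auto simp: power3_eq_cube)
  finally show ?thesis .
qed

text \<open>The free parameter \<open>\<eta>\<close> will be the step size: increments over a step have sixth moments of order
  \<open>\<eta>\<^sup>3\<close>, so the bracket has bounded expectation and the whole right-hand side is of order \<open>\<eta>\<close>.\<close>

lemma reciprocal_diff_sq:
  fixes p q \<eta> :: real
  assumes "p \<noteq> 0" "q \<noteq> 0" "0 < \<eta>"
  shows "(1 / p - 1 / q)\<^sup>2 \<le> \<eta> * ((p - q) ^ 6 / \<eta> ^ 3 + inverse (p ^ 6) + inverse (q ^ 6))"
proof -
  have "1 / p - 1 / q = - ((p - q) * inverse p * inverse q)"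
    using assms by (simp add: field_simps)
  then have "(1 / p - 1 / q)\<^sup>2 = (p - q)\<^sup>2 * inverse (p\<^sup>2) * inverse (q\<^sup>2)"
    by (simp add: power_mult_distrib power_inverse)
  also have "\<dots> = \<eta> * (((p - q)\<^sup>2 / \<eta>) * inverse (p\<^sup>2) * inverse (q\<^sup>2))"
    using assms by simp
  also have "\<dots> \<le> \<eta> * (((p - q)\<^sup>2 / \<eta>) ^ 3 + (inverse (p\<^sup>2)) ^ 3 + (inverse (q\<^sup>2)) ^ 3)"
    using assms by (intro mult_left_mono product_le_sum_cubes) auto
  also have "\<dots> = \<eta> * ((p - q) ^ 6 / \<eta> ^ 3 + inverse (p ^ 6) + inverse (q ^ 6))"
    by (simp add: power_divide power_inverse flip: power_mult)
  finally show ?thesis .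
qed

lemma square_le_sixth_power:
  fixes a \<eta> :: real
  assumes "0 < \<eta>"
  shows "a\<^sup>2 \<le> \<eta> * (1 + a ^ 6 / \<eta> ^ 3)"
proof -
  define t where "t = a\<^sup>2 / \<eta>"
  have t: "0 \<le> t" using assms by (simp add: t_def)
  have "t \<le> 1 + t ^ 3"
  proof (cases "t \<le> 1")
    case False
    then have "t * 1 \<le> t * t\<^sup>2" by (intro mult_left_mono) auto
    then show ?thesis by (simp add: power3_eq_cube power2_eq_square)
  qed (use t in \<open>simp add: add_increasing2\<close>)
  then have "\<eta> * t \<le> \<eta> * (1 + t ^ 3)" using assms by simp
  then show ?thesis using assms by (simp add: t_def power_divide flip: power_mult)
qed

text \<open>The mean square regularity in time of the singular drift: along the solution, with \<open>\<eta>\<close> the length of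
  a time step, the bracket has bounded expectation.\<close>

lemma repulsion_diff_sq:
  fixes x y :: "real ^ 'd::{finite,linorder}"
  assumes x: "x \<in> ordered_chamber" and y: "y \<in> ordered_chamber"
    and \<gamma>: "\<And>j. i \<noteq> j \<Longrightarrow> \<bar>\<gamma> i j\<bar> \<le> G" and \<eta>: "0 < \<eta>"
  shows "(repulsion \<gamma> x i - repulsion \<gamma> y i)\<^sup>2 \<le>
    64 * (G * CARD('d))\<^sup>2 * \<eta> * (norm (x - y) ^ 6 / \<eta> ^ 3 + gap_energy x + gap_energy y)"
proof -
  let ?E = "64 * norm (x - y) ^ 6 / \<eta> ^ 3 + gap_energy x + gap_energy y"
  define r where "r j = 1 / (x $ i - x $ j) - 1 / (y $ i - y $ j)" for j
  have E0: "0 \<le> ?E" using \<eta> gap_energy_nonneg[of x] gap_energy_nonneg[of y] by simp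
  have G0: "0 \<le> G\<^sup>2" by simp
  have summand: "(\<gamma> i j * r j)\<^sup>2 \<le> G\<^sup>2 * (\<eta> * ?E)" if j: "j \<in> UNIV - {i}" for j
  proof -
    have ij: "i \<noteq> j" using j by auto
    have "(r j)\<^sup>2 \<le> \<eta> * (((x $ i - x $ j) - (y $ i - y $ j)) ^ 6 / \<eta> ^ 3 + inverse ((x $ i - x $ j) ^ 6) + inverse ((y $ i - y $ j) ^ 6))"
      unfolding r_def using chamber_distinct[OF x ij] chamber_distinct[OF y ij] \<eta> by (intro reciprocal_diff_sq) auto
    also have "\<dots> \<le> \<eta> * ?E"
    proof (intro mult_left_mono add_mono divide_right_mono inverse_gap_le_gap_energy x y ij)
      have "(x $ i - x $ j) - (y $ i - y $ j) = (x - y) $ i - (x - y) $ j" by simp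
      then have "\<bar>(x $ i - x $ j) - (y $ i - y $ j)\<bar> ^ 6 \<le> (2 * norm (x - y)) ^ 6"
        using gap_le_norm[of "x - y" i j] by (intro power_mono) auto
      then show "((x $ i - x $ j) - (y $ i - y $ j)) ^ 6 \<le> 64 * norm (x - y) ^ 6"
        by (simp add: power_mult_distrib)
    qed (use \<eta> in auto)
    finally have "(r j)\<^sup>2 \<le> \<eta> * ?E" .
    moreover have "(\<gamma> i j)\<^sup>2 \<le> G\<^sup>2"
      using \<gamma>[OF ij] by (metis abs_ge_zero power2_abs power_mono)
    ultimately show ?thesis by (simp add: power_mult_distrib mult_mono)
  qed
  have "repulsion \<gamma> x i - repulsion \<gamma> y i = (\<Sum>j\<in>UNIV - {i}. \<gamma> i j * r j)"
    by (simp add: repulsion_def r_def right_diff_distrib sum_subtractf)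
  then have "(repulsion \<gamma> x i - repulsion \<gamma> y i)\<^sup>2 \<le> (\<Sum>j\<in>UNIV - {i}. (\<gamma> i j * r j)\<^sup>2) * card (UNIV - {i})"
    by (simp only: sum_squared_le_sum_of_squares)
  also have "\<dots> \<le> (\<Sum>j\<in>UNIV - {i}. G\<^sup>2 * (\<eta> * ?E)) * card (UNIV - {i})"
    by (intro mult_right_mono sum_mono summand) auto
  also have "\<dots> = (real (card (UNIV - {i})))\<^sup>2 * (G\<^sup>2 * (\<eta> * ?E))" by (simp add: power2_eq_square)
  also have "\<dots> \<le> (real CARD('d))\<^sup>2 * (G\<^sup>2 * (\<eta> * ?E))"
    using E0 \<eta> by (intro mult_right_mono power_mono) (auto intro!: card_mono)
  also have "\<dots> = (G * CARD('d))\<^sup>2 * \<eta> * ?E" by (simp add: power_mult_distrib)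
  also have "\<dots> \<le> (G * CARD('d))\<^sup>2 * \<eta> * (64 * (norm (x - y) ^ 6 / \<eta> ^ 3 + gap_energy x + gap_energy y))"
    using \<eta> gap_energy_nonneg[of x] gap_energy_nonneg[of y] by (intro mult_left_mono) auto
  finally show ?thesis by (simp add: algebra_simps)
qed

section \<open>Square-integrable martingale differences\<close>

primrec running_max :: "(nat \<Rightarrow> real) \<Rightarrow> nat \<Rightarrow> real" where
  "running_max S 0 = S 0"
| "running_max S (Suc k) = max (running_max S k) (S (Suc k))"

lemma running_max_upper: "k \<le> n \<Longrightarrow> S k \<le> running_max S n"
proof (induction n)
  case (Suc n)
  then show ?case by (cases "k = Suc n") auto
qed simp

text \<open>Doob's \<open>L\<^sup>2\<close> inequality holds along every path, up to a discrete stochastic integral with mean zero. The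
  running maximum only increases at times when it equals \<open>S\<close>, so summation by parts bounds
  \<open>\<Sum>k<n. running_max S k * (S (Suc k) - S k)\<close> by \<open>m * S n - m\<^sup>2 / 2\<close> with \<open>m = running_max S n\<close>; the
  rest is \<open>0 \<le> (m - 2 * S n)\<^sup>2\<close>.\<close>

lemma pathwise_Doob:
  assumes "S 0 = 0"
  shows "(running_max S n)\<^sup>2 \<le> 4 * (S n)\<^sup>2 - 4 * (\<Sum>k<n. running_max S k * (S (Suc k) - S k))"
proof -
  have *: "(\<Sum>k<n. running_max S k * (S (Suc k) - S k)) \<le> running_max S n * S n - (running_max S n)\<^sup>2 / 2"
  proof (induction n)
    case (Suc n)
    define m s where "m = running_max S n" and "s = S (Suc n)"
    have "m * s - m\<^sup>2 / 2 \<le> max m s * s - (max m s)\<^sup>2 / 2"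
    proof (cases "s \<le> m")
      case False
      have "0 \<le> (m - s)\<^sup>2" by simp
      with False show ?thesis by (simp add: max_def power2_eq_square algebra_simps)
    qed (simp add: max_def)
    with Suc show ?case by (simp add: algebra_simps flip: m_def s_def)
  qed (simp add: assms)
  have "0 \<le> (running_max S n - 2 * S n)\<^sup>2" by simp
  with * show ?thesis by (simp add: power2_eq_square algebra_simps)
qed

lemma integrable_mult_sq:
  fixes f g :: "'a \<Rightarrow> real"
  assumes [measurable]: "f \<in> borel_measurable M" "g \<in> borel_measurable M"
    and "integrable M (\<lambda>x. (f x)\<^sup>2)" "integrable M (\<lambda>x. (g x)\<^sup>2)"
  shows "integrable M (\<lambda>x. f x * g x)"
proof (rule Bochner_Integration.integrable_bound)
  show "integrable M (\<lambda>x. (f x)\<^sup>2 + (g x)\<^sup>2)" using assms by simp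
  show "AE x in M. norm (f x * g x) \<le> norm ((f x)\<^sup>2 + (g x)\<^sup>2)"
  proof (intro AE_I2)
    fix x
    have "0 \<le> (\<bar>f x\<bar> - \<bar>g x\<bar>)\<^sup>2" by simp
    then have "2 * \<bar>f x * g x\<bar> \<le> (f x)\<^sup>2 + (g x)\<^sup>2"
      by (simp add: power2_diff abs_mult mult.assoc)
    then show "norm (f x * g x) \<le> norm ((f x)\<^sup>2 + (g x)\<^sup>2)" by simp
  qed
qed simp

lemma integrable_add_sq:
  fixes f g :: "'a \<Rightarrow> real"
  assumes "f \<in> borel_measurable M" "g \<in> borel_measurable M"
    and "integrable M (\<lambda>x. (f x)\<^sup>2)" "integrable M (\<lambda>x. (g x)\<^sup>2)"
  shows "integrable M (\<lambda>x. (f x + g x)\<^sup>2)"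
proof -
  have "integrable M (\<lambda>x. (f x)\<^sup>2 + (g x)\<^sup>2 + 2 * (f x * g x))"
    using assms integrable_mult_sq[OF assms] by simp
  then show ?thesis by (simp add: power2_sum mult.assoc)
qed

lemma integrable_max_sq:
  fixes f g :: "'a \<Rightarrow> real"
  assumes [measurable]: "f \<in> borel_measurable M" "g \<in> borel_measurable M"
    and "integrable M (\<lambda>x. (f x)\<^sup>2)" "integrable M (\<lambda>x. (g x)\<^sup>2)"
  shows "integrable M (\<lambda>x. (max (f x) (g x))\<^sup>2)"
proof (rule Bochner_Integration.integrable_bound)
  show "integrable M (\<lambda>x. (f x)\<^sup>2 + (g x)\<^sup>2)" using assms by simp
qed (auto simp: max_def)

lemma (in prob_space) integral_sq_le:
  assumes "integrable M (X :: 'a \<Rightarrow> real)" "integrable M (\<lambda>\<omega>. (X \<omega>)\<^sup>2)"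
  shows "(expectation X)\<^sup>2 \<le> expectation (\<lambda>\<omega>. (X \<omega>)\<^sup>2)"
  using variance_eq[OF assms] variance_positive[of X] by simp

lemma (in prob_space) integrable_of_sq:
  assumes "(X :: 'a \<Rightarrow> real) \<in> borel_measurable M" "integrable M (\<lambda>\<omega>. (X \<omega>)\<^sup>2)"
  shows "integrable M X"
  using integrable_mult_sq[OF assms(1) _ assms(2), of "\<lambda>_. 1"] by simp

lemma integral_real_le_of_nn:
  assumes "f \<in> borel_measurable M" "\<And>x. f x \<ge> 0" "(\<integral>\<^sup>+x. ennreal (f x) \<partial>M) \<le> ennreal c" "c \<ge> 0"
  shows "integrable M f" "(LINT x|M. f x) \<le> c"
proof -
  show i: "integrable M f"
    using assms by (intro integrableI_nonneg) (auto intro: le_less_trans)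
  have "ennreal (LINT x|M. f x) = (\<integral>\<^sup>+x. ennreal (f x) \<partial>M)"
    using assms(2) by (intro nn_integral_eq_integral[symmetric] i) auto
  then have "ennreal (LINT x|M. f x) \<le> ennreal c" using assms(3) by (rule ord_eq_le_trans)
  then show "(LINT x|M. f x) \<le> c" by (rule ennreal_le_iff[OF assms(4), THEN iffD1])
qed

text \<open>This says that the conditional expectation of \<open>P\<close> given \<open>G\<close> is zero. The test functions need not be
  bounded; running maxima of martingales will be used as such.\<close>

definition mean_zero_given :: "'a measure \<Rightarrow> 'a measure \<Rightarrow> ('a \<Rightarrow> real) \<Rightarrow> bool" where
  "mean_zero_given M G P \<longleftrightarrow> P \<in> borel_measurable M \<and> integrable M P \<and>
     (\<forall>\<xi>. \<xi> \<in> borel_measurable G \<longrightarrow> integrable M (\<lambda>\<omega>. \<xi> \<omega> * P \<omega>) \<longrightarrow> (LINT \<omega>|M. \<xi> \<omega> * P \<omega>) = 0)"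

text \<open>Testing with indicators determines the conditional expectation, which is therefore zero.\<close>

lemma (in prob_space) mean_zero_givenI:
  assumes sub: "subalgebra M G" and P: "P \<in> borel_measurable M" "integrable M (\<lambda>\<omega>. (P \<omega>)\<^sup>2)"
    and A: "\<And>A. A \<in> sets G \<Longrightarrow> expectation (\<lambda>\<omega>. indicator A \<omega> * P \<omega>) = 0"
  shows "mean_zero_given M G P"
  unfolding mean_zero_given_def
proof (intro conjI allI impI)
  interpret finite_measure_subalgebra M G using sub by unfold_locales
  show "P \<in> borel_measurable M" by fact
  show int: "integrable M P" by (rule integrable_of_sq[OF P])
  fix \<xi> :: "'a \<Rightarrow> real" assume \<xi>: "\<xi> \<in> borel_measurable G" "integrable M (\<lambda>\<omega>. \<xi> \<omega> * P \<omega>)"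
  have "AE \<omega> in M. real_cond_exp M G P \<omega> = 0"
    using A int by (intro real_cond_exp_charact) (auto simp: set_lebesgue_integral_def)
  then have "AE \<omega> in M. \<xi> \<omega> * real_cond_exp M G P \<omega> = 0" by eventually_elim simp
  then have "expectation (\<lambda>\<omega>. \<xi> \<omega> * real_cond_exp M G P \<omega>) = 0" by (rule integral_eq_zero_AE)
  then show "expectation (\<lambda>\<omega>. \<xi> \<omega> * P \<omega>) = 0"
    using real_cond_exp_intg(2)[OF \<xi>(2,1) P(1)] by simp
qed

text \<open>Integrability of a test function times the whole sum says nothing about the single summands, so the sum is tested with
  indicator functions, for which the summands are integrable separately.\<close>

lemma (in prob_space) mean_zero_given_sum:
  fixes \<xi> P :: "'i \<Rightarrow> 'a \<Rightarrow> real"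
  assumes S: "finite S" and sub: "subalgebra M G"
    and \<xi>: "\<And>i. i \<in> S \<Longrightarrow> \<xi> i \<in> borel_measurable G"
    and P: "\<And>i. i \<in> S \<Longrightarrow> mean_zero_given M G (P i)"
    and sq: "\<And>i. i \<in> S \<Longrightarrow> integrable M (\<lambda>\<omega>. (\<xi> i \<omega> * P i \<omega>)\<^sup>2)"
  shows "mean_zero_given M G (\<lambda>\<omega>. \<Sum>i\<in>S. \<xi> i \<omega> * P i \<omega>)"
    and "integrable M (\<lambda>\<omega>. (\<Sum>i\<in>S. \<xi> i \<omega> * P i \<omega>)\<^sup>2)"
    and "expectation (\<lambda>\<omega>. (\<Sum>i\<in>S. \<xi> i \<omega> * P i \<omega>)\<^sup>2) \<le> card S * (\<Sum>i\<in>S. expectation (\<lambda>\<omega>. (\<xi> i \<omega> * P i \<omega>)\<^sup>2))"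
proof -
  have PM: "P i \<in> borel_measurable M" if "i \<in> S" for i using P[OF that] by (simp add: mean_zero_given_def)
  have \<xi>M: "\<xi> i \<in> borel_measurable M" if "i \<in> S" for i by (rule measurable_from_subalg[OF sub \<xi>[OF that]])
  have prodM: "(\<lambda>\<omega>. \<xi> i \<omega> * P i \<omega>) \<in> borel_measurable M" if "i \<in> S" for i
    using PM[OF that] \<xi>M[OF that] by simp
  have sumM: "(\<lambda>\<omega>. \<Sum>i\<in>S. \<xi> i \<omega> * P i \<omega>) \<in> borel_measurable M"
    by (intro borel_measurable_sum prodM)
  have bound: "integrable M (\<lambda>\<omega>. card S * (\<Sum>i\<in>S. (\<xi> i \<omega> * P i \<omega>)\<^sup>2))"
    by (intro integrable_mult_right Bochner_Integration.integrable_sum sq)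
  have le: "(\<Sum>i\<in>S. \<xi> i \<omega> * P i \<omega>)\<^sup>2 \<le> card S * (\<Sum>i\<in>S. (\<xi> i \<omega> * P i \<omega>)\<^sup>2)" for \<omega>
    using sum_squared_le_sum_of_squares[of "\<lambda>i. \<xi> i \<omega> * P i \<omega>" S] by (simp add: mult.commute)
  show int2: "integrable M (\<lambda>\<omega>. (\<Sum>i\<in>S. \<xi> i \<omega> * P i \<omega>)\<^sup>2)"
  proof (rule Bochner_Integration.integrable_bound[OF bound])
    show "AE \<omega> in M. norm ((\<Sum>i\<in>S. \<xi> i \<omega> * P i \<omega>)\<^sup>2) \<le> norm (card S * (\<Sum>i\<in>S. (\<xi> i \<omega> * P i \<omega>)\<^sup>2))"
      using le by (intro AE_I2) (simp add: abs_of_nonneg sum_nonneg)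
  qed (use sumM in simp)
  have "expectation (\<lambda>\<omega>. (\<Sum>i\<in>S. \<xi> i \<omega> * P i \<omega>)\<^sup>2) \<le> expectation (\<lambda>\<omega>. card S * (\<Sum>i\<in>S. (\<xi> i \<omega> * P i \<omega>)\<^sup>2))"
    using le by (intro integral_mono int2 bound)
  also have "\<dots> = card S * (\<Sum>i\<in>S. expectation (\<lambda>\<omega>. (\<xi> i \<omega> * P i \<omega>)\<^sup>2))"
    using sq by (simp add: Bochner_Integration.integral_sum)
  finally show "expectation (\<lambda>\<omega>. (\<Sum>i\<in>S. \<xi> i \<omega> * P i \<omega>)\<^sup>2) \<le> card S * (\<Sum>i\<in>S. expectation (\<lambda>\<omega>. (\<xi> i \<omega> * P i \<omega>)\<^sup>2))" .
  show "mean_zero_given M G (\<lambda>\<omega>. \<Sum>i\<in>S. \<xi> i \<omega> * P i \<omega>)"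
  proof (rule mean_zero_givenI[OF sub sumM int2])
    fix A assume A: "A \<in> sets G"
    then have AM: "A \<in> sets M" using sub by (auto simp: subalgebra_def)
    have int: "integrable M (\<lambda>\<omega>. (indicator A \<omega> * \<xi> i \<omega>) * P i \<omega>)" if "i \<in> S" for i
      using integrable_mult_indicator[OF AM integrable_of_sq[OF prodM[OF that] sq[OF that]]] by (simp add: mult.assoc)
    have zero: "expectation (\<lambda>\<omega>. (indicator A \<omega> * \<xi> i \<omega>) * P i \<omega>) = 0" if i: "i \<in> S" for i
    proof -
      have "(\<lambda>\<omega>. indicator A \<omega> * \<xi> i \<omega>) \<in> borel_measurable G"
        using \<xi>[OF i] A by (intro borel_measurable_times borel_measurable_indicator)
      then show ?thesis using P[OF i] int[OF i] unfolding mean_zero_given_def by blast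
    qed
    have "expectation (\<lambda>\<omega>. indicator A \<omega> * (\<Sum>i\<in>S. \<xi> i \<omega> * P i \<omega>)) = expectation (\<lambda>\<omega>. \<Sum>i\<in>S. (indicator A \<omega> * \<xi> i \<omega>) * P i \<omega>)"
      by (simp add: sum_distrib_left mult.assoc)
    also have "\<dots> = (\<Sum>i\<in>S. expectation (\<lambda>\<omega>. (indicator A \<omega> * \<xi> i \<omega>) * P i \<omega>))"
      by (rule Bochner_Integration.integral_sum[OF int])
    also have "\<dots> = 0" using zero by simp
    finally show "expectation (\<lambda>\<omega>. indicator A \<omega> * (\<Sum>i\<in>S. \<xi> i \<omega> * P i \<omega>)) = 0" .
  qed
qed

text \<open>The expectation of the pathwise inequality: the running maximum up to \<open>k\<close> is known at time \<open>k\<close>, so its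
  product with \<open>P k\<close> has mean zero, and the summands of \<open>S\<close> are orthogonal for the same reason.\<close>

lemma (in prob_space) Doob_L2:
  fixes P :: "nat \<Rightarrow> 'a \<Rightarrow> real" and n :: nat
  defines "S \<equiv> \<lambda>\<omega> k. \<Sum>j<k. P j \<omega>"
  assumes sub: "\<And>k. k \<le> n \<Longrightarrow> subalgebra M (G k)"
    and mono: "\<And>k. k < n \<Longrightarrow> sets (G k) \<subseteq> sets (G (Suc k))"
    and meas: "\<And>k. k < n \<Longrightarrow> P k \<in> borel_measurable (G (Suc k))"
    and sq: "\<And>k. k < n \<Longrightarrow> integrable M (\<lambda>\<omega>. (P k \<omega>)\<^sup>2)"
    and mart: "\<And>k. k < n \<Longrightarrow> mean_zero_given M (G k) (P k)"
  shows "(\<lambda>\<omega>. running_max (S \<omega>) n) \<in> borel_measurable (G n)"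
    "integrable M (\<lambda>\<omega>. (running_max (S \<omega>) n)\<^sup>2)"
    "expectation (\<lambda>\<omega>. (running_max (S \<omega>) n)\<^sup>2) \<le> 4 * (\<Sum>k<n. expectation (\<lambda>\<omega>. (P k \<omega>)\<^sup>2))"
proof -
  let ?m = "\<lambda>\<omega>. running_max (S \<omega>)"
  have S0: "S \<omega> 0 = 0" and S_Suc: "S \<omega> (Suc k) = S \<omega> k + P k \<omega>" for \<omega> k
    by (simp_all add: S_def)
  have step: "subalgebra (G (Suc k)) (G k)" if "k < n" for k
    using sub[of k] sub[of "Suc k"] mono[OF that] that by (simp add: subalgebra_def)
  have PM [measurable]: "P k \<in> borel_measurable M" if "k < n" for k
    using measurable_from_subalg[OF sub meas] that by simp
  have adapted: "k \<le> n \<Longrightarrow> (\<lambda>\<omega>. S \<omega> k) \<in> borel_measurable (G k) \<and> (\<lambda>\<omega>. ?m \<omega> k) \<in> borel_measurable (G k)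
      \<and> integrable M (\<lambda>\<omega>. (S \<omega> k)\<^sup>2) \<and> integrable M (\<lambda>\<omega>. (?m \<omega> k)\<^sup>2)" for k
  proof (induction k)
    case (Suc k)
    then have k: "k < n" by simp
    note [measurable] = meas[OF k] PM[OF k]
    have [measurable]: "(\<lambda>\<omega>. S \<omega> k) \<in> borel_measurable (G (Suc k))" "(\<lambda>\<omega>. ?m \<omega> k) \<in> borel_measurable (G (Suc k))"
      using Suc measurable_from_subalg[OF step[OF k]] by auto
    have [measurable]: "(\<lambda>\<omega>. S \<omega> k) \<in> borel_measurable M" "(\<lambda>\<omega>. ?m \<omega> k) \<in> borel_measurable M"
      using Suc measurable_from_subalg[OF sub[of k]] by auto
    have "integrable M (\<lambda>\<omega>. (S \<omega> k + P k \<omega>)\<^sup>2)"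
      using Suc sq[OF k] by (intro integrable_add_sq) auto
    then have "integrable M (\<lambda>\<omega>. (max (?m \<omega> k) (S \<omega> k + P k \<omega>))\<^sup>2)"
      using Suc by (intro integrable_max_sq) auto
    with \<open>integrable M (\<lambda>\<omega>. (S \<omega> k + P k \<omega>)\<^sup>2)\<close> show ?case by (auto simp: S_Suc)
  qed (simp add: S0)
  then show "(\<lambda>\<omega>. ?m \<omega> n) \<in> borel_measurable (G n)" and m2: "integrable M (\<lambda>\<omega>. (?m \<omega> n)\<^sup>2)"
    by auto
  have SM [measurable]: "(\<lambda>\<omega>. S \<omega> k) \<in> borel_measurable M" "(\<lambda>\<omega>. ?m \<omega> k) \<in> borel_measurable M" if "k \<le> n" for k
    using adapted[OF that] measurable_from_subalg[OF sub[OF that]] by auto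
  have S_sq: "k \<le> n \<Longrightarrow> expectation (\<lambda>\<omega>. (S \<omega> k)\<^sup>2) = (\<Sum>j<k. expectation (\<lambda>\<omega>. (P j \<omega>)\<^sup>2))" for k
  proof (induction k)
    case (Suc k)
    then have k: "k < n" "k \<le> n" by auto
    have int: "integrable M (\<lambda>\<omega>. S \<omega> k * P k \<omega>)"
      using adapted[OF k(2)] sq[OF k(1)] SM[OF k(2)] PM[OF k(1)] by (intro integrable_mult_sq) auto
    then have "expectation (\<lambda>\<omega>. S \<omega> k * P k \<omega>) = 0"
      using mart[OF k(1)] adapted[OF k(2)] by (simp add: mean_zero_given_def)
    then have "expectation (\<lambda>\<omega>. (S \<omega> k)\<^sup>2 + (P k \<omega>)\<^sup>2 + 2 * (S \<omega> k * P k \<omega>))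
        = expectation (\<lambda>\<omega>. (S \<omega> k)\<^sup>2) + expectation (\<lambda>\<omega>. (P k \<omega>)\<^sup>2)"
      using int adapted[OF k(2)] sq[OF k(1)] by simp
    with Suc show ?case by (simp add: S_Suc power2_sum mult.assoc)
  qed (simp add: S0)
  have cross: "integrable M (\<lambda>\<omega>. ?m \<omega> k * P k \<omega>)" "expectation (\<lambda>\<omega>. ?m \<omega> k * P k \<omega>) = 0" if k: "k < n" for k
  proof -
    have k': "k \<le> n" using k by simp
    show int: "integrable M (\<lambda>\<omega>. ?m \<omega> k * P k \<omega>)"
      using adapted[OF k'] sq[OF k] SM[OF k'] PM[OF k] by (intro integrable_mult_sq) auto
    then show "expectation (\<lambda>\<omega>. ?m \<omega> k * P k \<omega>) = 0"
      using mart[OF k] adapted[OF k'] by (simp add: mean_zero_given_def)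
  qed
  have int: "integrable M (\<lambda>\<omega>. 4 * (S \<omega> n)\<^sup>2)" "integrable M (\<lambda>\<omega>. 4 * (\<Sum>k<n. ?m \<omega> k * P k \<omega>))"
    using adapted[of n] cross(1) by (auto intro!: integrable_mult_right integrable_sum)
  have "expectation (\<lambda>\<omega>. (?m \<omega> n)\<^sup>2) \<le> expectation (\<lambda>\<omega>. 4 * (S \<omega> n)\<^sup>2 - 4 * (\<Sum>k<n. ?m \<omega> k * P k \<omega>))"
  proof (rule integral_mono[OF m2])
    show "integrable M (\<lambda>\<omega>. 4 * (S \<omega> n)\<^sup>2 - 4 * (\<Sum>k<n. ?m \<omega> k * P k \<omega>))"
      using int by simp
    show "(?m \<omega> n)\<^sup>2 \<le> 4 * (S \<omega> n)\<^sup>2 - 4 * (\<Sum>k<n. ?m \<omega> k * P k \<omega>)" for \<omega>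
      using pathwise_Doob[of "S \<omega>" n, OF S0] by (simp add: S_Suc)
  qed
  also have "\<dots> = 4 * expectation (\<lambda>\<omega>. (S \<omega> n)\<^sup>2)"
    using int cross by (simp add: Bochner_Integration.integral_sum)
  finally show "expectation (\<lambda>\<omega>. (?m \<omega> n)\<^sup>2) \<le> 4 * (\<Sum>k<n. expectation (\<lambda>\<omega>. (P k \<omega>)\<^sup>2))"
    by (simp add: S_sq)
qed

section \<open>Stochastic recursions\<close>

text \<open>The discrete Gronwall argument. The integrability of \<open>a k\<close> is part of the induction since the bounds
  on \<open>P k\<close> and \<open>Q k\<close> presuppose it.\<close>

lemma (in prob_space) recursive_mean_bound:
  fixes a :: "nat \<Rightarrow> 'a \<Rightarrow> real"
  assumes K: "K \<ge> 0" and h: "h > 0"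
    and a: "\<And>k. k \<le> n \<Longrightarrow> a k \<in> borel_measurable M" "\<And>k \<omega>. a k \<omega> \<ge> 0"
    and a0: "AE \<omega> in M. a 0 \<omega> = 0"
    and P: "\<And>k. k < n \<Longrightarrow> integrable M (a k) \<Longrightarrow> mean_zero_given M (G k) (P k)"
    and Q: "\<And>k. k < n \<Longrightarrow> integrable M (a k) \<Longrightarrow> integrable M (Q k) \<and> expectation (Q k) \<le> K * (h * expectation (a k) + h\<^sup>2)"
    and step: "\<And>k. k < n \<Longrightarrow> AE \<omega> in M. a (Suc k) \<omega> \<le> a k \<omega> + 2 * P k \<omega> + Q k \<omega>"
  shows "k \<le> n \<Longrightarrow> integrable M (a k) \<and> expectation (a k) \<le> real k * K * h\<^sup>2 * (1 + K * h) ^ k"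
proof (induction k)
  case 0
  have "integrable M (a 0)"
    using a0 by (intro integrable_cong_AE_imp[OF integrable_zero[of M]] a) auto
  moreover have "expectation (a 0) = expectation (\<lambda>_. 0)"
    using a0 by (intro integral_cong_AE a) auto
  ultimately show ?case by simp
next
  case (Suc k)
  then have k: "k < n" and int: "integrable M (a k)"
    and IH: "expectation (a k) \<le> real k * K * h\<^sup>2 * (1 + K * h) ^ k" by auto
  have intP: "integrable M (P k)" using P[OF k int] by (simp add: mean_zero_given_def)
  have "expectation (\<lambda>\<omega>. 1 * P k \<omega>) = 0"
  proof -
    have "\<forall>\<xi>. \<xi> \<in> borel_measurable (G k) \<longrightarrow> integrable M (\<lambda>\<omega>. \<xi> \<omega> * P k \<omega>) \<longrightarrow> expectation (\<lambda>\<omega>. \<xi> \<omega> * P k \<omega>) = 0"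
      using P[OF k int] by (simp add: mean_zero_given_def)
    then show ?thesis using intP by (elim allE[of _ "\<lambda>_. 1"]) simp
  qed
  then have EP: "expectation (P k) = 0" by simp
  have bound: "integrable M (\<lambda>\<omega>. a k \<omega> + 2 * P k \<omega> + Q k \<omega>)"
    using int intP Q[OF k int] by auto
  have "integrable M (a (Suc k))"
  proof (rule Bochner_Integration.integrable_bound[OF bound])
    show "AE \<omega> in M. norm (a (Suc k) \<omega>) \<le> norm (a k \<omega> + 2 * P k \<omega> + Q k \<omega>)"
      using step[OF k] by eventually_elim (use a(2) in \<open>auto intro: order_trans\<close>)
  qed (use a k in auto)
  moreover have "expectation (a (Suc k)) \<le> expectation (\<lambda>\<omega>. a k \<omega> + 2 * P k \<omega> + Q k \<omega>)"
    by (rule integral_mono_AE[OF calculation bound step[OF k]])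
  moreover have "\<dots> = expectation (a k) + expectation (Q k)"
    using int intP EP Q[OF k int] by simp
  moreover have "\<dots> \<le> (1 + K * h) * expectation (a k) + K * h\<^sup>2"
    using Q[OF k int] by (simp add: algebra_simps)
  moreover have "\<dots> \<le> (1 + K * h) * (real k * K * h\<^sup>2 * (1 + K * h) ^ k) + K * h\<^sup>2 * (1 + K * h) ^ Suc k"
  proof (intro add_mono mult_left_mono IH)
    have "1 \<le> (1 + K * h) ^ Suc k" using K h by (intro one_le_power) simp
    then show "K * h\<^sup>2 \<le> K * h\<^sup>2 * (1 + K * h) ^ Suc k"
      using K mult_left_mono[of 1 "(1 + K * h) ^ Suc k" "K * h\<^sup>2"] by simp
  qed (use K h in auto)
  moreover have "\<dots> = real (Suc k) * K * h\<^sup>2 * (1 + K * h) ^ Suc k"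
    by (simp add: algebra_simps)
  ultimately show ?case by linarith
qed

text \<open>Summing the recursion bounds \<open>a k\<close> by a martingale at time \<open>k\<close> plus a sum of nonnegative terms. The mean
  of the latter is of order \<open>h\<close>. The \<open>n\<close> increments of the martingale have variances of order
  \<open>h * expectation (a k)\<close>, that is \<open>h\<^sup>2\<close>, so its maximum has root mean square of order
  \<open>sqrt h\<close>; this term determines the rate.\<close>

lemma (in prob_space) recursive_maximal_bound:
  fixes a :: "nat \<Rightarrow> 'a \<Rightarrow> real"
  assumes n: "n \<ge> 1" and K: "K \<ge> 0" and h: "0 < h" "h \<le> 1" and \<tau>: "real n * h \<le> \<tau>"
    and sub: "\<And>k. k \<le> n \<Longrightarrow> subalgebra M (G k)"
    and mono: "\<And>k. k < n \<Longrightarrow> sets (G k) \<subseteq> sets (G (Suc k))"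
    and a: "\<And>k. k \<le> n \<Longrightarrow> a k \<in> borel_measurable M" "\<And>k \<omega>. a k \<omega> \<ge> 0"
    and a0: "AE \<omega> in M. a 0 \<omega> = 0"
    and Pm: "\<And>k. k < n \<Longrightarrow> P k \<in> borel_measurable (G (Suc k))"
    and P: "\<And>k. k < n \<Longrightarrow> integrable M (a k) \<Longrightarrow> mean_zero_given M (G k) (P k)"
    and P2: "\<And>k. k < n \<Longrightarrow> integrable M (a k) \<Longrightarrow> integrable M (\<lambda>\<omega>. (P k \<omega>)\<^sup>2) \<and>
        expectation (\<lambda>\<omega>. (P k \<omega>)\<^sup>2) \<le> K * h * expectation (a k)"
    and Q0: "\<And>k \<omega>. k < n \<Longrightarrow> Q k \<omega> \<ge> 0"
    and Q: "\<And>k. k < n \<Longrightarrow> integrable M (a k) \<Longrightarrow> integrable M (Q k) \<and> expectation (Q k) \<le> K * (h * expectation (a k) + h\<^sup>2)"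
    and step: "\<And>k. k < n \<Longrightarrow> AE \<omega> in M. a (Suc k) \<omega> \<le> a k \<omega> + 2 * P k \<omega> + Q k \<omega>"
  defines "C \<equiv> \<tau> * K * exp (\<tau> * K)"
  shows "\<And>k. k \<le> n \<Longrightarrow> integrable M (a k)"
    and "\<And>k. k \<le> n \<Longrightarrow> expectation (a k) \<le> C * h"
    and "integrable M (\<lambda>\<omega>. SUP k\<in>{1..n}. a k \<omega>)"
    and "expectation (\<lambda>\<omega>. SUP k\<in>{1..n}. a k \<omega>) \<le> (4 * sqrt (\<tau> * K * C) + \<tau> * K * (C + 1)) * sqrt h"
proof -
  have \<tau>0: "\<tau> \<ge> 0" using h \<tau> by (smt (verit) mult_nonneg_nonneg of_nat_0_le_iff)
  have C0: "C \<ge> 0" unfolding C_def using \<tau>0 K by simp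
  have mean: "integrable M (a k) \<and> expectation (a k) \<le> real k * K * h\<^sup>2 * (1 + K * h) ^ k" if "k \<le> n" for k
    by (rule recursive_mean_bound[where G = G and P = P and Q = Q and n = n]) (fact K h a a0 P Q step that)+
  then show int: "integrable M (a k)" if "k \<le> n" for k using that by blast
  show Ea: "expectation (a k) \<le> C * h" if k: "k \<le> n" for k
  proof -
    have kh: "real k * h \<le> \<tau>" using k \<tau> h by (smt (verit) mult_right_mono of_nat_le_iff)
    have "(1 + K * h) ^ k \<le> exp (K * h) ^ k"
      using K h by (intro power_mono exp_ge_add_one_self) auto
    also have "\<dots> = exp (real k * h * K)" by (simp add: exp_of_nat_mult[symmetric] algebra_simps)
    also have "\<dots> \<le> exp (\<tau> * K)" using kh K by (simp add: mult_right_mono)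
    finally have 1: "(1 + K * h) ^ k \<le> exp (\<tau> * K)" .
    have "expectation (a k) \<le> real k * K * h\<^sup>2 * (1 + K * h) ^ k" using mean k by blast
    also have "\<dots> = (real k * h) * (K * h) * (1 + K * h) ^ k" by (simp add: power2_eq_square)
    also have "\<dots> \<le> \<tau> * (K * h) * exp (\<tau> * K)"
      using kh K h 1 \<tau>0 by (intro mult_mono mult_right_mono) auto
    finally show ?thesis by (simp add: C_def algebra_simps)
  qed
  define m where "m \<omega> = running_max (\<lambda>k. \<Sum>j<k. 2 * P j \<omega>) n" for \<omega>
  have EP2: "integrable M (\<lambda>\<omega>. (2 * P k \<omega>)\<^sup>2)" "expectation (\<lambda>\<omega>. (2 * P k \<omega>)\<^sup>2) \<le> 4 * (K * h * (C * h))"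
    if k: "k < n" for k
  proof -
    have i: "integrable M (a k)" using int k by simp
    show "integrable M (\<lambda>\<omega>. (2 * P k \<omega>)\<^sup>2)" using P2[OF k i] by (simp add: power_mult_distrib)
    have "expectation (\<lambda>\<omega>. (P k \<omega>)\<^sup>2) \<le> K * h * (C * h)"
      using P2[OF k i] Ea[of k] k K h by (smt (verit) mult_left_mono mult_nonneg_nonneg less_imp_le)
    then show "expectation (\<lambda>\<omega>. (2 * P k \<omega>)\<^sup>2) \<le> 4 * (K * h * (C * h))"
      by (simp add: power_mult_distrib)
  qed
  have mart: "mean_zero_given M (G k) (\<lambda>\<omega>. 2 * P k \<omega>)" if k: "k < n" for k
  proof -
    have "mean_zero_given M (G k) (P k)" using P[OF k] int[of k] k by simp
    then show ?thesis unfolding mean_zero_given_def by (auto simp: mult.left_commute[of _ 2])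
  qed
  have Pm': "(\<lambda>\<omega>. 2 * P k \<omega>) \<in> borel_measurable (G (Suc k))" if "k < n" for k
    using Pm[OF that] by simp
  note Doob = Doob_L2[where P = "\<lambda>k \<omega>. 2 * P k \<omega>" and G = G and n = n, folded m_def]
  have "m \<in> borel_measurable (G n)"
    by (rule Doob(1)) (fact sub mono Pm' EP2 mart)+
  then have mM: "m \<in> borel_measurable M" by (rule measurable_from_subalg[OF sub[OF order_refl]])
  have m2: "integrable M (\<lambda>\<omega>. (m \<omega>)\<^sup>2)"
    by (rule Doob(2)) (fact sub mono Pm' EP2 mart)+
  have Em2: "expectation (\<lambda>\<omega>. (m \<omega>)\<^sup>2) \<le> 4 * (\<Sum>k<n. expectation (\<lambda>\<omega>. (2 * P k \<omega>)\<^sup>2))"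
    by (rule Doob(3)) (fact sub mono Pm' EP2 mart)+
  have "expectation (\<lambda>\<omega>. (m \<omega>)\<^sup>2) \<le> 4 * (\<Sum>k<n. 4 * (K * h * (C * h)))"
  proof (rule order_trans[OF Em2], intro mult_left_mono sum_mono)
    fix k assume "k \<in> {..<n}"
    then show "expectation (\<lambda>\<omega>. (2 * P k \<omega>)\<^sup>2) \<le> 4 * (K * h * (C * h))" using EP2(2)[of k] by simp
  qed simp
  also have "\<dots> = 16 * ((real n * h) * K * C * h)" by simp
  also have "\<dots> \<le> 16 * (\<tau> * K * C * h)"
    using \<tau> K C0 h by (intro mult_left_mono mult_right_mono) auto
  finally have Em2': "expectation (\<lambda>\<omega>. (m \<omega>)\<^sup>2) \<le> 16 * (\<tau> * K * C * h)" .
  have intm: "integrable M m" by (rule integrable_of_sq[OF mM m2])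
  have "(expectation m)\<^sup>2 \<le> 16 * (\<tau> * K * C * h)"
    using integral_sq_le[OF intm m2] Em2' by simp
  then have "expectation m \<le> sqrt (16 * (\<tau> * K * C * h))" by (rule real_le_rsqrt)
  also have "\<dots> = 4 * sqrt (\<tau> * K * C) * sqrt h" by (simp add: real_sqrt_mult)
  finally have Em: "expectation m \<le> 4 * sqrt (\<tau> * K * C) * sqrt h" .
  have EQ: "integrable M (Q k)" "expectation (Q k) \<le> K * (C + 1) * (h * h)" if k: "k < n" for k
  proof -
    have i: "integrable M (a k)" using int k by simp
    show "integrable M (Q k)" using Q[OF k i] by simp
    have "expectation (Q k) \<le> K * (h * expectation (a k) + h\<^sup>2)" using Q[OF k i] by simp
    also have "\<dots> \<le> K * (h * (C * h) + h\<^sup>2)"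
      using Ea[of k] k K h by (intro mult_left_mono add_right_mono) auto
    finally show "expectation (Q k) \<le> K * (C + 1) * (h * h)"
      by (simp add: algebra_simps power2_eq_square)
  qed
  have "(\<Sum>k<n. expectation (Q k)) \<le> (\<Sum>k<n. K * (C + 1) * (h * h))"
    by (intro sum_mono EQ(2)) simp
  also have "\<dots> = (real n * h) * (K * (C + 1) * h)" by simp
  also have "\<dots> \<le> \<tau> * (K * (C + 1) * sqrt h)"
  proof (rule mult_mono[OF \<tau> _ \<tau>0])
    show "K * (C + 1) * h \<le> K * (C + 1) * sqrt h"
      using K C0 h real_le_rsqrt[of h h] by (intro mult_left_mono) (auto simp: power2_eq_square mult_left_le)
    show "0 \<le> K * (C + 1) * h" using K C0 h by simp
  qed
  finally have EQs: "(\<Sum>k<n. expectation (Q k)) \<le> \<tau> * K * (C + 1) * sqrt h" by simp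
  have "AE \<omega> in M. \<forall>k<n. a (Suc k) \<omega> \<le> a k \<omega> + 2 * P k \<omega> + Q k \<omega>"
    unfolding AE_all_countable using step by fastforce
  with a0 have sup_le: "AE \<omega> in M. (SUP k\<in>{1..n}. a k \<omega>) \<le> m \<omega> + (\<Sum>j<n. Q j \<omega>)"
  proof eventually_elim
    case (elim \<omega>)
    have sum: "k \<le> n \<Longrightarrow> a k \<omega> \<le> (\<Sum>j<k. 2 * P j \<omega>) + (\<Sum>j<k. Q j \<omega>)" for k
    proof (induction k)
      case (Suc k)
      then show ?case using elim(2)[rule_format, of k] by simp
    qed (use elim in simp)
    show ?case
    proof (rule cSUP_least)
      fix k assume "k \<in> {1..n}"
      then have k: "k \<le> n" by simp
      have "(\<Sum>j<k. 2 * P j \<omega>) \<le> m \<omega>" unfolding m_def by (rule running_max_upper[OF k])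
      moreover have "(\<Sum>j<k. Q j \<omega>) \<le> (\<Sum>j<n. Q j \<omega>)"
        using k Q0 by (intro sum_mono2) auto
      ultimately show "a k \<omega> \<le> m \<omega> + (\<Sum>j<n. Q j \<omega>)" using sum[OF k] by simp
    qed (use n in auto)
  qed
  have SUP0: "0 \<le> (SUP k\<in>{1..n}. a k \<omega>)" for \<omega>
    using a(2)[of 1 \<omega>] n by (intro cSUP_upper2[where x = 1]) auto
  have bound: "integrable M (\<lambda>\<omega>. m \<omega> + (\<Sum>j<n. Q j \<omega>))"
    by (intro Bochner_Integration.integrable_add Bochner_Integration.integrable_sum intm EQ(1)) simp
  have SUPm: "(\<lambda>\<omega>. SUP k\<in>{1..n}. a k \<omega>) \<in> borel_measurable M"
    using a by (intro borel_measurable_cSUP) auto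
  show int_sup: "integrable M (\<lambda>\<omega>. SUP k\<in>{1..n}. a k \<omega>)"
  proof (rule Bochner_Integration.integrable_bound[OF bound SUPm])
    show "AE \<omega> in M. norm (SUP k\<in>{1..n}. a k \<omega>) \<le> norm (m \<omega> + (\<Sum>j<n. Q j \<omega>))"
      using sup_le by eventually_elim (use SUP0 in \<open>auto intro: order_trans\<close>)
  qed
  have "expectation (\<lambda>\<omega>. SUP k\<in>{1..n}. a k \<omega>) \<le> expectation (\<lambda>\<omega>. m \<omega> + (\<Sum>j<n. Q j \<omega>))"
    by (rule integral_mono_AE[OF int_sup bound sup_le])
  also have "\<dots> = expectation m + (\<Sum>j<n. expectation (Q j))"
  proof -
    have "integrable M (\<lambda>\<omega>. \<Sum>j<n. Q j \<omega>)" "expectation (\<lambda>\<omega>. \<Sum>j<n. Q j \<omega>) = (\<Sum>j<n. expectation (Q j))"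
      using EQ(1) by (auto intro!: Bochner_Integration.integrable_sum Bochner_Integration.integral_sum)
    then show ?thesis using intm by simp
  qed
  also have "\<dots> \<le> (4 * sqrt (\<tau> * K * C) + \<tau> * K * (C + 1)) * sqrt h"
    using Em EQs by (simp add: algebra_simps)
  finally show "expectation (\<lambda>\<omega>. SUP k\<in>{1..n}. a k \<omega>) \<le> (4 * sqrt (\<tau> * K * C) + \<tau> * K * (C + 1)) * sqrt h" .
qed

section \<open>Brownian increments and step integrands\<close>

lemma usual_filtrationD:
  assumes "usual_filtration M F"
  shows "\<And>t. 0 \<le> t \<Longrightarrow> subalgebra M (F t)" "\<And>s t. 0 \<le> s \<Longrightarrow> s \<le> t \<Longrightarrow> subalgebra (F t) (F s)"
proof -
  show 1: "subalgebra M (F t)" if "0 \<le> t" for t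
    using assms[unfolded usual_filtration_def, THEN conjunct1] that by blast
  show "subalgebra (F t) (F s)" if "0 \<le> s" "s \<le> t" for s t
  proof -
    have "sets (F s) \<subseteq> sets (F t)"
      using assms[unfolded usual_filtration_def, THEN conjunct2, THEN conjunct1] that by blast
    then show ?thesis using 1[of s] 1[of t] that by (simp add: subalgebra_def)
  qed
qed

lemma vec_nth_measurable [measurable]: "(\<lambda>x :: real ^ 'n::finite. x $ i) \<in> borel_measurable borel"
  by (intro borel_measurable_continuous_onI continuous_intros)

text \<open>The properties of a coordinate of Brownian motion on which the stochastic integral rests: increments
  have mean zero and variance \<open>v - u\<close>, also after weighting with an integrable function of the past.\<close>

definition independent_increments :: "'a measure \<Rightarrow> (real \<Rightarrow> 'a measure) \<Rightarrow> (real \<Rightarrow> 'a \<Rightarrow> real) \<Rightarrow> bool" where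
  "independent_increments M F B \<longleftrightarrow>
     (\<forall>t\<ge>0. B t \<in> borel_measurable (F t)) \<and>
     (\<forall>u v g. 0 \<le> u \<longrightarrow> u \<le> v \<longrightarrow> g \<in> borel_measurable (F u) \<longrightarrow> integrable M g \<longrightarrow>
        integrable M (\<lambda>\<omega>. g \<omega> * (B v \<omega> - B u \<omega>)) \<and> (LINT \<omega>|M. g \<omega> * (B v \<omega> - B u \<omega>)) = 0 \<and>
        integrable M (\<lambda>\<omega>. g \<omega> * (B v \<omega> - B u \<omega>)\<^sup>2) \<and>
        (LINT \<omega>|M. g \<omega> * (B v \<omega> - B u \<omega>)\<^sup>2) = (v - u) * (LINT \<omega>|M. g \<omega>))"

lemma (in prob_space) indep_var_of_indep_set:
  assumes indep: "indep_set \<G> \<H>" and [measurable]: "g \<in> borel_measurable M" "D \<in> borel_measurable M"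
    and g: "\<And>A. A \<in> sets borel \<Longrightarrow> g -` A \<inter> space M \<in> \<G>"
    and D: "\<And>A. A \<in> sets borel \<Longrightarrow> D -` A \<inter> space M \<in> \<H>"
  shows "indep_var borel g borel D"
  unfolding indep_var_eq
proof (intro conjI indep_set_sigma_sets)
  have *: "\<exists>C. h -` A \<inter> space M \<inter> (h -` B \<inter> space M) = h -` C \<inter> space M \<and> C \<in> sets borel"
    if "A \<in> sets borel" "B \<in> sets borel" for h :: "'a \<Rightarrow> 'b::topological_space" and A B
    using that by (intro exI[of _ "A \<inter> B"]) auto
  show "indep_set {g -` A \<inter> space M |A. A \<in> sets borel} {D -` A \<inter> space M |A. A \<in> sets borel}"
    using indep_setD[OF indep] indep_setD_ev1[OF indep] g D by (intro indep_setI) auto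
  show "Int_stable {g -` A \<inter> space M |A. A \<in> sets borel}" "Int_stable {D -` A \<inter> space M |A. A \<in> sets borel}"
    unfolding Int_stable_def using * by auto
qed auto

lemma (in prob_space) brownian_independent_increments:
  assumes F: "usual_filtration M F" and W: "brownian_motion M F W"
  shows "independent_increments M F (\<lambda>t \<omega>. W t \<omega> $ i)"
proof -
  have adapted: "W t \<in> borel_measurable (F t)" if "0 \<le> t" for t
    using W that by (simp add: brownian_motion_def)
  have coord: "(\<lambda>\<omega>. W t \<omega> $ i) \<in> borel_measurable (F t)" if "0 \<le> t" for t
    using measurable_compose[OF adapted[OF that] vec_nth_measurable] by simp
  {
    fix u v :: real and g :: "'a \<Rightarrow> real"
    assume uv: "0 \<le> u" "u \<le> v" and g: "g \<in> borel_measurable (F u)" and int_g: "integrable M g"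
    define D where "D \<omega> = W v \<omega> $ i - W u \<omega> $ i" for \<omega>
    have D_vec: "D \<omega> = (W v \<omega> - W u \<omega>) $ i" for \<omega> by (simp add: D_def)
    have "integrable M (\<lambda>\<omega>. g \<omega> * D \<omega>) \<and> (LINT \<omega>|M. g \<omega> * D \<omega>) = 0 \<and>
        integrable M (\<lambda>\<omega>. g \<omega> * (D \<omega>)\<^sup>2) \<and>
        (LINT \<omega>|M. g \<omega> * (D \<omega>)\<^sup>2) = (v - u) * (LINT \<omega>|M. g \<omega>)"
    proof (cases "u = v")
      case False
      with uv have less: "u < v" by simp
      have W_inc: "indep_set (sets (F u)) {(\<lambda>\<omega>. W v \<omega> - W u \<omega>) -` B \<inter> space M | B. B \<in> sets borel}"
        and dist: "distributed M lborel D (\<lambda>x. ennreal (normal_density 0 (sqrt (v - u)) x))"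
        using W uv less unfolding brownian_motion_def D_vec by auto
      have gM: "g \<in> borel_measurable M" using int_g by simp
      have DM [measurable]: "D \<in> borel_measurable M"
        using distributed_measurable[OF dist] by simp
      have "indep_var borel g borel D"
      proof (rule indep_var_of_indep_set[OF W_inc gM DM])
        fix A :: "real set" assume A: "A \<in> sets borel"
        have "space (F u) = space M" using usual_filtrationD(1)[OF F uv(1)] by (simp add: subalgebra_def)
        then show "g -` A \<inter> space M \<in> sets (F u)" using measurable_sets[OF g A] by simp
        have "(\<lambda>x. x $ i) -` A \<in> sets (borel :: (real ^ 'b) measure)"
          using measurable_sets[OF vec_nth_measurable A] by simp
        then show "D -` A \<inter> space M \<in> {(\<lambda>\<omega>. W v \<omega> - W u \<omega>) -` B \<inter> space M | B. B \<in> sets borel}"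
          by (intro CollectI exI[of _ "(\<lambda>x. x $ i) -` A"]) (auto simp: D_vec)
      qed
      then have indep: "indep_var borel g borel (f \<circ> D)" if "f \<in> borel_measurable borel" for f :: "real \<Rightarrow> real"
        using indep_var_compose[of borel g borel D id borel f borel] that by simp
      let ?\<phi> = "normal_density 0 (sqrt (v - u))"
      have sd: "sqrt (v - u) > 0" using less by simp
      have m1: "integrable M D" "expectation D = 0"
        using distributed_integrable[OF dist, of "\<lambda>x. x"] distributed_integral[OF dist, of "\<lambda>x. x"]
          integrable_normal_moment[OF sd, of 0 1] integral_normal_moment_odd[OF sd, of 0 0] by auto
      have m2: "integrable M (\<lambda>\<omega>. (D \<omega>)\<^sup>2)" "expectation (\<lambda>\<omega>. (D \<omega>)\<^sup>2) = v - u"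
        using distributed_integrable[OF dist, of "\<lambda>x. x\<^sup>2"] distributed_integral[OF dist, of "\<lambda>x. x\<^sup>2"]
          integrable_normal_moment[OF sd, of 0 2] integral_normal_moment_even[OF sd, of 0 1] less by (auto simp: fact_numeral)
      show ?thesis
        using indep_var_integrable[OF indep[of "\<lambda>x. x"] int_g] indep_var_lebesgue_integral[OF indep[of "\<lambda>x. x"] int_g]
          indep_var_integrable[OF indep[of "\<lambda>x. x\<^sup>2"] int_g] indep_var_lebesgue_integral[OF indep[of "\<lambda>x. x\<^sup>2"] int_g]
          m1 m2 by (simp add: comp_def mult.commute)
    qed (simp add: D_def)
  }
  with coord show ?thesis by (auto simp: independent_increments_def)
qed

text \<open>The Ito isometry and the martingale property for step integrands, weighted by a bounded function \<open>Z\<close> of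
  the past. Adaptedness of \<open>\<zeta> k\<close> is required on nondegenerate intervals only because the partitions
  to which this is applied arise by clamping and may contain repeated points.\<close>

lemma (in prob_space) step_integral_moments:
  assumes F: "usual_filtration M F" and B: "independent_increments M F B"
    and c0: "0 \<le> c 0" and c: "\<And>k. k < N \<Longrightarrow> c k \<le> c (Suc k)"
    and \<zeta>: "\<And>k. k < N \<Longrightarrow> c k < c (Suc k) \<Longrightarrow> \<zeta> k \<in> borel_measurable (F (c k))"
    and \<zeta>_bd: "\<And>k. k < N \<Longrightarrow> \<exists>K. \<forall>\<omega>\<in>space M. \<bar>\<zeta> k \<omega>\<bar> \<le> K"
    and Z: "Z \<in> borel_measurable (F (c 0))" and Z_bd: "\<And>\<omega>. \<omega> \<in> space M \<Longrightarrow> \<bar>Z \<omega>\<bar> \<le> KZ"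
  defines "J \<equiv> \<lambda>\<omega>. \<Sum>k<N. \<zeta> k \<omega> * (B (c (Suc k)) \<omega> - B (c k) \<omega>)"
  shows "J \<in> borel_measurable (F (c N))" "integrable M (\<lambda>\<omega>. (J \<omega>)\<^sup>2)"
    "expectation (\<lambda>\<omega>. Z \<omega> * J \<omega>) = 0"
    "expectation (\<lambda>\<omega>. Z \<omega> * (J \<omega>)\<^sup>2) = (\<Sum>k<N. expectation (\<lambda>\<omega>. Z \<omega> * (\<zeta> k \<omega>)\<^sup>2) * (c (Suc k) - c k))"
proof -
  define J' where "J' n \<omega> = (\<Sum>k<n. \<zeta> k \<omega> * (B (c (Suc k)) \<omega> - B (c k) \<omega>))" for n \<omega>
  have J': "J = J' N" by (simp add: J_def J'_def fun_eq_iff)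
  have B_meas: "B t \<in> borel_measurable (F t)" if "0 \<le> t" for t
    using B that by (simp add: independent_increments_def)
  have bounded_int: "integrable M (\<lambda>\<omega>. Y \<omega> * Z' \<omega>)"
    if "integrable M Y" "Z' \<in> borel_measurable M" "\<And>\<omega>. \<omega> \<in> space M \<Longrightarrow> \<bar>Z' \<omega>\<bar> \<le> K'" for Y Z' :: "'a \<Rightarrow> real" and K'
  proof (rule Bochner_Integration.integrable_bound[of M "\<lambda>\<omega>. K' * Y \<omega>"])
    show "AE \<omega> in M. norm (Y \<omega> * Z' \<omega>) \<le> norm (K' * Y \<omega>)"
    proof (intro AE_I2)
      fix \<omega> assume "\<omega> \<in> space M"
      then have "\<bar>Z' \<omega>\<bar> \<le> \<bar>K'\<bar>" using that(3) by force
      then show "norm (Y \<omega> * Z' \<omega>) \<le> norm (K' * Y \<omega>)"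
        by (simp add: abs_mult mult.commute[of "\<bar>K'\<bar>"] mult_left_mono)
    qed
  qed (use that in auto)
  have "n \<le> N \<Longrightarrow> 0 \<le> c n \<and> J' n \<in> borel_measurable (F (c n)) \<and> Z \<in> borel_measurable (F (c n)) \<and>
      integrable M (\<lambda>\<omega>. (J' n \<omega>)\<^sup>2) \<and> expectation (\<lambda>\<omega>. Z \<omega> * J' n \<omega>) = 0 \<and>
      expectation (\<lambda>\<omega>. Z \<omega> * (J' n \<omega>)\<^sup>2) = (\<Sum>k<n. expectation (\<lambda>\<omega>. Z \<omega> * (\<zeta> k \<omega>)\<^sup>2) * (c (Suc k) - c k))" for n
  proof (induction n)
    case 0
    then show ?case using c0 Z by (simp add: J'_def)
  next
    case (Suc n)
    then have n: "n < N" and IH: "0 \<le> c n" "J' n \<in> borel_measurable (F (c n))" "Z \<in> borel_measurable (F (c n))"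
      "integrable M (\<lambda>\<omega>. (J' n \<omega>)\<^sup>2)" "expectation (\<lambda>\<omega>. Z \<omega> * J' n \<omega>) = 0"
      "expectation (\<lambda>\<omega>. Z \<omega> * (J' n \<omega>)\<^sup>2) = (\<Sum>k<n. expectation (\<lambda>\<omega>. Z \<omega> * (\<zeta> k \<omega>)\<^sup>2) * (c (Suc k) - c k))"
      by auto
    show ?case
    proof (cases "c n = c (Suc n)")
      case True
      then have "J' (Suc n) = J' n" by (simp add: J'_def fun_eq_iff)
      with IH True show ?thesis by simp
    next
      case False
      with c[OF n] have less: "c n < c (Suc n)" by simp
      let ?G = "F (c n)"
      let ?D = "\<lambda>\<omega>. B (c (Suc n)) \<omega> - B (c n) \<omega>"
      have sub: "subalgebra M ?G" "subalgebra (F (c (Suc n))) ?G" "subalgebra M (F (c (Suc n)))"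
        using usual_filtrationD[OF F] IH(1) less by auto
      note [measurable] = \<zeta>[OF n less] IH(2,3)
      obtain K where K: "\<And>\<omega>. \<omega> \<in> space M \<Longrightarrow> \<bar>\<zeta> n \<omega>\<bar> \<le> K" using \<zeta>_bd[OF n] by blast
      have up: "f \<in> borel_measurable ?G \<Longrightarrow> f \<in> borel_measurable M" for f :: "'a \<Rightarrow> real"
        by (rule measurable_from_subalg[OF sub(1)])
      have up': "f \<in> borel_measurable ?G \<Longrightarrow> f \<in> borel_measurable (F (c (Suc n)))" for f :: "'a \<Rightarrow> real"
        by (rule measurable_from_subalg[OF sub(2)])
      have inc: "integrable M (\<lambda>\<omega>. g \<omega> * ?D \<omega>)" "expectation (\<lambda>\<omega>. g \<omega> * ?D \<omega>) = 0"
        "integrable M (\<lambda>\<omega>. g \<omega> * (?D \<omega>)\<^sup>2)"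
        "expectation (\<lambda>\<omega>. g \<omega> * (?D \<omega>)\<^sup>2) = (c (Suc n) - c n) * expectation g"
        if "g \<in> borel_measurable ?G" "integrable M g" for g
        using B IH(1) less that unfolding independent_increments_def by auto
      have J_Suc: "J' (Suc n) \<omega> = J' n \<omega> + \<zeta> n \<omega> * ?D \<omega>" for \<omega> by (simp add: J'_def)
      have meas: "J' (Suc n) \<in> borel_measurable (F (c (Suc n)))"
      proof -
        note [measurable] = up'[OF \<zeta>[OF n less]] up'[OF IH(2)] up'[OF B_meas[OF IH(1)]]
        have [measurable]: "B (c (Suc n)) \<in> borel_measurable (F (c (Suc n)))" using IH(1) less by (intro B_meas) auto
        show ?thesis unfolding J_Suc[abs_def] by measurable
      qed
      have [simp]: "integrable M (J' n)" by (rule integrable_of_sq[OF up[OF IH(2)] IH(4)])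
      have Zm: "Z \<in> borel_measurable M" "\<zeta> n \<in> borel_measurable M" by (rule up[OF IH(3)], rule up[OF \<zeta>[OF n less]])
      have zb: "integrable M (\<lambda>\<omega>. Y \<omega> * \<zeta> n \<omega>)" "integrable M (\<lambda>\<omega>. Y \<omega> * Z \<omega>)" if "integrable M Y" for Y
        by (rule bounded_int[OF that Zm(2) K], assumption, rule bounded_int[OF that Zm(1) Z_bd])
      have i1: "integrable M (\<lambda>\<omega>. (\<zeta> n \<omega>)\<^sup>2)" "integrable M (\<zeta> n)"
        using zb(1)[OF zb(1)[of "\<lambda>_. 1"]] zb(1)[of "\<lambda>_. 1"] by (auto simp: power2_eq_square)
      have i2: "integrable M (\<lambda>\<omega>. Z \<omega> * (\<zeta> n \<omega>)\<^sup>2)" "integrable M (\<lambda>\<omega>. Z \<omega> * \<zeta> n \<omega>)"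
        "integrable M (\<lambda>\<omega>. J' n \<omega> * \<zeta> n \<omega>)" "integrable M (\<lambda>\<omega>. Z \<omega> * (J' n \<omega> * \<zeta> n \<omega>))"
        "integrable M (\<lambda>\<omega>. Z \<omega> * J' n \<omega>)" "integrable M (\<lambda>\<omega>. Z \<omega> * (J' n \<omega>)\<^sup>2)"
        using zb(2)[OF i1(1)] zb(2)[OF i1(2)] zb(1)[of "J' n"] zb(2)[OF zb(1)[of "J' n"]] zb(2)[of "J' n"] zb(2)[OF IH(4)]
        by (auto simp: mult.commute)
      have sq: "(J' (Suc n) \<omega>)\<^sup>2 = (J' n \<omega>)\<^sup>2 + (\<zeta> n \<omega>)\<^sup>2 * (?D \<omega>)\<^sup>2 + 2 * ((J' n \<omega> * \<zeta> n \<omega>) * ?D \<omega>)" for \<omega>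
        unfolding J_Suc by (simp add: power2_sum power_mult_distrib mult.assoc)
      have i3: "integrable M (\<lambda>\<omega>. (J' (Suc n) \<omega>)\<^sup>2)"
        unfolding sq
        by (intro Bochner_Integration.integrable_add integrable_mult_right inc(1,3) i1 i2 IH(4)) measurable
      have "expectation (\<lambda>\<omega>. Z \<omega> * J' (Suc n) \<omega>) = expectation (\<lambda>\<omega>. Z \<omega> * J' n \<omega> + (Z \<omega> * \<zeta> n \<omega>) * ?D \<omega>)"
        by (simp add: J_Suc algebra_simps)
      also have "\<dots> = 0"
        using inc(1,2)[of "\<lambda>\<omega>. Z \<omega> * \<zeta> n \<omega>"] i2 IH(5) by simp
      finally have e1: "expectation (\<lambda>\<omega>. Z \<omega> * J' (Suc n) \<omega>) = 0" .
      have "expectation (\<lambda>\<omega>. Z \<omega> * (J' (Suc n) \<omega>)\<^sup>2) =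
          expectation (\<lambda>\<omega>. Z \<omega> * (J' n \<omega>)\<^sup>2 + (Z \<omega> * (\<zeta> n \<omega>)\<^sup>2) * (?D \<omega>)\<^sup>2 + 2 * ((Z \<omega> * (J' n \<omega> * \<zeta> n \<omega>)) * ?D \<omega>))"
        unfolding sq by (intro arg_cong[where f = expectation] ext) (simp add: distrib_left mult.assoc mult.left_commute)
      also have "\<dots> = expectation (\<lambda>\<omega>. Z \<omega> * (J' n \<omega>)\<^sup>2) + (c (Suc n) - c n) * expectation (\<lambda>\<omega>. Z \<omega> * (\<zeta> n \<omega>)\<^sup>2)"
        using inc(3,4)[of "\<lambda>\<omega>. Z \<omega> * (\<zeta> n \<omega>)\<^sup>2"] inc(1,2)[of "\<lambda>\<omega>. Z \<omega> * (J' n \<omega> * \<zeta> n \<omega>)"] i2 by simp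
      finally have e2: "expectation (\<lambda>\<omega>. Z \<omega> * (J' (Suc n) \<omega>)\<^sup>2) =
          (\<Sum>k<Suc n. expectation (\<lambda>\<omega>. Z \<omega> * (\<zeta> k \<omega>)\<^sup>2) * (c (Suc k) - c k))"
        using IH(6) by (simp add: mult.commute)
      show ?thesis using IH(1) less meas up'[OF IH(3)] i3 e1 e2 by simp
    qed
  qed
  from this[of N] show "J \<in> borel_measurable (F (c N))" "integrable M (\<lambda>\<omega>. (J \<omega>)\<^sup>2)"
    "expectation (\<lambda>\<omega>. Z \<omega> * J \<omega>) = 0"
    "expectation (\<lambda>\<omega>. Z \<omega> * (J \<omega>)\<^sup>2) = (\<Sum>k<N. expectation (\<lambda>\<omega>. Z \<omega> * (\<zeta> k \<omega>)\<^sup>2) * (c (Suc k) - c k))"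
    unfolding J' by auto
qed

lemma step_intervals_disjoint:
  fixes c :: "nat \<Rightarrow> real"
  assumes c: "\<And>k. k < N \<Longrightarrow> c k \<le> c (Suc k)" and "i < N" "j < N"
    and "r \<in> {c i<..c (Suc i)}" "r \<in> {c j<..c (Suc j)}"
  shows "i = j"
proof -
  have mono: "c i \<le> c j" if "i \<le> j" "j \<le> N" for i j
    using that by (induction j rule: dec_induct) (use c in \<open>auto intro: order_trans\<close>)
  show ?thesis
    using assms(2-) mono[of "Suc i" j] mono[of "Suc j" i] by (cases i j rule: linorder_cases) auto
qed

text \<open>The increment over \<open>{u..v}\<close> of a simple integral, compensated by \<open>\<theta> * (B v - B u)\<close>, is itself the integral
  of a step function: clamp the partition to \<open>{u..v}\<close>, add the points \<open>u\<close> and \<open>v\<close>, and subtract \<open>\<theta>\<close> from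
  each coefficient.\<close>

lemma (in prob_space) simple_increment:
  assumes F: "usual_filtration M F" and B: "independent_increments M F B"
    and simple: "simple_integrand M F T N p \<xi>"
    and uv: "0 \<le> u" "u < v"
    and \<theta>: "\<theta> \<in> borel_measurable (F u)" "\<And>\<omega>. \<omega> \<in> space M \<Longrightarrow> \<bar>\<theta> \<omega>\<bar> \<le> K\<theta>"
    and Z: "Z \<in> borel_measurable (F u)" "\<And>\<omega>. 0 \<le> Z \<omega>" "\<And>\<omega>. \<omega> \<in> space M \<Longrightarrow> Z \<omega> \<le> KZ"
  defines "D \<equiv> \<lambda>\<omega>. simple_integral B N p \<xi> v \<omega> - simple_integral B N p \<xi> u \<omega> - \<theta> \<omega> * (B v \<omega> - B u \<omega>)"
  shows "D \<in> borel_measurable M" "integrable M (\<lambda>\<omega>. (D \<omega>)\<^sup>2)" "expectation (\<lambda>\<omega>. Z \<omega> * D \<omega>) = 0"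
    "(\<integral>\<^sup>+\<omega>. ennreal (Z \<omega> * (D \<omega>)\<^sup>2) \<partial>M) \<le>
      (\<integral>\<^sup>+\<omega>. ennreal (Z \<omega>) * (\<integral>\<^sup>+r\<in>{u..v}. ennreal ((simple_process N p \<xi> r \<omega> - \<theta> \<omega>)\<^sup>2) \<partial>lborel) \<partial>M)"
proof -
  (* The refined partition is u, the clamped points of p, and v; the outer two intervals carry no simple integrand. *)
  define clamp where "clamp q = max u (min v q)" for q
  define c where "c k = (if k = 0 then u else if k \<le> Suc N then clamp (p (k - 1)) else v)" for k
  define \<zeta> where "\<zeta> k \<omega> = (if k = 0 \<or> k = Suc N then 0 else \<xi> (k - 1) \<omega>) - \<theta> \<omega>" for k \<omega>
  have p: "p k < p (Suc k)" if "k < N" for k using simple that by (simp add: simple_integrand_def)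
  have p0: "0 \<le> p k" if "k \<le> N" for k
    using that
  proof (induction k)
    case 0
    then show ?case using simple by (simp add: simple_integrand_def)
  next
    case (Suc k)
    then show ?case using p[of k] by simp
  qed
  have \<xi>: "\<xi> k \<in> borel_measurable (F (p k))" "\<exists>K. \<forall>\<omega>\<in>space M. \<bar>\<xi> k \<omega>\<bar> \<le> K" if "k < N" for k
    using simple that by (auto simp: simple_integrand_def)
  have clamp: "u \<le> clamp q" "clamp q \<le> v" for q using uv by (auto simp: clamp_def)
  have c_simps: "c 0 = u" "c (Suc (Suc N)) = v" "\<And>j. j \<le> N \<Longrightarrow> c (Suc j) = clamp (p j)"
    by (auto simp: c_def)
  have \<zeta>_simps: "\<zeta> 0 = (\<lambda>\<omega>. - \<theta> \<omega>)" "\<zeta> (Suc N) = (\<lambda>\<omega>. - \<theta> \<omega>)" "\<And>j. j < N \<Longrightarrow> \<zeta> (Suc j) = (\<lambda>\<omega>. \<xi> j \<omega> - \<theta> \<omega>)"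
    by (auto simp: \<zeta>_def fun_eq_iff)
  have split: "k = 0 \<or> k = Suc N \<or> (\<exists>j<N. k = Suc j)" if "k < Suc (Suc N)" for k
    using that by (cases k) (auto simp: less_Suc_eq)
  have c_mono: "c k \<le> c (Suc k)" if "k < Suc (Suc N)" for k
    using split[OF that]
  proof (elim disjE exE conjE)
    fix j assume "j < N" "k = Suc j"
    then show ?thesis using p[of j] by (simp add: c_simps clamp_def min_def max_def)
  qed (use clamp in \<open>auto simp: c_simps\<close>)
  have cu: "u \<le> c k" for k using clamp uv by (auto simp: c_def)
  have \<theta>_at: "\<theta> \<in> borel_measurable (F (c k))" for k
    by (rule measurable_from_subalg[OF usual_filtrationD(2)[OF F uv(1) cu] \<theta>(1)])
  have \<zeta>_meas: "\<zeta> k \<in> borel_measurable (F (c k))" if k: "k < Suc (Suc N)" and less: "c k < c (Suc k)" for k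
    using split[OF k]
  proof (elim disjE exE conjE)
    fix j assume j: "j < N" "k = Suc j"
    have "p j \<le> c k" using less j p[OF j(1)] by (auto simp: c_simps clamp_def min_def max_def split: if_splits)
    then have "\<xi> j \<in> borel_measurable (F (c k))"
      using measurable_from_subalg[OF usual_filtrationD(2)[OF F p0[of j]] \<xi>(1)[OF j(1)]] j by auto
    then show ?thesis using \<theta>_at[of k] j by (simp add: \<zeta>_simps)
  qed (use \<theta>_at[of k] in \<open>auto simp: \<zeta>_simps\<close>)
  have \<zeta>_bd: "\<exists>K. \<forall>\<omega>\<in>space M. \<bar>\<zeta> k \<omega>\<bar> \<le> K" if k: "k < Suc (Suc N)" for k
    using split[OF k]
  proof (elim disjE exE conjE)
    fix j assume j: "j < N" "k = Suc j"
    obtain K where K: "\<forall>\<omega>\<in>space M. \<bar>\<xi> j \<omega>\<bar> \<le> K" using \<xi>(2)[OF j(1)] by blast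
    show ?thesis
    proof (intro exI ballI)
      fix \<omega> assume "\<omega> \<in> space M"
      then show "\<bar>\<zeta> k \<omega>\<bar> \<le> K + K\<theta>"
        using K \<theta>(2)[of \<omega>] j by (simp add: \<zeta>_simps) (smt (verit))
    qed
  qed (use \<theta>(2) in \<open>auto simp: \<zeta>_simps\<close>)
  have D_sum: "D \<omega> = (\<Sum>k<Suc (Suc N). \<zeta> k \<omega> * (B (c (Suc k)) \<omega> - B (c k) \<omega>))" for \<omega>
  proof -
    (* For q below u both sides vanish, for q above v both are B v - B u. *)
    have clampB: "B (min v q) \<omega> - B (min u q) \<omega> = B (clamp q) \<omega> - B u \<omega>" for q
      using uv by (auto simp: clamp_def min_def max_def)
    have inner: "simple_integral B N p \<xi> v \<omega> - simple_integral B N p \<xi> u \<omega> =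
        (\<Sum>j<N. \<xi> j \<omega> * (B (c (Suc (Suc j))) \<omega> - B (c (Suc j)) \<omega>))"
      unfolding simple_integral_def sum_subtractf[symmetric]
    proof (intro sum.cong refl)
      fix j assume j: "j \<in> {..<N}"
      have "B (min v (p (Suc j))) \<omega> - B (min v (p j)) \<omega> - (B (min u (p (Suc j))) \<omega> - B (min u (p j)) \<omega>)
          = B (c (Suc (Suc j))) \<omega> - B (c (Suc j)) \<omega>"
        using clampB[of "p (Suc j)"] clampB[of "p j"] j by (simp add: c_simps(3))
      then show "\<xi> j \<omega> * (B (min v (p (Suc j))) \<omega> - B (min v (p j)) \<omega>)
          - \<xi> j \<omega> * (B (min u (p (Suc j))) \<omega> - B (min u (p j)) \<omega>)
          = \<xi> j \<omega> * (B (c (Suc (Suc j))) \<omega> - B (c (Suc j)) \<omega>)"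
        by (metis right_diff_distrib)
    qed
    have tele: "(\<Sum>k<Suc (Suc N). B (c (Suc k)) \<omega> - B (c k) \<omega>) = B v \<omega> - B u \<omega>"
      using sum_lessThan_telescope[of "\<lambda>k. B (c k) \<omega>" "Suc (Suc N)"] by (simp only: c_simps)
    define \<eta> where "\<eta> k = (if k = 0 \<or> k = Suc N then 0 else \<xi> (k - 1) \<omega>)" for k
    have "(\<Sum>k<Suc (Suc N). \<zeta> k \<omega> * (B (c (Suc k)) \<omega> - B (c k) \<omega>)) =
        (\<Sum>k<Suc (Suc N). \<eta> k * (B (c (Suc k)) \<omega> - B (c k) \<omega>)) - \<theta> \<omega> * (B v \<omega> - B u \<omega>)"
      unfolding tele[symmetric] sum_distrib_left sum_subtractf[symmetric]
      by (intro sum.cong refl) (simp add: \<zeta>_def \<eta>_def algebra_simps)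
    also have "(\<Sum>k<Suc (Suc N). \<eta> k * (B (c (Suc k)) \<omega> - B (c k) \<omega>)) =
        (\<Sum>k<Suc N. \<eta> k * (B (c (Suc k)) \<omega> - B (c k) \<omega>))"
      by (subst sum.lessThan_Suc) (simp add: \<eta>_def)
    also have "\<dots> = (\<Sum>j<N. \<xi> j \<omega> * (B (c (Suc (Suc j))) \<omega> - B (c (Suc j)) \<omega>))"
      by (subst sum.lessThan_Suc_shift) (simp add: \<eta>_def)
    finally show ?thesis using inner by (simp add: D_def)
  qed
  have Zabs: "\<bar>Z \<omega>\<bar> \<le> KZ" if "\<omega> \<in> space M" for \<omega> using Z that by simp
  have c0: "0 \<le> c 0" and Z0: "Z \<in> borel_measurable (F (c 0))" using uv Z by (auto simp: c_simps)
  note step = step_integral_moments[where c = c and \<zeta> = \<zeta> and Z = Z and N = "Suc (Suc N)" and KZ = KZ and F = F and B = B,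
      OF F B c0 c_mono \<zeta>_meas \<zeta>_bd Z0 Zabs, folded D_sum]
  have "D \<in> borel_measurable (F v)" using step(1) by (simp add: c_simps D_sum[abs_def])
  then show DM: "D \<in> borel_measurable M"
    using uv by (intro measurable_from_subalg[OF usual_filtrationD(1)[OF F]]) auto
  show D2: "integrable M (\<lambda>\<omega>. (D \<omega>)\<^sup>2)" by (rule step(2))
  show "expectation (\<lambda>\<omega>. Z \<omega> * D \<omega>) = 0" by (rule step(3))
  have ZM: "Z \<in> borel_measurable M" by (rule measurable_from_subalg[OF usual_filtrationD(1)[OF F uv(1)] Z(1)])
  have \<theta>M: "\<theta> \<in> borel_measurable M" by (rule measurable_from_subalg[OF usual_filtrationD(1)[OF F uv(1)] \<theta>(1)])
  have \<zeta>M: "\<zeta> k \<in> borel_measurable M" if k: "k < Suc (Suc N)" for k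
    using split[OF k]
  proof (elim disjE exE conjE)
    fix j assume j: "j < N" "k = Suc j"
    have "\<xi> j \<in> borel_measurable M"
      using j p0[of j] by (intro measurable_from_subalg[OF usual_filtrationD(1)[OF F] \<xi>(1)]) auto
    then show ?thesis using \<theta>M j by (simp add: \<zeta>_simps)
  qed (use \<theta>M in \<open>auto simp: \<zeta>_simps\<close>)
  have int_Z\<zeta>: "integrable M (\<lambda>\<omega>. Z \<omega> * (\<zeta> k \<omega>)\<^sup>2)" if k: "k < Suc (Suc N)" for k
  proof -
    obtain K where K: "\<And>\<omega>. \<omega> \<in> space M \<Longrightarrow> \<bar>\<zeta> k \<omega>\<bar> \<le> K" using \<zeta>_bd[OF k] by blast
    have "AE \<omega> in M. norm (Z \<omega> * (\<zeta> k \<omega>)\<^sup>2) \<le> KZ * K\<^sup>2"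
    proof (intro AE_I2)
      fix \<omega> assume \<omega>: "\<omega> \<in> space M"
      have "(\<zeta> k \<omega>)\<^sup>2 \<le> K\<^sup>2" using K[OF \<omega>] by (simp add: abs_le_square_iff[symmetric])
      then have "Z \<omega> * (\<zeta> k \<omega>)\<^sup>2 \<le> KZ * K\<^sup>2"
        using Z(2)[of \<omega>] Z(3)[OF \<omega>] by (intro mult_mono) auto
      then show "norm (Z \<omega> * (\<zeta> k \<omega>)\<^sup>2) \<le> KZ * K\<^sup>2" using Z(2)[of \<omega>] by simp
    qed
    then show ?thesis using ZM \<zeta>M[OF k] by (intro integrable_const_bound) auto
  qed
  have int_ZD: "integrable M (\<lambda>\<omega>. Z \<omega> * (D \<omega>)\<^sup>2)"
  proof (rule Bochner_Integration.integrable_bound[of M "\<lambda>\<omega>. KZ * (D \<omega>)\<^sup>2"])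
    show "AE \<omega> in M. norm (Z \<omega> * (D \<omega>)\<^sup>2) \<le> norm (KZ * (D \<omega>)\<^sup>2)"
    proof (intro AE_I2)
      fix \<omega> assume "\<omega> \<in> space M"
      then have "0 \<le> Z \<omega>" "Z \<omega> \<le> KZ" using Z by auto
      then show "norm (Z \<omega> * (D \<omega>)\<^sup>2) \<le> norm (KZ * (D \<omega>)\<^sup>2)" by (simp add: mult_right_mono)
    qed
  qed (use D2 ZM DM in auto)
  have "(\<integral>\<^sup>+\<omega>. ennreal (Z \<omega> * (D \<omega>)\<^sup>2) \<partial>M) = ennreal (expectation (\<lambda>\<omega>. Z \<omega> * (D \<omega>)\<^sup>2))"
    using Z(2) by (intro nn_integral_eq_integral int_ZD) auto
  also have "expectation (\<lambda>\<omega>. Z \<omega> * (D \<omega>)\<^sup>2) = (\<Sum>k<Suc (Suc N). expectation (\<lambda>\<omega>. Z \<omega> * (\<zeta> k \<omega>)\<^sup>2) * (c (Suc k) - c k))"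
    by (rule step(4))
  also have "\<dots> = expectation (\<lambda>\<omega>. \<Sum>k<Suc (Suc N). Z \<omega> * (\<zeta> k \<omega>)\<^sup>2 * (c (Suc k) - c k))"
    using int_Z\<zeta> by (subst Bochner_Integration.integral_sum) auto
  also have "ennreal \<dots> = (\<integral>\<^sup>+\<omega>. ennreal (\<Sum>k<Suc (Suc N). Z \<omega> * (\<zeta> k \<omega>)\<^sup>2 * (c (Suc k) - c k)) \<partial>M)"
    using Z(2) c_mono int_Z\<zeta>
    by (intro nn_integral_eq_integral[symmetric] Bochner_Integration.integrable_sum AE_I2 sum_nonneg mult_nonneg_nonneg
        integrable_mult_left) auto
  also have "\<dots> \<le> (\<integral>\<^sup>+\<omega>. ennreal (Z \<omega>) * (\<integral>\<^sup>+r\<in>{u..v}. ennreal ((simple_process N p \<xi> r \<omega> - \<theta> \<omega>)\<^sup>2) \<partial>lborel) \<partial>M)"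
  proof (rule nn_integral_mono)
    fix \<omega>
    let ?I = "\<lambda>k. {c k<..c (Suc k)}"
    have pos: "0 \<le> c (Suc k) - c k" if "k < Suc (Suc N)" for k using c_mono[OF that] by simp
    have "(\<Sum>k<Suc (Suc N). ennreal ((\<zeta> k \<omega>)\<^sup>2) * ennreal (c (Suc k) - c k)) =
        (\<Sum>k<Suc (Suc N). \<integral>\<^sup>+r. ennreal ((\<zeta> k \<omega>)\<^sup>2) * indicator (?I k) r \<partial>lborel)"
      using c_mono by (intro sum.cong refl) (simp add: nn_integral_cmult_indicator)
    also have "\<dots> = (\<integral>\<^sup>+r. (\<Sum>k<Suc (Suc N). ennreal ((\<zeta> k \<omega>)\<^sup>2) * indicator (?I k) r) \<partial>lborel)"
      by (rule nn_integral_sum[symmetric]) simp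
    also have "\<dots> \<le> (\<integral>\<^sup>+r\<in>{u..v}. ennreal ((simple_process N p \<xi> r \<omega> - \<theta> \<omega>)\<^sup>2) \<partial>lborel)"
    proof (rule nn_integral_mono)
      fix r
      show "(\<Sum>k<Suc (Suc N). ennreal ((\<zeta> k \<omega>)\<^sup>2) * indicator (?I k) r)
          \<le> ennreal ((simple_process N p \<xi> r \<omega> - \<theta> \<omega>)\<^sup>2) * indicator {u..v} r"
      proof (cases "\<exists>k<Suc (Suc N). r \<in> ?I k")
        case True
        then obtain k where k: "k < Suc (Suc N)" "r \<in> ?I k" by blast
        have "c (Suc k) \<le> v" using clamp by (auto simp: c_def)
        then have r: "u < r" "r \<le> v" using k cu[of k] by auto
        have "(\<Sum>k'<Suc (Suc N). ennreal ((\<zeta> k' \<omega>)\<^sup>2) * indicator (?I k') r)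
            = (\<Sum>k'<Suc (Suc N). if k' = k then ennreal ((\<zeta> k \<omega>)\<^sup>2) else 0)"
        proof (intro sum.cong refl)
          fix k' assume k': "k' \<in> {..<Suc (Suc N)}"
          show "ennreal ((\<zeta> k' \<omega>)\<^sup>2) * indicator (?I k') r = (if k' = k then ennreal ((\<zeta> k \<omega>)\<^sup>2) else 0)"
          proof (cases "r \<in> ?I k'")
            case True
            have "k' = k"
              by (rule step_intervals_disjoint[OF c_mono _ k(1) True k(2)]) (use k' in auto)
            with True show ?thesis by simp
          next
            case False
            with k(2) have "k' \<noteq> k" by blast
            with False show ?thesis by simp
          qed
        qed
        also have "\<dots> = ennreal ((\<zeta> k \<omega>)\<^sup>2)" using k by simp
        also have "\<zeta> k \<omega> = simple_process N p \<xi> r \<omega> - \<theta> \<omega>"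
        proof -
          have p_mono: "p i \<le> p j" if "i \<le> j" "j \<le> N" for i j
            using that
          proof (induction j rule: dec_induct)
            case (step n)
            then have "p i \<le> p n" "p n < p (Suc n)" using p[of n] by auto
            then show ?case by simp
          qed simp
          have outside: "simple_process N p \<xi> r \<omega> = 0" if "r \<le> p 0 \<or> p N < r"
            unfolding simple_process_def
          proof (intro sum.neutral ballI)
            fix j assume "j \<in> {..<N}"
            then show "\<xi> j \<omega> * indicator {p j<..p (Suc j)} r = 0"
              using that p_mono[of 0 j] p_mono[of "Suc j" N] by (auto simp: indicator_def)
          qed
          show ?thesis
            using split[OF k(1)]
          proof (elim disjE exE conjE)
            assume k0: "k = 0"
            then have "r \<le> p 0" using k(2) r by (simp add: c_simps clamp_def)
            then show ?thesis using outside k0 by (simp add: \<zeta>_simps)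
          next
            assume kN: "k = Suc N"
            then have "p N < r" using k(2) r by (simp add: c_simps clamp_def)
            then show ?thesis using outside kN by (simp add: \<zeta>_simps)
          next
            fix j assume j: "j < N" "k = Suc j"
            have rj: "r \<in> {p j<..p (Suc j)}" using k(2) r j by (auto simp: c_simps clamp_def)
            have "simple_process N p \<xi> r \<omega> = (\<Sum>i<N. if i = j then \<xi> j \<omega> else 0)"
              unfolding simple_process_def
            proof (intro sum.cong refl)
              fix i assume i: "i \<in> {..<N}"
              show "\<xi> i \<omega> * indicator {p i<..p (Suc i)} r = (if i = j then \<xi> j \<omega> else 0)"
              proof (cases "r \<in> {p i<..p (Suc i)}")
                case True
                have "i = j"
                  by (rule step_intervals_disjoint[OF less_imp_le[OF p] _ j(1) True rj]) (use i in auto)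
                with True show ?thesis by simp
              next
                case False
                with rj have "i \<noteq> j" by blast
                with False show ?thesis by simp
              qed
            qed
            then show ?thesis using j by (simp add: \<zeta>_simps)
          qed
        qed
        finally show ?thesis using r by simp
      next
        case False
        then have zero: "(\<Sum>k<Suc (Suc N). ennreal ((\<zeta> k \<omega>)\<^sup>2) * indicator (?I k) r) = 0"
          by (intro sum.neutral) auto
        show ?thesis unfolding zero by simp
      qed
    qed
    finally have bound: "(\<Sum>k<Suc (Suc N). ennreal ((\<zeta> k \<omega>)\<^sup>2) * ennreal (c (Suc k) - c k))
        \<le> (\<integral>\<^sup>+r\<in>{u..v}. ennreal ((simple_process N p \<xi> r \<omega> - \<theta> \<omega>)\<^sup>2) \<partial>lborel)" .
    have "ennreal (\<Sum>k<Suc (Suc N). Z \<omega> * (\<zeta> k \<omega>)\<^sup>2 * (c (Suc k) - c k)) =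
        (\<Sum>k<Suc (Suc N). ennreal (Z \<omega> * (\<zeta> k \<omega>)\<^sup>2 * (c (Suc k) - c k)))"
      using Z(2) pos by (intro sum_ennreal[symmetric]) auto
    also have "\<dots> = ennreal (Z \<omega>) * (\<Sum>k<Suc (Suc N). ennreal ((\<zeta> k \<omega>)\<^sup>2) * ennreal (c (Suc k) - c k))"
      unfolding sum_distrib_left
      using Z(2)[of \<omega>] pos by (intro sum.cong refl) (simp add: ennreal_mult mult.assoc)
    also have "\<dots> \<le> ennreal (Z \<omega>) * (\<integral>\<^sup>+r\<in>{u..v}. ennreal ((simple_process N p \<xi> r \<omega> - \<theta> \<omega>)\<^sup>2) \<partial>lborel)"
      by (rule mult_left_mono[OF bound]) simp
    finally show "ennreal (\<Sum>k<Suc (Suc N). Z \<omega> * (\<zeta> k \<omega>)\<^sup>2 * (c (Suc k) - c k))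
      \<le> ennreal (Z \<omega>) * (\<integral>\<^sup>+r\<in>{u..v}. ennreal ((simple_process N p \<xi> r \<omega> - \<theta> \<omega>)\<^sup>2) \<partial>lborel)" .
  qed
  finally show "(\<integral>\<^sup>+\<omega>. ennreal (Z \<omega> * (D \<omega>)\<^sup>2) \<partial>M) \<le>
      (\<integral>\<^sup>+\<omega>. ennreal (Z \<omega>) * (\<integral>\<^sup>+r\<in>{u..v}. ennreal ((simple_process N p \<xi> r \<omega> - \<theta> \<omega>)\<^sup>2) \<partial>lborel) \<partial>M)" .
qed

section \<open>Increments of Ito integrals\<close>

lemma sq_sum_le: "(a + b)\<^sup>2 \<le> 2 * a\<^sup>2 + 2 * (b\<^sup>2 :: real)"
proof -
  have "0 \<le> (a - b)\<^sup>2" by simp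
  then show ?thesis by (simp add: power2_eq_square algebra_simps)
qed

lemma ennreal_sq_sum_le: "ennreal ((a + b)\<^sup>2) \<le> 2 * ennreal (a\<^sup>2) + 2 * ennreal (b\<^sup>2)"
proof -
  have "ennreal ((a + b)\<^sup>2) \<le> ennreal (2 * a\<^sup>2 + 2 * b\<^sup>2)" by (rule ennreal_leI[OF sq_sum_le])
  also have "\<dots> = 2 * ennreal (a\<^sup>2) + 2 * ennreal (b\<^sup>2)" by (simp add: ennreal_mult)
  finally show ?thesis .
qed

text \<open>Truncation of the weight and monotone convergence.\<close>

lemma nn_integral_bounded_weight:
  assumes "\<And>m :: nat. (\<integral>\<^sup>+\<omega>. ennreal (min (Z \<omega>) (real m) * Y \<omega>) \<partial>M) \<le> c"
    and [measurable]: "Z \<in> borel_measurable M" "Y \<in> borel_measurable M" and "\<And>\<omega>. 0 \<le> Y \<omega>"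
  shows "(\<integral>\<^sup>+\<omega>. ennreal (Z \<omega> * Y \<omega>) \<partial>M) \<le> c"
proof -
  have "(\<integral>\<^sup>+\<omega>. ennreal (Z \<omega> * Y \<omega>) \<partial>M) = (\<integral>\<^sup>+\<omega>. (SUP m :: nat. ennreal (min (Z \<omega>) (real m) * Y \<omega>)) \<partial>M)"
  proof (rule nn_integral_cong)
    fix \<omega>
    obtain m :: nat where "Z \<omega> \<le> real m" using real_arch_simple by blast
    then have "ennreal (Z \<omega> * Y \<omega>) = ennreal (min (Z \<omega>) (real m) * Y \<omega>)" by (simp add: min_def)
    moreover have "ennreal (min (Z \<omega>) (real m) * Y \<omega>) \<le> ennreal (Z \<omega> * Y \<omega>)" for m :: nat
      using assms(4)[of \<omega>] by (intro ennreal_leI mult_right_mono) auto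
    ultimately show "ennreal (Z \<omega> * Y \<omega>) = (SUP m :: nat. ennreal (min (Z \<omega>) (real m) * Y \<omega>))"
      by (intro antisym SUP_least) (auto intro: SUP_upper2)
  qed
  also have "\<dots> = (SUP m :: nat. \<integral>\<^sup>+\<omega>. ennreal (min (Z \<omega>) (real m) * Y \<omega>) \<partial>M)"
    using assms(4)
    by (intro nn_integral_monotone_convergence_SUP)
       (auto simp: incseq_def le_fun_def intro!: ennreal_leI mult_right_mono)
  also have "\<dots> \<le> c" using assms(1) by (rule SUP_least)
  finally show ?thesis .
qed

text \<open>Orthogonality to the past and a bound for second moments, obtained by passing to the limit in
  \<open>simple_increment\<close>. The approximation is in mean square, and splitting off the approximation error by
  \<open>(a + b)\<^sup>2 \<le> 2 * a\<^sup>2 + 2 * b\<^sup>2\<close> once for the integral and once for the integrand produces the factor \<open>4\<close>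
  in place of the isometry. The jointly measurable version \<open>H'\<close> of the integrand makes its time
  integrals measurable functions of \<open>\<omega>\<close>, so that integrals over \<open>\<omega>\<close> can be split into sums. The
  compensator \<open>\<theta> * (B v - B u)\<close> will be the increment used by the scheme.\<close>

lemma (in prob_space) ito_increment:
  assumes F: "usual_filtration M F" and B: "independent_increments M F B"
    and ito: "ito_integral M F T B H I"
    and H': "(\<lambda>(r, \<omega>). H' r \<omega>) \<in> borel_measurable (lborel \<Otimes>\<^sub>M M)"
      "AE \<omega> in M. \<forall>r\<in>{0..T}. H r \<omega> = H' r \<omega>"
    and uv: "0 \<le> u" "u < v" "v \<le> T"
    and \<theta>: "\<theta> \<in> borel_measurable (F u)" "\<And>\<omega>. \<omega> \<in> space M \<Longrightarrow> \<bar>\<theta> \<omega>\<bar> \<le> K\<theta>"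
  defines "N \<equiv> \<lambda>\<omega>. I v \<omega> - I u \<omega> - \<theta> \<omega> * (B v \<omega> - B u \<omega>)"
  shows "N \<in> borel_measurable (F v)" "integrable M (\<lambda>\<omega>. (N \<omega>)\<^sup>2)" "mean_zero_given M (F u) N"
    "\<And>Z. Z \<in> borel_measurable (F u) \<Longrightarrow> (\<And>\<omega>. 0 \<le> Z \<omega>) \<Longrightarrow>
      (\<integral>\<^sup>+\<omega>. ennreal (Z \<omega> * (N \<omega>)\<^sup>2) \<partial>M) \<le>
        4 * (\<integral>\<^sup>+\<omega>. ennreal (Z \<omega>) * (\<integral>\<^sup>+r\<in>{u..v}. ennreal ((H' r \<omega> - \<theta> \<omega>)\<^sup>2) \<partial>lborel) \<partial>M)"
proof -
  obtain n s \<xi> where simple: "\<And>m :: nat. simple_integrand M F T (n m) (s m) (\<xi> m)"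
    and H_lim: "(\<lambda>m. \<integral>\<^sup>+\<omega>. (\<integral>\<^sup>+t\<in>{0..T}. ennreal ((simple_process (n m) (s m) (\<xi> m) t \<omega> - H t \<omega>)\<^sup>2) \<partial>lborel) \<partial>M) \<longlonglongrightarrow> 0"
    and I_lim: "\<And>t. t \<in> {0..T} \<Longrightarrow>
      (\<lambda>m. \<integral>\<^sup>+\<omega>. ennreal ((simple_integral B (n m) (s m) (\<xi> m) t \<omega> - I t \<omega>)\<^sup>2) \<partial>M) \<longlonglongrightarrow> 0"
    using ito unfolding ito_integral_def by blast
  have I_meas: "I t \<in> borel_measurable (F t)" if "t \<in> {0..T}" for t
    using ito that unfolding ito_integral_def by blast
  have sub: "subalgebra M (F t)" if "0 \<le> t" for t by (rule usual_filtrationD(1)[OF F that])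
  have B_meas: "B t \<in> borel_measurable (F t)" if "0 \<le> t" for t
    using B that by (simp add: independent_increments_def)
  have BM: "B t \<in> borel_measurable M" if "0 \<le> t" for t
    by (rule measurable_from_subalg[OF sub[OF that] B_meas[OF that]])
  have [measurable]: "B u \<in> borel_measurable M" "B v \<in> borel_measurable M" using uv by (auto intro: BM)
  have IM: "I t \<in> borel_measurable M" if "t \<in> {0..T}" for t
    using that by (intro measurable_from_subalg[OF sub I_meas]) auto
  have [measurable]: "I u \<in> borel_measurable M" "I v \<in> borel_measurable M" using uv by (auto intro: IM)
  have \<theta>M [measurable]: "\<theta> \<in> borel_measurable M" by (rule measurable_from_subalg[OF sub[OF uv(1)] \<theta>(1)])
  have up: "f \<in> borel_measurable (F v)" if "f \<in> borel_measurable (F u)" for f :: "'a \<Rightarrow> real"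
    using uv by (intro measurable_from_subalg[OF usual_filtrationD(2)[OF F] that]) auto
  have [measurable]: "I v \<in> borel_measurable (F v)" "B v \<in> borel_measurable (F v)" "I u \<in> borel_measurable (F v)"
    "B u \<in> borel_measurable (F v)" "\<theta> \<in> borel_measurable (F v)"
    using uv by (auto intro!: up I_meas B_meas \<theta>(1))
  show "N \<in> borel_measurable (F v)" unfolding N_def by measurable
  have NM [measurable]: "N \<in> borel_measurable M" unfolding N_def by measurable
  let ?SP = "\<lambda>m. simple_process (n m) (s m) (\<xi> m)"
  let ?SI = "\<lambda>m. simple_integral B (n m) (s m) (\<xi> m)"
  define D where "D m \<omega> = ?SI m v \<omega> - ?SI m u \<omega> - \<theta> \<omega> * (B v \<omega> - B u \<omega>)" for m \<omega>
  have s0: "0 \<le> s m k" if "k \<le> n m" for m k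
    using that
  proof (induction k)
    case 0
    then show ?case using simple[of m] by (simp add: simple_integrand_def)
  next
    case (Suc k)
    then have "s m k < s m (Suc k)" using simple[of m] by (simp add: simple_integrand_def)
    with Suc show ?case by simp
  qed
  have \<xi>M: "\<xi> m k \<in> borel_measurable M" if "k < n m" for m k
    using simple[of m] that s0[of k m] by (intro measurable_from_subalg[OF sub]) (auto simp: simple_integrand_def)
  have SI_M [measurable]: "?SI m t \<in> borel_measurable M" if "0 \<le> t" for m t
    unfolding simple_integral_def using \<xi>M s0 that
    by (intro borel_measurable_sum borel_measurable_times borel_measurable_diff BM) auto
  have [measurable]: "?SI m u \<in> borel_measurable M" "?SI m v \<in> borel_measurable M" for m
    using uv by (auto intro!: SI_M)
  (* The approximation errors in mean square: epsilon for the integrand, delta for the increment N. *)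
  define \<epsilon> where "\<epsilon> m = (\<integral>\<^sup>+\<omega>. (\<integral>\<^sup>+t\<in>{0..T}. ennreal ((?SP m t \<omega> - H' t \<omega>)\<^sup>2) \<partial>lborel) \<partial>M)" for m
  have \<epsilon>: "\<epsilon> \<longlonglongrightarrow> 0"
  proof -
    have "\<epsilon> m = (\<integral>\<^sup>+\<omega>. (\<integral>\<^sup>+t\<in>{0..T}. ennreal ((?SP m t \<omega> - H t \<omega>)\<^sup>2) \<partial>lborel) \<partial>M)" for m
      unfolding \<epsilon>_def
    proof (rule nn_integral_cong_AE)
      show "AE \<omega> in M. (\<integral>\<^sup>+t\<in>{0..T}. ennreal ((?SP m t \<omega> - H' t \<omega>)\<^sup>2) \<partial>lborel)
          = (\<integral>\<^sup>+t\<in>{0..T}. ennreal ((?SP m t \<omega> - H t \<omega>)\<^sup>2) \<partial>lborel)"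
        using H'(2) by eventually_elim (auto intro!: nn_integral_cong simp: indicator_def)
    qed
    then have "\<epsilon> = (\<lambda>m. \<integral>\<^sup>+\<omega>. (\<integral>\<^sup>+t\<in>{0..T}. ennreal ((?SP m t \<omega> - H t \<omega>)\<^sup>2) \<partial>lborel) \<partial>M)"
      by (rule ext)
    with H_lim show ?thesis by simp
  qed
  define \<delta> where "\<delta> m = (\<integral>\<^sup>+\<omega>. ennreal ((N \<omega> - D m \<omega>)\<^sup>2) \<partial>M)" for m
  define \<alpha> where "\<alpha> t m = (\<integral>\<^sup>+\<omega>. ennreal ((?SI m t \<omega> - I t \<omega>)\<^sup>2) \<partial>M)" for t m
  have \<delta>_le: "\<delta> m \<le> 2 * \<alpha> v m + 2 * \<alpha> u m" for m
  proof -
    have "\<delta> m \<le> (\<integral>\<^sup>+\<omega>. 2 * ennreal ((?SI m v \<omega> - I v \<omega>)\<^sup>2) + 2 * ennreal ((?SI m u \<omega> - I u \<omega>)\<^sup>2) \<partial>M)"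
      unfolding \<delta>_def
    proof (rule nn_integral_mono)
      fix \<omega>
      have "(N \<omega> - D m \<omega>)\<^sup>2 = (- (?SI m v \<omega> - I v \<omega>) + (?SI m u \<omega> - I u \<omega>))\<^sup>2"
        by (intro arg_cong[where f = "\<lambda>x. x\<^sup>2"]) (simp add: N_def D_def)
      then show "ennreal ((N \<omega> - D m \<omega>)\<^sup>2) \<le> 2 * ennreal ((?SI m v \<omega> - I v \<omega>)\<^sup>2) + 2 * ennreal ((?SI m u \<omega> - I u \<omega>)\<^sup>2)"
        using ennreal_sq_sum_le[of "- (?SI m v \<omega> - I v \<omega>)" "?SI m u \<omega> - I u \<omega>"] by (simp only: power2_minus)
    qed
    also have "\<dots> = 2 * \<alpha> v m + 2 * \<alpha> u m"
      unfolding \<alpha>_def by (simp add: nn_integral_add nn_integral_cmult)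
    finally show ?thesis .
  qed
  have \<delta>: "\<delta> \<longlonglongrightarrow> 0"
  proof (rule tendsto_sandwich[OF _ _ tendsto_const])
    show "(\<lambda>m. 2 * \<alpha> v m + 2 * \<alpha> u m) \<longlonglongrightarrow> 0"
      using tendsto_add[OF tendsto_mult_ennreal[OF tendsto_const[of 2] I_lim[of v, folded \<alpha>_def]]
          tendsto_mult_ennreal[OF tendsto_const[of 2] I_lim[of u, folded \<alpha>_def]]] uv by simp
  qed (auto simp: \<delta>_le)
  have D_inc: "D m \<in> borel_measurable M" "integrable M (\<lambda>\<omega>. (D m \<omega>)\<^sup>2)"
      "Z \<in> borel_measurable (F u) \<Longrightarrow> (\<And>\<omega>. 0 \<le> Z \<omega>) \<Longrightarrow> (\<And>\<omega>. \<omega> \<in> space M \<Longrightarrow> Z \<omega> \<le> KZ) \<Longrightarrow> expectation (\<lambda>\<omega>. Z \<omega> * D m \<omega>) = 0"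
      "Z \<in> borel_measurable (F u) \<Longrightarrow> (\<And>\<omega>. 0 \<le> Z \<omega>) \<Longrightarrow> (\<And>\<omega>. \<omega> \<in> space M \<Longrightarrow> Z \<omega> \<le> KZ) \<Longrightarrow>
       (\<integral>\<^sup>+\<omega>. ennreal (Z \<omega> * (D m \<omega>)\<^sup>2) \<partial>M) \<le>
        (\<integral>\<^sup>+\<omega>. ennreal (Z \<omega>) * (\<integral>\<^sup>+r\<in>{u..v}. ennreal ((?SP m r \<omega> - \<theta> \<omega>)\<^sup>2) \<partial>lborel) \<partial>M)" for m Z KZ
  proof -
    have *: "(\<lambda>_. 0 :: real) \<in> borel_measurable (F u)" by simp
    show "D m \<in> borel_measurable M" "integrable M (\<lambda>\<omega>. (D m \<omega>)\<^sup>2)"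
      using simple_increment(1,2)[where Z = "\<lambda>_. 0" and KZ = 0, OF F B simple uv(1,2) \<theta> *]
      by (simp_all add: D_def[abs_def])
  qed (simp_all add: D_def, (rule simple_increment[OF F B simple uv(1,2) \<theta>]; assumption)+)
  note [measurable] = D_inc(1)
  have "\<exists>m. \<delta> m < 1"
    using order_tendstoD(2)[OF \<delta>, of 1] by (auto dest: eventually_happens)
  then obtain m1 where m1: "\<delta> m1 < top" using ennreal_one_less_top less_trans by blast
  have int_diff: "integrable M (\<lambda>\<omega>. (N \<omega> - D m \<omega>)\<^sup>2)" if "\<delta> m < top" for m
    using that unfolding \<delta>_def by (intro integrableI_nonneg) auto
  have "integrable M (\<lambda>\<omega>. ((N \<omega> - D m1 \<omega>) + D m1 \<omega>)\<^sup>2)"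
    using m1 int_diff[of m1] D_inc(2)[of m1] by (intro integrable_add_sq) auto
  then show N2: "integrable M (\<lambda>\<omega>. (N \<omega>)\<^sup>2)" by simp
  show "mean_zero_given M (F u) N"
  proof (rule mean_zero_givenI[OF sub[OF uv(1)] NM N2])
    fix A assume A: "A \<in> sets (F u)"
    then have AM [measurable]: "A \<in> sets M" using sub[OF uv(1)] by (auto simp: subalgebra_def)
    let ?e = "expectation (\<lambda>\<omega>. indicator A \<omega> * N \<omega>)"
    (* The integral of D m over A vanishes, so only the approximation error remains. *)
    have "ennreal (?e\<^sup>2) \<le> \<delta> m" for m
    proof (cases "\<delta> m < top")
      case True
      note intd = int_diff[OF True]
      have i1: "integrable M (\<lambda>\<omega>. indicator A \<omega> * N \<omega>)" "integrable M (\<lambda>\<omega>. indicator A \<omega> * D m \<omega>)"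
        using integrable_mult_indicator[OF AM integrable_of_sq[OF NM N2]]
          integrable_mult_indicator[OF AM integrable_of_sq[OF D_inc(1) D_inc(2), of m]] by auto
      have "expectation (\<lambda>\<omega>. indicator A \<omega> * D m \<omega>) = 0"
        by (rule D_inc(3)[OF _ _ indicator_le_1]) (use A in auto)
      then have "?e = expectation (\<lambda>\<omega>. indicator A \<omega> * (N \<omega> - D m \<omega>))"
        using i1 by (simp add: right_diff_distrib)
      moreover have sq: "(indicator A \<omega> * (N \<omega> - D m \<omega>))\<^sup>2 = indicator A \<omega> * (N \<omega> - D m \<omega>)\<^sup>2" for \<omega>
        by (simp add: indicator_def)
      have i2: "integrable M (\<lambda>\<omega>. (indicator A \<omega> * (N \<omega> - D m \<omega>))\<^sup>2)"
        unfolding sq using integrable_mult_indicator[OF AM intd] by simp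
      moreover have "integrable M (\<lambda>\<omega>. indicator A \<omega> * (N \<omega> - D m \<omega>))"
        using i1 by (simp add: right_diff_distrib)
      ultimately have "?e\<^sup>2 \<le> expectation (\<lambda>\<omega>. (indicator A \<omega> * (N \<omega> - D m \<omega>))\<^sup>2)"
        using integral_sq_le by auto
      also have "\<dots> \<le> expectation (\<lambda>\<omega>. (N \<omega> - D m \<omega>)\<^sup>2)"
        unfolding sq by (intro integral_mono intd i2[unfolded sq]) (auto simp: indicator_def)
      finally have "ennreal (?e\<^sup>2) \<le> ennreal (expectation (\<lambda>\<omega>. (N \<omega> - D m \<omega>)\<^sup>2))" by (rule ennreal_leI)
      also have "\<dots> = \<delta> m" unfolding \<delta>_def by (intro nn_integral_eq_integral[symmetric] intd) auto
      finally show ?thesis .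
    next
      case False
      then have "\<delta> m = top" using top.not_eq_extremum by blast
      then show ?thesis by simp
    qed
    then have "ennreal (?e\<^sup>2) \<le> 0" by (intro tendsto_lowerbound[OF \<delta>]) auto
    then show "?e = 0" by (simp add: ennreal_eq_0_iff)
  qed
  define \<Gamma> where "\<Gamma> \<omega> = (\<integral>\<^sup>+r\<in>{u..v}. ennreal ((H' r \<omega> - \<theta> \<omega>)\<^sup>2) \<partial>lborel)" for \<omega>
  define E where "E m \<omega> = (\<integral>\<^sup>+t\<in>{0..T}. ennreal ((?SP m t \<omega> - H' t \<omega>)\<^sup>2) \<partial>lborel)" for m \<omega>
  have SP_joint: "(\<lambda>x. ?SP m (fst x) (snd x)) \<in> borel_measurable (lborel \<Otimes>\<^sub>M M)" for m
    unfolding simple_process_def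
  proof (intro borel_measurable_sum borel_measurable_times)
    fix k assume "k \<in> {..<n m}"
    then have [measurable]: "\<xi> m k \<in> borel_measurable M" by (intro \<xi>M) simp
    show "(\<lambda>x. \<xi> m k (snd x)) \<in> borel_measurable (lborel \<Otimes>\<^sub>M M)" by measurable
    show "(\<lambda>x. indicator {s m k<..s m (Suc k)} (fst x) :: real) \<in> borel_measurable (lborel \<Otimes>\<^sub>M M)" by measurable
  qed
  have H'_joint: "(\<lambda>x. H' (fst x) (snd x)) \<in> borel_measurable (lborel \<Otimes>\<^sub>M M)"
    using H'(1) by (simp add: case_prod_beta')
  have [measurable]: "(\<lambda>x. ?SP m (snd x) (fst x)) \<in> borel_measurable (M \<Otimes>\<^sub>M lborel)" for m
    using measurable_compose[of "\<lambda>x. (snd x, fst x)" "M \<Otimes>\<^sub>M lborel" "lborel \<Otimes>\<^sub>M M", OF _ SP_joint] by simp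
  have [measurable]: "(\<lambda>x. H' (snd x) (fst x)) \<in> borel_measurable (M \<Otimes>\<^sub>M lborel)"
    using measurable_compose[of "\<lambda>x. (snd x, fst x)" "M \<Otimes>\<^sub>M lborel" "lborel \<Otimes>\<^sub>M M", OF _ H'_joint] by simp
  have sections: "(\<lambda>r. ?SP m r \<omega>) \<in> borel_measurable borel" "(\<lambda>r. H' r \<omega>) \<in> borel_measurable borel"
    if "\<omega> \<in> space M" for m \<omega>
    using measurable_compose[OF measurable_Pair2'[OF that, of lborel] SP_joint]
      measurable_compose[OF measurable_Pair2'[OF that, of lborel] H'_joint] by simp_all
  have \<Gamma>M [measurable]: "\<Gamma> \<in> borel_measurable M"
    unfolding \<Gamma>_def[abs_def] by (rule lborel.borel_measurable_nn_integral) (simp add: case_prod_beta')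
  have EM [measurable]: "E m \<in> borel_measurable M" for m
    unfolding E_def[abs_def] by (rule lborel.borel_measurable_nn_integral) (simp add: case_prod_beta')
  have SP_le: "(\<integral>\<^sup>+r\<in>{u..v}. ennreal ((?SP m r \<omega> - \<theta> \<omega>)\<^sup>2) \<partial>lborel) \<le> 2 * E m \<omega> + 2 * \<Gamma> \<omega>" if \<omega>: "\<omega> \<in> space M" for m \<omega>
  proof -
    note [measurable] = sections[OF \<omega>]
    have "(\<integral>\<^sup>+r\<in>{u..v}. ennreal ((?SP m r \<omega> - \<theta> \<omega>)\<^sup>2) \<partial>lborel) \<le>
        (\<integral>\<^sup>+r. 2 * (ennreal ((?SP m r \<omega> - H' r \<omega>)\<^sup>2) * indicator {0..T} r)
          + 2 * (ennreal ((H' r \<omega> - \<theta> \<omega>)\<^sup>2) * indicator {u..v} r) \<partial>lborel)"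
      using ennreal_sq_sum_le[of "?SP m r \<omega> - H' r \<omega>" "H' r \<omega> - \<theta> \<omega>" for r] uv
      by (intro nn_integral_mono) (auto simp: indicator_def)
    also have "\<dots> = 2 * E m \<omega> + 2 * \<Gamma> \<omega>"
      unfolding E_def \<Gamma>_def by (simp add: nn_integral_add nn_integral_cmult)
    finally show ?thesis .
  qed
  have bounded: "(\<integral>\<^sup>+\<omega>. ennreal (Z \<omega> * (N \<omega>)\<^sup>2) \<partial>M) \<le> 4 * (\<integral>\<^sup>+\<omega>. ennreal (Z \<omega>) * \<Gamma> \<omega> \<partial>M)"
    if Z: "Z \<in> borel_measurable (F u)" "\<And>\<omega>. 0 \<le> Z \<omega>" "\<And>\<omega>. \<omega> \<in> space M \<Longrightarrow> Z \<omega> \<le> KZ" and "0 \<le> KZ" for Z KZ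
  proof -
    have [measurable]: "Z \<in> borel_measurable M" by (rule measurable_from_subalg[OF sub[OF uv(1)] Z(1)])
    let ?b = "\<integral>\<^sup>+\<omega>. ennreal (Z \<omega>) * \<Gamma> \<omega> \<partial>M"
    have "(\<integral>\<^sup>+\<omega>. ennreal (Z \<omega> * (N \<omega>)\<^sup>2) \<partial>M) \<le> (2 * ennreal KZ) * \<delta> m + (4 * ennreal KZ) * \<epsilon> m + 4 * ?b" for m
    proof -
      have "(\<integral>\<^sup>+\<omega>. ennreal (Z \<omega> * (N \<omega>)\<^sup>2) \<partial>M)
          \<le> (\<integral>\<^sup>+\<omega>. (2 * ennreal KZ) * ennreal ((N \<omega> - D m \<omega>)\<^sup>2) + 2 * ennreal (Z \<omega> * (D m \<omega>)\<^sup>2) \<partial>M)"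
      proof (rule nn_integral_mono)
        fix \<omega> assume \<omega>: "\<omega> \<in> space M"
        have "ennreal (Z \<omega> * (N \<omega>)\<^sup>2) = ennreal (Z \<omega>) * ennreal (((N \<omega> - D m \<omega>) + D m \<omega>)\<^sup>2)"
          using Z(2) by (simp add: ennreal_mult)
        also have "\<dots> \<le> ennreal (Z \<omega>) * (2 * ennreal ((N \<omega> - D m \<omega>)\<^sup>2) + 2 * ennreal ((D m \<omega>)\<^sup>2))"
          by (intro mult_left_mono ennreal_sq_sum_le) simp
        also have "\<dots> = 2 * (ennreal (Z \<omega>) * ennreal ((N \<omega> - D m \<omega>)\<^sup>2)) + 2 * ennreal (Z \<omega> * (D m \<omega>)\<^sup>2)"
          using Z(2) by (simp add: ennreal_mult distrib_left mult.left_commute)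
        also have "\<dots> \<le> 2 * (ennreal KZ * ennreal ((N \<omega> - D m \<omega>)\<^sup>2)) + 2 * ennreal (Z \<omega> * (D m \<omega>)\<^sup>2)"
          using Z(3)[OF \<omega>] by (intro add_right_mono mult_left_mono mult_right_mono ennreal_leI) auto
        finally show "ennreal (Z \<omega> * (N \<omega>)\<^sup>2)
            \<le> (2 * ennreal KZ) * ennreal ((N \<omega> - D m \<omega>)\<^sup>2) + 2 * ennreal (Z \<omega> * (D m \<omega>)\<^sup>2)"
          by (simp add: mult.assoc)
      qed
      also have "\<dots> = (2 * ennreal KZ) * \<delta> m + 2 * (\<integral>\<^sup>+\<omega>. ennreal (Z \<omega> * (D m \<omega>)\<^sup>2) \<partial>M)"
        unfolding \<delta>_def by (simp add: nn_integral_add nn_integral_cmult)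
      also have "(\<integral>\<^sup>+\<omega>. ennreal (Z \<omega> * (D m \<omega>)\<^sup>2) \<partial>M)
          \<le> (\<integral>\<^sup>+\<omega>. ennreal (Z \<omega>) * (\<integral>\<^sup>+r\<in>{u..v}. ennreal ((?SP m r \<omega> - \<theta> \<omega>)\<^sup>2) \<partial>lborel) \<partial>M)"
        by (rule D_inc(4)[OF Z])
      also have "\<dots> \<le> (\<integral>\<^sup>+\<omega>. (2 * ennreal KZ) * E m \<omega> + 2 * (ennreal (Z \<omega>) * \<Gamma> \<omega>) \<partial>M)"
      proof (rule nn_integral_mono)
        fix \<omega> assume \<omega>: "\<omega> \<in> space M"
        have "ennreal (Z \<omega>) * (\<integral>\<^sup>+r\<in>{u..v}. ennreal ((?SP m r \<omega> - \<theta> \<omega>)\<^sup>2) \<partial>lborel)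
            \<le> ennreal (Z \<omega>) * (2 * E m \<omega> + 2 * \<Gamma> \<omega>)"
          by (intro mult_left_mono SP_le[OF \<omega>]) simp
        also have "\<dots> = 2 * (ennreal (Z \<omega>) * E m \<omega>) + 2 * (ennreal (Z \<omega>) * \<Gamma> \<omega>)"
          by (simp add: distrib_left mult.left_commute)
        also have "\<dots> \<le> 2 * (ennreal KZ * E m \<omega>) + 2 * (ennreal (Z \<omega>) * \<Gamma> \<omega>)"
          using Z(3)[OF \<omega>] by (intro add_right_mono mult_left_mono mult_right_mono ennreal_leI) auto
        finally show "ennreal (Z \<omega>) * (\<integral>\<^sup>+r\<in>{u..v}. ennreal ((?SP m r \<omega> - \<theta> \<omega>)\<^sup>2) \<partial>lborel)
            \<le> (2 * ennreal KZ) * E m \<omega> + 2 * (ennreal (Z \<omega>) * \<Gamma> \<omega>)" by (simp add: mult.assoc)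
      qed
      also have "\<dots> = (2 * ennreal KZ) * \<epsilon> m + 2 * ?b"
        unfolding \<epsilon>_def E_def[symmetric] by (simp add: nn_integral_add nn_integral_cmult)
      finally show ?thesis
        by (simp add: distrib_left mult.assoc add.assoc mult_left_mono add_left_mono flip: mult.assoc[of 2 2])
    qed
    moreover have "(\<lambda>m. (2 * ennreal KZ) * \<delta> m + (4 * ennreal KZ) * \<epsilon> m + 4 * ?b) \<longlonglongrightarrow> (2 * ennreal KZ) * 0 + (4 * ennreal KZ) * 0 + 4 * ?b"
      by (intro tendsto_add tendsto_const ennreal_tendsto_cmult \<delta> \<epsilon>) (auto simp: ennreal_mult_less_top)
    ultimately show ?thesis
      by (intro tendsto_lowerbound[where F = sequentially and f = "\<lambda>m. (2 * ennreal KZ) * \<delta> m + (4 * ennreal KZ) * \<epsilon> m + 4 * ?b"]) auto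
  qed
  fix Z :: "'a \<Rightarrow> real" assume Z: "Z \<in> borel_measurable (F u)" "\<And>\<omega>. 0 \<le> Z \<omega>"
  have ZM: "Z \<in> borel_measurable M" by (rule measurable_from_subalg[OF sub[OF uv(1)] Z(1)])
  show "(\<integral>\<^sup>+\<omega>. ennreal (Z \<omega> * (N \<omega>)\<^sup>2) \<partial>M) \<le>
        4 * (\<integral>\<^sup>+\<omega>. ennreal (Z \<omega>) * (\<integral>\<^sup>+r\<in>{u..v}. ennreal ((H' r \<omega> - \<theta> \<omega>)\<^sup>2) \<partial>lborel) \<partial>M)"
    unfolding \<Gamma>_def[symmetric]
  proof (rule nn_integral_bounded_weight)
    fix m :: nat
    have "(\<integral>\<^sup>+\<omega>. ennreal (min (Z \<omega>) (real m) * (N \<omega>)\<^sup>2) \<partial>M) \<le> 4 * (\<integral>\<^sup>+\<omega>. ennreal (min (Z \<omega>) (real m)) * \<Gamma> \<omega> \<partial>M)"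
      using Z by (intro bounded[OF _ _ min.cobounded2]) auto
    also have "\<dots> \<le> 4 * (\<integral>\<^sup>+\<omega>. ennreal (Z \<omega>) * \<Gamma> \<omega> \<partial>M)"
      by (intro mult_left_mono nn_integral_mono mult_right_mono ennreal_leI) auto
    finally show "(\<integral>\<^sup>+\<omega>. ennreal (min (Z \<omega>) (real m) * (N \<omega>)\<^sup>2) \<partial>M) \<le> 4 * (\<integral>\<^sup>+\<omega>. ennreal (Z \<omega>) * \<Gamma> \<omega> \<partial>M)" .
  qed (use ZM in auto)
qed

section \<open>Paths and time integrals\<close>

text \<open>Freezing time at the multiples of \<open>1 / (m + 1)\<close> gives jointly measurable approximations.\<close>

lemma continuous_paths_jointly_measurable:
  fixes Y :: "real \<Rightarrow> 'a \<Rightarrow> 'b::{metric_space, second_countable_topology}"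
  assumes Y: "\<And>t. Y t \<in> borel_measurable M" and cont: "\<And>\<omega>. continuous_on UNIV (\<lambda>t. Y t \<omega>)"
  shows "(\<lambda>x. Y (fst x) (snd x)) \<in> borel_measurable (lborel \<Otimes>\<^sub>M M)"
proof (rule borel_measurable_LIMSEQ_metric[where
      f = "\<lambda>m x. Y (real_of_int \<lfloor>real (Suc m) * fst x\<rfloor> / real (Suc m)) (snd x)"])
  fix m :: nat
  have "(\<lambda>x. (\<lambda>i :: int. \<lambda>x. Y (real_of_int i / real (Suc m)) (snd x)) \<lfloor>real (Suc m) * fst x\<rfloor> x)
      \<in> borel_measurable (lborel \<Otimes>\<^sub>M M)"
  proof (rule measurable_compose_countable[where g = "\<lambda>x. \<lfloor>real (Suc m) * fst x\<rfloor>" and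
        f = "\<lambda>(i :: int) x. Y (real_of_int i / real (Suc m)) (snd x)"])
    show "(\<lambda>x. Y (real_of_int i / real (Suc m)) (snd x)) \<in> borel_measurable (lborel \<Otimes>\<^sub>M M)" for i
      by (rule measurable_compose[OF measurable_snd Y])
    show "(\<lambda>x. \<lfloor>real (Suc m) * fst x\<rfloor>) \<in> (lborel \<Otimes>\<^sub>M M) \<rightarrow>\<^sub>M count_space UNIV" by measurable
  qed
  then show "(\<lambda>x. Y (real_of_int \<lfloor>real (Suc m) * fst x\<rfloor> / real (Suc m)) (snd x)) \<in> borel_measurable (lborel \<Otimes>\<^sub>M M)"
    by simp
next
  fix x :: "real \<times> 'a"
  have "(\<lambda>m. real_of_int \<lfloor>real (Suc m) * fst x\<rfloor> / real (Suc m)) \<longlonglongrightarrow> fst x"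
  proof (rule tendsto_sandwich)
    show "(\<lambda>m. fst x - 1 / real (Suc m)) \<longlonglongrightarrow> fst x"
      using tendsto_diff[OF tendsto_const[of "fst x"] LIMSEQ_inverse_real_of_nat] by (simp add: inverse_eq_divide)
    show "\<forall>\<^sub>F m in sequentially. fst x - 1 / real (Suc m) \<le> real_of_int \<lfloor>real (Suc m) * fst x\<rfloor> / real (Suc m)"
    proof (rule always_eventually, rule allI)
      fix m :: nat
      have "real (Suc m) * fst x - 1 \<le> real_of_int \<lfloor>real (Suc m) * fst x\<rfloor>" by linarith
      then have "(real (Suc m) * fst x - 1) / real (Suc m) \<le> real_of_int \<lfloor>real (Suc m) * fst x\<rfloor> / real (Suc m)"
        by (rule divide_right_mono) simp
      then show "fst x - 1 / real (Suc m) \<le> real_of_int \<lfloor>real (Suc m) * fst x\<rfloor> / real (Suc m)"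
        by (simp add: diff_divide_distrib del: of_nat_Suc)
    qed
    show "\<forall>\<^sub>F m in sequentially. real_of_int \<lfloor>real (Suc m) * fst x\<rfloor> / real (Suc m) \<le> fst x"
    proof (rule always_eventually, rule allI)
      fix m :: nat
      have "real_of_int \<lfloor>real (Suc m) * fst x\<rfloor> / real (Suc m) \<le> (real (Suc m) * fst x) / real (Suc m)"
        by (rule divide_right_mono) (auto simp del: of_nat_Suc)
      then show "real_of_int \<lfloor>real (Suc m) * fst x\<rfloor> / real (Suc m) \<le> fst x" by (simp del: of_nat_Suc)
    qed
  qed simp
  moreover have "isCont (\<lambda>t. Y t (snd x)) (fst x)"
    using cont[of "snd x"] by (simp add: continuous_on_eq_continuous_at)
  ultimately show "(\<lambda>m. Y (real_of_int \<lfloor>real (Suc m) * fst x\<rfloor> / real (Suc m)) (snd x)) \<longlonglongrightarrow> Y (fst x) (snd x)"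
    by (rule isCont_tendsto_compose[rotated])
qed

lemma (in prob_space) time_integral_le:
  assumes \<Phi>: "(\<lambda>x. \<Phi> (fst x) (snd x)) \<in> borel_measurable (lborel \<Otimes>\<^sub>M M)" and uv: "u \<le> v"
    and c: "\<And>r. r \<in> {u..v} \<Longrightarrow> (\<integral>\<^sup>+\<omega>. \<Phi> r \<omega> \<partial>M) \<le> c"
  shows "(\<integral>\<^sup>+\<omega>. (\<integral>\<^sup>+r\<in>{u..v}. \<Phi> r \<omega> \<partial>lborel) \<partial>M) \<le> c * ennreal (v - u)"
proof -
  interpret pair_sigma_finite lborel M by unfold_locales
  note [measurable] = \<Phi>
  have "(\<integral>\<^sup>+\<omega>. (\<integral>\<^sup>+r. \<Phi> r \<omega> * indicator {u..v} r \<partial>lborel) \<partial>M) = (\<integral>\<^sup>+r. (\<integral>\<^sup>+\<omega>. \<Phi> r \<omega> * indicator {u..v} r \<partial>M) \<partial>lborel)"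
    by (rule Fubini') (simp add: case_prod_beta')
  also have "\<dots> \<le> (\<integral>\<^sup>+r. c * indicator {u..v} r \<partial>lborel)"
    using c by (intro nn_integral_mono) (auto simp: indicator_def)
  also have "\<dots> = c * ennreal (v - u)" using uv by (simp add: nn_integral_cmult_indicator)
  finally show ?thesis .
qed

text \<open>Cauchy-Schwarz with the constant function \<open>1\<close>.\<close>

lemma set_integral_sq_le:
  fixes g :: "real \<Rightarrow> real"
  assumes g: "set_integrable lborel {u..v} g" and uv: "u \<le> v"
  shows "ennreal ((LINT r:{u..v}|lborel. g r)\<^sup>2) \<le> ennreal (v - u) * (\<integral>\<^sup>+r\<in>{u..v}. ennreal ((g r)\<^sup>2) \<partial>lborel)"
proof -
  define f where "f r = indicator {u..v} r *\<^sub>R g r" for r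
  have int: "integrable lborel f" using g by (simp add: set_integrable_def f_def[abs_def])
  then have [measurable]: "f \<in> borel_measurable borel" by simp
  have "ennreal \<bar>LINT r|lborel. f r\<bar> \<le> (\<integral>\<^sup>+r. ennreal \<bar>f r\<bar> \<partial>lborel)"
    using integral_norm_bound_ennreal[OF int] by simp
  also have "\<dots> = (\<integral>\<^sup>+r. ennreal \<bar>f r\<bar> * indicator {u..v} r \<partial>lborel)"
    by (intro nn_integral_cong) (simp add: f_def indicator_def)
  finally have "(ennreal \<bar>LINT r|lborel. f r\<bar>)\<^sup>2 \<le> (\<integral>\<^sup>+r. ennreal \<bar>f r\<bar> * indicator {u..v} r \<partial>lborel)\<^sup>2"
    by (rule power_mono) simp
  also have "\<dots> \<le> (\<integral>\<^sup>+r. (ennreal \<bar>f r\<bar>)\<^sup>2 \<partial>lborel) * (\<integral>\<^sup>+r. (indicator {u..v} r)\<^sup>2 \<partial>lborel)"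
    by (rule Cauchy_Schwarz_nn_integral) auto
  also have "(\<integral>\<^sup>+r. (indicator {u..v} r)\<^sup>2 \<partial>lborel) = (\<integral>\<^sup>+r. indicator {u..v} r \<partial>lborel)"
    by (intro nn_integral_cong) (simp add: indicator_def)
  also have "\<dots> = ennreal (v - u)" using uv by simp
  also have "(\<integral>\<^sup>+r. (ennreal \<bar>f r\<bar>)\<^sup>2 \<partial>lborel) = (\<integral>\<^sup>+r\<in>{u..v}. ennreal ((g r)\<^sup>2) \<partial>lborel)"
    by (intro nn_integral_cong) (simp add: f_def indicator_def ennreal_power)
  finally show ?thesis
    by (simp add: ennreal_power set_lebesgue_integral_def f_def mult.commute)
qed

text \<open>Paths outside an event of full measure are replaced by a constant in the chamber. That event belongs to
  \<open>F 0\<close> by the usual conditions, so adaptedness is preserved.\<close>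

lemma chamber_modification:
  fixes X :: "real \<Rightarrow> 'a \<Rightarrow> real ^ 'd::{finite,linorder}"
  assumes F: "usual_filtration M F" and T: "0 \<le> T"
    and meas: "\<And>t. t \<in> {0..T} \<Longrightarrow> X t \<in> borel_measurable (F t)"
    and cont: "AE \<omega> in M. continuous_on {0..T} (\<lambda>t. X t \<omega>)"
    and chamber: "AE \<omega> in M. \<forall>t\<in>{0..T}. X t \<omega> \<in> ordered_chamber"
  obtains X' where "\<And>t \<omega>. X' t \<omega> \<in> ordered_chamber" "\<And>\<omega>. continuous_on UNIV (\<lambda>t. X' t \<omega>)"
    "\<And>t. t \<in> {0..T} \<Longrightarrow> X' t \<in> borel_measurable (F t)" "\<And>t. X' t \<in> borel_measurable M"
    "AE \<omega> in M. \<forall>t\<in>{0..T}. X' t \<omega> = X t \<omega>"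
proof -
  obtain x0 :: "real ^ 'd::{finite,linorder}" where x0: "x0 \<in> ordered_chamber" using chamber_nonempty by blast
  define good where "good \<omega> \<longleftrightarrow> continuous_on {0..T} (\<lambda>t. X t \<omega>) \<and> (\<forall>t\<in>{0..T}. X t \<omega> \<in> ordered_chamber)" for \<omega>
  define clamp where "clamp t = max 0 (min T t)" for t
  define X' where "X' t \<omega> = (if good \<omega> then X (clamp t) \<omega> else x0)" for t \<omega>
  have clamp: "clamp t \<in> {0..T}" "t \<in> {0..T} \<Longrightarrow> clamp t = t" for t using T by (auto simp: clamp_def)
  have good_AE: "AE \<omega> in M. good \<omega>" unfolding good_def using cont chamber by eventually_elim simp
  then obtain N where N: "{\<omega>\<in>space M. \<not> good \<omega>} \<subseteq> N" "N \<in> null_sets M"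
    unfolding eventually_ae_filter by blast
  have "\<forall>N\<in>null_sets M. \<forall>A. A \<subseteq> N \<longrightarrow> A \<in> sets (F 0)"
    using F[unfolded usual_filtration_def, THEN conjunct2, THEN conjunct2, THEN conjunct1] .
  then have bad0: "{\<omega>\<in>space M. \<not> good \<omega>} \<in> sets (F 0)" using N by blast
  have sp: "space (F t) = space M" if "0 \<le> t" for t
    using usual_filtrationD(1)[OF F that] by (simp add: subalgebra_def)
  have goodF: "{\<omega>\<in>space (F t). good \<omega>} \<in> sets (F t)" if "0 \<le> t" for t
  proof -
    have "{\<omega>\<in>space M. \<not> good \<omega>} \<in> sets (F t)"
      using bad0 usual_filtrationD(2)[OF F _ that] by (auto simp: subalgebra_def)
    then have "space (F t) - {\<omega>\<in>space M. \<not> good \<omega>} \<in> sets (F t)" by auto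
    also have "space (F t) - {\<omega>\<in>space M. \<not> good \<omega>} = {\<omega>\<in>space (F t). good \<omega>}" using sp[OF that] by auto
    finally show ?thesis .
  qed
  have adapted: "X' t \<in> borel_measurable (F t)" if t: "t \<in> {0..T}" for t
    unfolding X'_def[abs_def] clamp(2)[OF t]
    using meas[OF t] goodF[of t] t by (intro measurable_If) auto
  show thesis
  proof (rule that)
    show "X' t \<omega> \<in> ordered_chamber" for t \<omega> using clamp(1)[of t] x0 by (simp add: X'_def good_def)
    show "continuous_on UNIV (\<lambda>t. X' t \<omega>)" for \<omega>
    proof (cases "good \<omega>")
      case True
      have "continuous_on UNIV (\<lambda>t. X (clamp t) \<omega>)"
      proof (rule continuous_on_compose2[where g = "\<lambda>t. X t \<omega>" and f = clamp])
        show "continuous_on {0..T} (\<lambda>t. X t \<omega>)" using True by (simp add: good_def)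
        show "continuous_on UNIV clamp" unfolding clamp_def by (intro continuous_intros)
      qed (use clamp in auto)
      with True show ?thesis by (simp add: X'_def)
    qed (simp add: X'_def)
    show "X' t \<in> borel_measurable (F t)" if "t \<in> {0..T}" for t by (rule adapted[OF that])
    show "X' t \<in> borel_measurable M" for t
    proof -
      have "X' t = X' (clamp t)" using clamp by (simp add: X'_def fun_eq_iff)
      moreover have "X' (clamp t) \<in> borel_measurable M"
        using clamp(1)[of t] by (intro measurable_from_subalg[OF usual_filtrationD(1)[OF F] adapted]) auto
      ultimately show ?thesis by simp
    qed
    show "AE \<omega> in M. \<forall>t\<in>{0..T}. X' t \<omega> = X t \<omega>"
      using good_AE by eventually_elim (simp add: X'_def clamp(2))
  qed
qed

section \<open>The drift error of one step\<close>

text \<open>The situation after normalisation: \<open>X\<close> is a version of the solution all of whose paths are continuous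
  and stay in the chamber, \<open>H\<close> is the family of integrands for which the stochastic integrals \<open>I\<close> are
  given, and the bounds \<open>L\<close>, \<open>K\<close>, \<open>G\<close> and \<open>C\<close> are uniform in all indices.\<close>

locale particle_system = prob_space M
  for M :: "'a measure" +
  fixes F :: "real \<Rightarrow> 'a measure" and W X :: "real \<Rightarrow> 'a \<Rightarrow> real ^ 'd::{finite,linorder}" and T :: real
    and \<gamma> :: "'d \<Rightarrow> 'd \<Rightarrow> real"
    and b :: "'d \<Rightarrow> real ^ 'd::{finite,linorder} \<Rightarrow> real"
    and \<sigma> :: "'d \<Rightarrow> 'd \<Rightarrow> real ^ 'd::{finite,linorder} \<Rightarrow> real"
    and H I :: "'d \<Rightarrow> 'd \<Rightarrow> real \<Rightarrow> 'a \<Rightarrow> real"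
    and L K G C :: real
  assumes F: "usual_filtration M F" and W: "brownian_motion M F W"
    and \<gamma>: "\<And>i j. i \<noteq> j \<Longrightarrow> \<gamma> i j = \<gamma> j i \<and> \<gamma> i j \<ge> 0"
    and \<gamma>_adj: "\<And>i j. (i, j) \<in> adjacent \<Longrightarrow> \<gamma> i j > 0"
    and \<gamma>_le: "\<And>i j. \<bar>\<gamma> i j\<bar> \<le> G"
    and L: "0 \<le> L"
    and b_lip: "\<And>i x y. \<bar>b i x - b i y\<bar> \<le> L * norm (x - y)"
    and \<sigma>_lip: "\<And>i j x y. \<bar>\<sigma> i j x - \<sigma> i j y\<bar> \<le> L * norm (x - y)"
    and \<sigma>_le: "\<And>i j x. \<bar>\<sigma> i j x\<bar> \<le> K"
    and X_chamber: "\<And>t \<omega>. X t \<omega> \<in> ordered_chamber"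
    and X_cont: "\<And>\<omega>. continuous_on UNIV (\<lambda>t. X t \<omega>)"
    and X_adapted: "\<And>t. t \<in> {0..T} \<Longrightarrow> X t \<in> borel_measurable (F t)"
    and X_meas: "\<And>t. X t \<in> borel_measurable M"
    and ito: "\<And>i j. ito_integral M F T (\<lambda>t \<omega>. W t \<omega> $ j) (H i j) (I i j)"
    and H: "\<And>i j. AE \<omega> in M. \<forall>r\<in>{0..T}. H i j r \<omega> = \<sigma> i j (X r \<omega>)"
    and sde: "\<And>i. AE \<omega> in M. \<forall>t\<in>{0..T}. X t \<omega> $ i = X 0 \<omega> $ i
        + (LINT r:{0..t}|lborel. repulsion \<gamma> (X r \<omega>) i + b i (X r \<omega>)) + (\<Sum>j\<in>UNIV. I i j t \<omega>)"
    and C: "0 \<le> C"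
    and gaps: "\<And>t. t \<in> {0..T} \<Longrightarrow> (\<integral>\<^sup>+\<omega>. ennreal (gap_energy (X t \<omega>)) \<partial>M) \<le> ennreal C"
    and increments: "\<And>s t. s \<in> {0..T} \<Longrightarrow> t \<in> {0..T} \<Longrightarrow>
        (\<integral>\<^sup>+\<omega>. ennreal (norm (X t \<omega> - X s \<omega>) ^ 6) \<partial>M) \<le> ennreal (C * \<bar>t - s\<bar> ^ 3)"
begin

lemma b_continuous: "continuous_on S (b i)"
proof -
  have "L-lipschitz_on UNIV (b i)" using b_lip L by (intro lipschitz_onI) (auto simp: dist_norm)
  then show ?thesis using lipschitz_on_continuous_on continuous_on_subset by blast
qed

lemma sigma_continuous: "continuous_on S (\<sigma> i j)"
proof -
  have "L-lipschitz_on UNIV (\<sigma> i j)" using \<sigma>_lip L by (intro lipschitz_onI) (auto simp: dist_norm)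
  then show ?thesis using lipschitz_on_continuous_on continuous_on_subset by blast
qed

lemma b_measurable [measurable]: "b i \<in> borel_measurable borel"
  by (rule borel_measurable_continuous_onI[OF b_continuous])

lemma sigma_measurable [measurable]: "\<sigma> i j \<in> borel_measurable borel"
  by (rule borel_measurable_continuous_onI[OF sigma_continuous])

lemma repulsion_measurable [measurable]: "(\<lambda>x :: real ^ 'd::{finite,linorder}. repulsion \<gamma> x i) \<in> borel_measurable borel"
  unfolding repulsion_def by measurable

lemma gap_energy_measurable [measurable]: "(gap_energy :: real ^ 'd::{finite,linorder} \<Rightarrow> real) \<in> borel_measurable borel"
  unfolding gap_energy_def case_prod_beta' by measurable

lemma X_joint [measurable]: "(\<lambda>x. X (fst x) (snd x)) \<in> borel_measurable (lborel \<Otimes>\<^sub>M M)"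
  by (rule continuous_paths_jointly_measurable[OF X_meas X_cont])

lemma X_joint' [measurable]: "(\<lambda>x. X (snd x) (fst x)) \<in> borel_measurable (M \<Otimes>\<^sub>M lborel)"
  using measurable_compose[of "\<lambda>x. (snd x, fst x)" "M \<Otimes>\<^sub>M lborel" "lborel \<Otimes>\<^sub>M M", OF _ X_joint] by simp

declare X_meas [measurable]

lemma drift_path_continuous:
  "continuous_on S (\<lambda>r. repulsion \<gamma> (X r \<omega>) i)" "continuous_on S (\<lambda>r. b i (X r \<omega>))"
proof -
  have X: "continuous_on S (\<lambda>r. X r \<omega>)" by (rule continuous_on_subset[OF X_cont]) simp
  show "continuous_on S (\<lambda>r. repulsion \<gamma> (X r \<omega>) i)"
    unfolding repulsion_def
    by (intro continuous_intros X ballI) (use chamber_distinct[OF X_chamber] in auto)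
  show "continuous_on S (\<lambda>r. b i (X r \<omega>))"
    by (rule continuous_on_compose2[OF b_continuous[of UNIV] X]) simp
qed

lemma gap_moment:
  assumes "t \<in> {0..T}"
  shows "integrable M (\<lambda>\<omega>. gap_energy (X t \<omega>))" "expectation (\<lambda>\<omega>. gap_energy (X t \<omega>)) \<le> C"
  by (rule integral_real_le_of_nn[OF _ gap_energy_nonneg gaps[OF assms] C]; measurable)+

lemma increment_moment:
  assumes "s \<in> {0..T}" "t \<in> {0..T}" "\<bar>t - s\<bar> \<le> h"
  shows "integrable M (\<lambda>\<omega>. norm (X t \<omega> - X s \<omega>) ^ 6)" "expectation (\<lambda>\<omega>. norm (X t \<omega> - X s \<omega>) ^ 6) \<le> C * h ^ 3"
proof -
  have "C * \<bar>t - s\<bar> ^ 3 \<le> C * h ^ 3" using assms(3) C by (intro mult_left_mono power_mono) auto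
  then have nn: "(\<integral>\<^sup>+\<omega>. ennreal (norm (X t \<omega> - X s \<omega>) ^ 6) \<partial>M) \<le> ennreal (C * h ^ 3)"
    using increments[OF assms(1,2)] ennreal_leI order_trans by blast
  have "0 \<le> C * h ^ 3" using C assms(3) by (intro mult_nonneg_nonneg zero_le_power) auto
  then show "integrable M (\<lambda>\<omega>. norm (X t \<omega> - X s \<omega>) ^ 6)" "expectation (\<lambda>\<omega>. norm (X t \<omega> - X s \<omega>) ^ 6) \<le> C * h ^ 3"
    by (intro integral_real_le_of_nn[OF _ _ nn]; simp)+
qed

text \<open>The drift of the solution minus the drift frozen by the scheme, which evaluates the repulsion at the right
  and \<open>b\<close> at the left end point of a time step.\<close>

definition defect :: "real \<Rightarrow> real \<Rightarrow> 'd \<Rightarrow> real \<Rightarrow> 'a \<Rightarrow> real" where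
  "defect u v i r \<omega> = (repulsion \<gamma> (X r \<omega>) i - repulsion \<gamma> (X v \<omega>) i) + (b i (X r \<omega>) - b i (X u \<omega>))"

definition drift_error :: "real \<Rightarrow> real \<Rightarrow> 'd \<Rightarrow> 'a \<Rightarrow> real" where
  "drift_error u v i \<omega> = (LINT r:{u..v}|lborel. defect u v i r \<omega>)"

text \<open>The martingale increment of the solution minus the one that the scheme uses when it is at \<open>y\<close>. The error in
  the state and the discretisation error of \<open>\<sigma>\<close> are deliberately not separated: both are orthogonal
  to the past.\<close>

definition noise :: "real \<Rightarrow> real \<Rightarrow> ('a \<Rightarrow> real ^ 'd::{finite,linorder}) \<Rightarrow> 'd \<Rightarrow> 'd \<Rightarrow> 'a \<Rightarrow> real" where
  "noise u v y i j \<omega> = I i j v \<omega> - I i j u \<omega> - \<sigma> i j (y \<omega>) * (W v \<omega> $ j - W u \<omega> $ j)"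

lemma defect_integrable: "set_integrable lborel {u..v} (\<lambda>r. defect u v i r \<omega>)"
  unfolding defect_def by (intro borel_integrable_atLeastAtMost' continuous_intros drift_path_continuous)

text \<open>From \<open>u\<close> to \<open>v\<close> the solution makes an implicit step like the scheme, with its own stochastic integrals as
  noise and with \<open>drift_error\<close> as perturbation.\<close>

lemma solution_increment:
  assumes uv: "0 \<le> u" "u \<le> v" "v \<le> T"
  shows "AE \<omega> in M. \<forall>i. X v \<omega> $ i = X u \<omega> $ i + (v - u) * (repulsion \<gamma> (X v \<omega>) i + b i (X u \<omega>))
      + drift_error u v i \<omega> + (\<Sum>j\<in>UNIV. I i j v \<omega> - I i j u \<omega>)"
proof -
  have "AE \<omega> in M. \<forall>i. \<forall>t\<in>{0..T}. X t \<omega> $ i = X 0 \<omega> $ i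
        + (LINT r:{0..t}|lborel. repulsion \<gamma> (X r \<omega>) i + b i (X r \<omega>)) + (\<Sum>j\<in>UNIV. I i j t \<omega>)"
    using sde by (simp add: AE_all_countable)
  then show ?thesis
  proof eventually_elim
    case (elim \<omega>)
    show ?case
    proof
      fix i
      let ?f = "\<lambda>r. repulsion \<gamma> (X r \<omega>) i + b i (X r \<omega>)"
      have cont: "continuous_on S ?f" for S by (intro continuous_intros drift_path_continuous)
      have LI: "(LINT r:{s..t}|lborel. ?f r) = integral {s..t} ?f" for s t
        by (rule set_borel_integral_eq_integral(2)[OF borel_integrable_atLeastAtMost'[OF cont]])
      have combine: "integral {0..u} ?f + integral {u..v} ?f = integral {0..v} ?f"
        using uv by (intro Henstock_Kurzweil_Integration.integral_combine integrable_continuous_interval cont) auto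
      have error: "drift_error u v i \<omega> = integral {u..v} ?f - (v - u) * (repulsion \<gamma> (X v \<omega>) i + b i (X u \<omega>))"
      proof -
        have "drift_error u v i \<omega> = integral {u..v} (\<lambda>r. defect u v i r \<omega>)"
          unfolding drift_error_def by (rule set_borel_integral_eq_integral(2)[OF defect_integrable])
        also have "(\<lambda>r. defect u v i r \<omega>) = (\<lambda>r. ?f r - (repulsion \<gamma> (X v \<omega>) i + b i (X u \<omega>)))"
          by (simp add: defect_def fun_eq_iff)
        also have "integral {u..v} \<dots> = integral {u..v} ?f - integral {u..v} (\<lambda>r. repulsion \<gamma> (X v \<omega>) i + b i (X u \<omega>))"
          by (intro Henstock_Kurzweil_Integration.integral_diff integrable_continuous_interval cont continuous_intros)
        finally show ?thesis using uv by simp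
      qed
      have "X t \<omega> $ i = X 0 \<omega> $ i + integral {0..t} ?f + (\<Sum>j\<in>UNIV. I i j t \<omega>)" if "t \<in> {0..T}" for t
        unfolding LI[symmetric] by (rule elim[rule_format, OF that])
      from this[of v] this[of u] have eqs: "X v \<omega> $ i = X 0 \<omega> $ i + integral {0..v} ?f + (\<Sum>j\<in>UNIV. I i j v \<omega>)"
        "X u \<omega> $ i = X 0 \<omega> $ i + integral {0..u} ?f + (\<Sum>j\<in>UNIV. I i j u \<omega>)"
        using uv by simp_all
      show "X v \<omega> $ i = X u \<omega> $ i + (v - u) * (repulsion \<gamma> (X v \<omega>) i + b i (X u \<omega>))
          + drift_error u v i \<omega> + (\<Sum>j\<in>UNIV. I i j v \<omega> - I i j u \<omega>)"
        using combine error eqs unfolding sum_subtractf by linarith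
    qed
  qed
qed

definition defect_const :: real where
  "defect_const = 128 * (G * CARD('d))\<^sup>2 + 2 * L\<^sup>2"

lemma defect_sq:
  assumes h: "0 < h"
  shows "(defect u v i r \<omega>)\<^sup>2 \<le> defect_const * h * (1 + norm (X r \<omega> - X v \<omega>) ^ 6 / h ^ 3
    + norm (X r \<omega> - X u \<omega>) ^ 6 / h ^ 3 + gap_energy (X r \<omega>) + gap_energy (X v \<omega>))"
proof -
  let ?a = "repulsion \<gamma> (X r \<omega>) i - repulsion \<gamma> (X v \<omega>) i" and ?b = "b i (X r \<omega>) - b i (X u \<omega>)"
  let ?A = "norm (X r \<omega> - X v \<omega>) ^ 6 / h ^ 3 + gap_energy (X r \<omega>) + gap_energy (X v \<omega>)"
  let ?B = "1 + norm (X r \<omega> - X u \<omega>) ^ 6 / h ^ 3"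
  have A0: "0 \<le> ?A" using h by (simp add: gap_energy_nonneg)
  have B0: "0 \<le> ?B" using h by simp
  have "?a\<^sup>2 \<le> 64 * (G * CARD('d))\<^sup>2 * h * ?A"
    by (rule repulsion_diff_sq[OF X_chamber X_chamber \<gamma>_le h])
  moreover have "?b\<^sup>2 \<le> L\<^sup>2 * (h * ?B)"
  proof -
    have "?b\<^sup>2 \<le> (L * norm (X r \<omega> - X u \<omega>))\<^sup>2"
      using b_lip[of i "X r \<omega>" "X u \<omega>"] by (metis abs_ge_zero power2_abs power_mono)
    also have "\<dots> \<le> L\<^sup>2 * (h * ?B)"
      unfolding power_mult_distrib by (intro mult_left_mono square_le_sixth_power h) simp
    finally show ?thesis .
  qed
  moreover have "(defect u v i r \<omega>)\<^sup>2 \<le> 2 * ?a\<^sup>2 + 2 * ?b\<^sup>2"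
    unfolding defect_def by (rule sq_sum_le)
  ultimately have "(defect u v i r \<omega>)\<^sup>2 \<le> 128 * (G * CARD('d))\<^sup>2 * (h * ?A) + 2 * L\<^sup>2 * (h * ?B)" by simp
  also have "\<dots> \<le> 128 * (G * CARD('d))\<^sup>2 * (h * (?A + ?B)) + 2 * L\<^sup>2 * (h * (?A + ?B))"
  proof -
    have "?A \<le> ?A + ?B" "?B \<le> ?A + ?B" using A0 B0 by linarith+
    then have le: "h * ?A \<le> h * (?A + ?B)" "h * ?B \<le> h * (?A + ?B)"
      using mult_left_mono[OF _ less_imp_le[OF h]] by blast+
    show ?thesis by (rule add_mono[OF mult_left_mono[OF le(1)] mult_left_mono[OF le(2)]]) simp_all
  qed
  also have "\<dots> = defect_const * h * (?A + ?B)" by (simp add: defect_const_def distrib_right mult.assoc)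
  finally show ?thesis by (simp add: add_ac)
qed

lemma drift_error_measurable [measurable]: "drift_error u v i \<in> borel_measurable M"
  unfolding drift_error_def[abs_def] set_lebesgue_integral_def defect_def
  by (rule lborel.borel_measurable_lebesgue_integral) (simp add: case_prod_beta')

text \<open>Cauchy-Schwarz in time contributes a factor \<open>v - u\<close>, the integration over time another one, and the
  squared defect is of order \<open>v - u\<close> in mean by \<open>defect_sq\<close> and the moment bounds.\<close>

lemma drift_error_moment:
  assumes uv: "0 \<le> u" "u < v" "v \<le> T"
  shows "integrable M (\<lambda>\<omega>. (drift_error u v i \<omega>)\<^sup>2)"
    "expectation (\<lambda>\<omega>. (drift_error u v i \<omega>)\<^sup>2) \<le> defect_const * (1 + 4 * C) * (v - u) ^ 3"
proof -
  define h where "h = v - u"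
  have h: "0 < h" using uv by (simp add: h_def)
  (* The bound of the squared defect, with expectation at most a constant times h at every time r. *)
  define \<Phi> where "\<Phi> r \<omega> = defect_const * h * (1 + norm (X r \<omega> - X v \<omega>) ^ 6 / h ^ 3
    + norm (X r \<omega> - X u \<omega>) ^ 6 / h ^ 3 + gap_energy (X r \<omega>) + gap_energy (X v \<omega>))" for r \<omega>
  have dc: "0 \<le> defect_const" by (simp add: defect_const_def)
  have \<Phi>0: "0 \<le> \<Phi> r \<omega>" for r \<omega> unfolding \<Phi>_def using h dc by (simp add: gap_energy_nonneg)
  have slice: "(\<integral>\<^sup>+\<omega>. ennreal (\<Phi> r \<omega>) \<partial>M) \<le> ennreal (defect_const * h * (1 + 4 * C))" if r: "r \<in> {u..v}" for r
  proof -
    have rT: "r \<in> {0..T}" "u \<in> {0..T}" "v \<in> {0..T}" "\<bar>r - v\<bar> \<le> h" "\<bar>r - u\<bar> \<le> h"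
      using r uv by (auto simp: h_def)
    note m = increment_moment[OF rT(3,1,4)] increment_moment[OF rT(2,1,5)] gap_moment[OF rT(1)] gap_moment[OF rT(3)]
    have int: "integrable M (\<Phi> r)" unfolding \<Phi>_def[abs_def] using m by simp
    have "expectation (\<Phi> r) = defect_const * h * (1 + expectation (\<lambda>\<omega>. norm (X r \<omega> - X v \<omega>) ^ 6) / h ^ 3
      + expectation (\<lambda>\<omega>. norm (X r \<omega> - X u \<omega>) ^ 6) / h ^ 3 + expectation (\<lambda>\<omega>. gap_energy (X r \<omega>))
      + expectation (\<lambda>\<omega>. gap_energy (X v \<omega>)))"
      unfolding \<Phi>_def[abs_def] using m by (simp add: prob_space)
    also have "\<dots> \<le> defect_const * h * (1 + C + C + C + C)"
      using m dc h by (intro mult_left_mono add_mono) (auto simp: divide_le_eq)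
    also have "1 + C + C + C + C = 1 + 4 * C" by simp
    finally have "expectation (\<Phi> r) \<le> defect_const * h * (1 + 4 * C)" .
    then show ?thesis using nn_integral_eq_integral[OF int] \<Phi>0 by (simp add: ennreal_leI)
  qed
  have "(\<integral>\<^sup>+\<omega>. ennreal ((drift_error u v i \<omega>)\<^sup>2) \<partial>M) \<le> (\<integral>\<^sup>+\<omega>. ennreal h * (\<integral>\<^sup>+r\<in>{u..v}. ennreal (\<Phi> r \<omega>) \<partial>lborel) \<partial>M)"
  proof (rule nn_integral_mono)
    fix \<omega>
    have "ennreal ((drift_error u v i \<omega>)\<^sup>2) \<le> ennreal h * (\<integral>\<^sup>+r\<in>{u..v}. ennreal ((defect u v i r \<omega>)\<^sup>2) \<partial>lborel)"
      unfolding drift_error_def h_def using uv by (intro set_integral_sq_le defect_integrable) simp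
    also have "\<dots> \<le> ennreal h * (\<integral>\<^sup>+r\<in>{u..v}. ennreal (\<Phi> r \<omega>) \<partial>lborel)"
      unfolding \<Phi>_def by (intro mult_left_mono nn_integral_mono mult_right_mono ennreal_leI defect_sq h) auto
    finally show "ennreal ((drift_error u v i \<omega>)\<^sup>2) \<le> ennreal h * (\<integral>\<^sup>+r\<in>{u..v}. ennreal (\<Phi> r \<omega>) \<partial>lborel)" .
  qed
  also have "\<dots> = ennreal h * (\<integral>\<^sup>+\<omega>. (\<integral>\<^sup>+r\<in>{u..v}. ennreal (\<Phi> r \<omega>) \<partial>lborel) \<partial>M)"
    unfolding \<Phi>_def
    by (intro nn_integral_cmult lborel.borel_measurable_nn_integral) (simp add: case_prod_beta')
  also have "\<dots> \<le> ennreal h * (ennreal (defect_const * h * (1 + 4 * C)) * ennreal (v - u))"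
    using uv slice by (intro mult_left_mono time_integral_le) (auto simp: \<Phi>_def)
  also have "\<dots> = ennreal (defect_const * (1 + 4 * C) * (v - u) ^ 3)"
    using h dc C by (simp add: h_def[symmetric] ennreal_mult[symmetric] power3_eq_cube mult_ac)
  finally have nn: "(\<integral>\<^sup>+\<omega>. ennreal ((drift_error u v i \<omega>)\<^sup>2) \<partial>M) \<le> ennreal (defect_const * (1 + 4 * C) * (v - u) ^ 3)" .
  have "0 \<le> defect_const * (1 + 4 * C) * (v - u) ^ 3" using dc C uv by simp
  then show "integrable M (\<lambda>\<omega>. (drift_error u v i \<omega>)\<^sup>2)"
    "expectation (\<lambda>\<omega>. (drift_error u v i \<omega>)\<^sup>2) \<le> defect_const * (1 + 4 * C) * (v - u) ^ 3"
    by (intro integral_real_le_of_nn[OF _ _ nn]; simp)+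
qed

section \<open>The noise and the error of one step\<close>

lemma noise_properties:
  assumes uv: "0 \<le> u" "u < v" "v \<le> T" and y: "y \<in> borel_measurable (F u)"
  shows "noise u v y i j \<in> borel_measurable (F v)" "integrable M (\<lambda>\<omega>. (noise u v y i j \<omega>)\<^sup>2)"
    "mean_zero_given M (F u) (noise u v y i j)"
    "\<And>Z. Z \<in> borel_measurable (F u) \<Longrightarrow> (\<And>\<omega>. 0 \<le> Z \<omega>) \<Longrightarrow>
      (\<integral>\<^sup>+\<omega>. ennreal (Z \<omega> * (noise u v y i j \<omega>)\<^sup>2) \<partial>M) \<le>
        4 * (\<integral>\<^sup>+\<omega>. ennreal (Z \<omega>) * (\<integral>\<^sup>+r\<in>{u..v}. ennreal ((\<sigma> i j (X r \<omega>) - \<sigma> i j (y \<omega>))\<^sup>2) \<partial>lborel) \<partial>M)"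
proof -
  have joint: "(\<lambda>(r, \<omega>). \<sigma> i j (X r \<omega>)) \<in> borel_measurable (lborel \<Otimes>\<^sub>M M)"
    by (simp add: case_prod_beta')
  have \<theta>: "(\<lambda>\<omega>. \<sigma> i j (y \<omega>)) \<in> borel_measurable (F u)"
    by (rule measurable_compose[OF y sigma_measurable])
  note inc = ito_increment[OF F brownian_independent_increments[OF F W] ito[of j i] joint H[of i j] uv \<theta> \<sigma>_le,
      folded noise_def]
  show "noise u v y i j \<in> borel_measurable (F v)" "integrable M (\<lambda>\<omega>. (noise u v y i j \<omega>)\<^sup>2)"
    "mean_zero_given M (F u) (noise u v y i j)"
    by (fact inc)+
  fix Z :: "'a \<Rightarrow> real" assume "Z \<in> borel_measurable (F u)" "\<And>\<omega>. 0 \<le> Z \<omega>"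
  then show "(\<integral>\<^sup>+\<omega>. ennreal (Z \<omega> * (noise u v y i j \<omega>)\<^sup>2) \<partial>M) \<le>
        4 * (\<integral>\<^sup>+\<omega>. ennreal (Z \<omega>) * (\<integral>\<^sup>+r\<in>{u..v}. ennreal ((\<sigma> i j (X r \<omega>) - \<sigma> i j (y \<omega>))\<^sup>2) \<partial>lborel) \<partial>M)"
    by (rule inc(4))
qed

text \<open>This estimate uses that \<open>\<sigma>\<close> is bounded. It is linear in the weight, so with the squared error as weight
  it controls the variance of the martingale part by the second moment of the error instead of the
  fourth.\<close>

lemma noise_weighted_moment:
  assumes uv: "0 \<le> u" "u < v" "v \<le> T" and y: "y \<in> borel_measurable (F u)"
    and Z: "Z \<in> borel_measurable (F u)" "\<And>\<omega>. 0 \<le> Z \<omega>" "integrable M Z"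
  shows "integrable M (\<lambda>\<omega>. Z \<omega> * (noise u v y i j \<omega>)\<^sup>2)"
    "expectation (\<lambda>\<omega>. Z \<omega> * (noise u v y i j \<omega>)\<^sup>2) \<le> 16 * K\<^sup>2 * (v - u) * expectation Z"
proof -
  have sub: "subalgebra M (F u)" "subalgebra M (F v)" using uv by (auto intro!: usual_filtrationD(1)[OF F])
  have [measurable]: "Z \<in> borel_measurable M" "noise u v y i j \<in> borel_measurable M"
    by (rule measurable_from_subalg[OF sub(1) Z(1)],
        rule measurable_from_subalg[OF sub(2) noise_properties(1)[OF uv y]])
  have "(\<integral>\<^sup>+\<omega>. ennreal (Z \<omega> * (noise u v y i j \<omega>)\<^sup>2) \<partial>M) \<le>
        4 * (\<integral>\<^sup>+\<omega>. ennreal (Z \<omega>) * (\<integral>\<^sup>+r\<in>{u..v}. ennreal ((\<sigma> i j (X r \<omega>) - \<sigma> i j (y \<omega>))\<^sup>2) \<partial>lborel) \<partial>M)"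
    by (rule noise_properties(4)[OF uv y Z(1,2)])
  also have "\<dots> \<le> 4 * (\<integral>\<^sup>+\<omega>. ennreal (Z \<omega>) * (\<integral>\<^sup>+r. ennreal (4 * K\<^sup>2) * indicator {u..v} r \<partial>lborel) \<partial>M)"
  proof (intro mult_left_mono nn_integral_mono mult_right_mono ennreal_leI)
    fix \<omega> r
    have "\<bar>\<sigma> i j (X r \<omega>) - \<sigma> i j (y \<omega>)\<bar> \<le> 2 * K"
      using \<sigma>_le[of i j "X r \<omega>"] \<sigma>_le[of i j "y \<omega>"] by linarith
    then have "\<bar>\<sigma> i j (X r \<omega>) - \<sigma> i j (y \<omega>)\<bar>\<^sup>2 \<le> (2 * K)\<^sup>2" by (intro power_mono) auto
    then show "(\<sigma> i j (X r \<omega>) - \<sigma> i j (y \<omega>))\<^sup>2 \<le> 4 * K\<^sup>2" by (simp add: power_mult_distrib)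
  qed auto
  also have "\<dots> = 4 * (\<integral>\<^sup>+\<omega>. ennreal (Z \<omega>) * (ennreal (4 * K\<^sup>2) * ennreal (v - u)) \<partial>M)"
    using uv by (simp add: nn_integral_cmult_indicator)
  also have "\<dots> = 4 * (ennreal (expectation Z) * (ennreal (4 * K\<^sup>2) * ennreal (v - u)))"
    using nn_integral_eq_integral[OF Z(3)] Z(2) by (simp add: nn_integral_multc)
  also have "\<dots> = ennreal (16 * K\<^sup>2 * (v - u) * expectation Z)"
  proof -
    have "ennreal 4 * (ennreal (expectation Z) * (ennreal (4 * K\<^sup>2) * ennreal (v - u)))
        = ennreal (4 * (expectation Z * (4 * K\<^sup>2 * (v - u))))"
      using uv Z(2) by (simp only: ennreal_mult Bochner_Integration.integral_nonneg mult_nonneg_nonneg zero_le_power2 zero_le_numeral diff_ge_0_iff_ge less_imp_le)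
    then show ?thesis by (simp add: mult_ac)
  qed
  finally have nn: "(\<integral>\<^sup>+\<omega>. ennreal (Z \<omega> * (noise u v y i j \<omega>)\<^sup>2) \<partial>M) \<le> ennreal (16 * K\<^sup>2 * (v - u) * expectation Z)" .
  have "0 \<le> 16 * K\<^sup>2 * (v - u) * expectation Z" using uv Z(2) by simp
  then show "integrable M (\<lambda>\<omega>. Z \<omega> * (noise u v y i j \<omega>)\<^sup>2)"
    "expectation (\<lambda>\<omega>. Z \<omega> * (noise u v y i j \<omega>)\<^sup>2) \<le> 16 * K\<^sup>2 * (v - u) * expectation Z"
    using Z(2) by (intro integral_real_le_of_nn[OF _ _ nn]; simp)+
qed

text \<open>This estimate uses that \<open>\<sigma>\<close> is Lipschitz: the noise is small when the error is small and the
  solution moves little during the step.\<close>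

lemma noise_moment:
  assumes uv: "0 \<le> u" "u < v" "v \<le> T" and y: "y \<in> borel_measurable (F u)"
    and int: "integrable M (\<lambda>\<omega>. (norm (X u \<omega> - y \<omega>))\<^sup>2)"
  shows "expectation (\<lambda>\<omega>. (noise u v y i j \<omega>)\<^sup>2) \<le>
    8 * L\<^sup>2 * (v - u) * ((v - u) * (1 + C) + expectation (\<lambda>\<omega>. (norm (X u \<omega> - y \<omega>))\<^sup>2))"
proof -
  define h where "h = v - u"
  have h: "0 < h" using uv by (simp add: h_def)
  let ?EA = "expectation (\<lambda>\<omega>. (norm (X u \<omega> - y \<omega>))\<^sup>2)"
  define \<Phi> where "\<Phi> r \<omega> = 2 * L\<^sup>2 * (h * (1 + norm (X r \<omega> - X u \<omega>) ^ 6 / h ^ 3) + (norm (X u \<omega> - y \<omega>))\<^sup>2)" for r \<omega>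
  have sub: "subalgebra M (F u)" "subalgebra M (F v)" using uv by (auto intro!: usual_filtrationD(1)[OF F])
  have yM [measurable]: "y \<in> borel_measurable M" by (rule measurable_from_subalg[OF sub(1) y])
  have [measurable]: "noise u v y i j \<in> borel_measurable M"
    by (rule measurable_from_subalg[OF sub(2) noise_properties(1)[OF uv y]])
  have \<Phi>0: "0 \<le> \<Phi> r \<omega>" for r \<omega> unfolding \<Phi>_def using h by simp
  have EA0: "0 \<le> ?EA" by simp
  have \<sigma>\<Phi>: "(\<sigma> i j (X r \<omega>) - \<sigma> i j (y \<omega>))\<^sup>2 \<le> \<Phi> r \<omega>" for r \<omega>
  proof -
    have lip: "(\<sigma> i j p - \<sigma> i j q)\<^sup>2 \<le> L\<^sup>2 * (norm (p - q))\<^sup>2" for p q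
      using power_mono[OF \<sigma>_lip[of i j p q], of 2] by (simp add: power_mult_distrib)
    have "(\<sigma> i j (X r \<omega>) - \<sigma> i j (y \<omega>))\<^sup>2 = ((\<sigma> i j (X r \<omega>) - \<sigma> i j (X u \<omega>)) + (\<sigma> i j (X u \<omega>) - \<sigma> i j (y \<omega>)))\<^sup>2" by simp
    also have "\<dots> \<le> 2 * (\<sigma> i j (X r \<omega>) - \<sigma> i j (X u \<omega>))\<^sup>2 + 2 * (\<sigma> i j (X u \<omega>) - \<sigma> i j (y \<omega>))\<^sup>2" by (rule sq_sum_le)
    also have "\<dots> \<le> 2 * (L\<^sup>2 * (norm (X r \<omega> - X u \<omega>))\<^sup>2) + 2 * (L\<^sup>2 * (norm (X u \<omega> - y \<omega>))\<^sup>2)"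
      by (intro add_mono mult_left_mono lip) auto
    also have "\<dots> \<le> 2 * (L\<^sup>2 * (h * (1 + norm (X r \<omega> - X u \<omega>) ^ 6 / h ^ 3))) + 2 * (L\<^sup>2 * (norm (X u \<omega> - y \<omega>))\<^sup>2)"
      by (intro add_right_mono mult_left_mono square_le_sixth_power h) auto
    also have "\<dots> = \<Phi> r \<omega>" by (simp add: \<Phi>_def algebra_simps)
    finally show ?thesis .
  qed
  have slice: "(\<integral>\<^sup>+\<omega>. ennreal (\<Phi> r \<omega>) \<partial>M) \<le> ennreal (2 * L\<^sup>2 * (h * (1 + C) + ?EA))" if r: "r \<in> {u..v}" for r
  proof -
    have rT: "u \<in> {0..T}" "r \<in> {0..T}" "\<bar>r - u\<bar> \<le> h" using r uv by (auto simp: h_def)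
    note m = increment_moment[OF rT]
    have int\<Phi>: "integrable M (\<Phi> r)" unfolding \<Phi>_def[abs_def] using m int by simp
    have "expectation (\<Phi> r) = 2 * L\<^sup>2 * (h * (1 + expectation (\<lambda>\<omega>. norm (X r \<omega> - X u \<omega>) ^ 6) / h ^ 3) + ?EA)"
      unfolding \<Phi>_def[abs_def] using m int by (simp add: prob_space)
    also have "\<dots> \<le> 2 * L\<^sup>2 * (h * (1 + C) + ?EA)"
      using m h by (intro mult_left_mono add_mono) (auto simp: divide_le_eq)
    finally show ?thesis using nn_integral_eq_integral[OF int\<Phi>] \<Phi>0 by (simp add: ennreal_leI)
  qed
  have \<Phi>_joint: "(\<lambda>x. ennreal (\<Phi> (fst x) (snd x))) \<in> borel_measurable (lborel \<Otimes>\<^sub>M M)"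
    unfolding \<Phi>_def by measurable
  have "(\<integral>\<^sup>+\<omega>. ennreal (1 * (noise u v y i j \<omega>)\<^sup>2) \<partial>M) \<le>
      4 * (\<integral>\<^sup>+\<omega>. ennreal 1 * (\<integral>\<^sup>+r\<in>{u..v}. ennreal ((\<sigma> i j (X r \<omega>) - \<sigma> i j (y \<omega>))\<^sup>2) \<partial>lborel) \<partial>M)"
    by (rule noise_properties(4)[OF uv y]) auto
  also have "\<dots> \<le> 4 * (\<integral>\<^sup>+\<omega>. (\<integral>\<^sup>+r\<in>{u..v}. ennreal (\<Phi> r \<omega>) \<partial>lborel) \<partial>M)"
    unfolding ennreal_1 mult_1
    by (intro mult_left_mono nn_integral_mono mult_right_mono ennreal_leI \<sigma>\<Phi>) auto
  also have "\<dots> \<le> 4 * (ennreal (2 * L\<^sup>2 * (h * (1 + C) + ?EA)) * ennreal (v - u))"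
    using uv slice \<Phi>_joint by (intro mult_left_mono time_integral_le) auto
  also have "\<dots> = ennreal (8 * L\<^sup>2 * (v - u) * ((v - u) * (1 + C) + ?EA))"
  proof -
    have "0 \<le> 2 * L\<^sup>2 * (h * (1 + C) + ?EA)" using h C EA0 by simp
    then have "ennreal 4 * (ennreal (2 * L\<^sup>2 * (h * (1 + C) + ?EA)) * ennreal h) =
        ennreal (4 * (2 * L\<^sup>2 * (h * (1 + C) + ?EA) * h))"
      using h by (simp only: ennreal_mult mult_nonneg_nonneg zero_le_numeral less_imp_le)
    then show ?thesis by (simp add: h_def mult_ac)
  qed
  finally have nn: "(\<integral>\<^sup>+\<omega>. ennreal ((noise u v y i j \<omega>)\<^sup>2) \<partial>M) \<le>
      ennreal (8 * L\<^sup>2 * (v - u) * ((v - u) * (1 + C) + ?EA))" by simp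
  have "0 \<le> 8 * L\<^sup>2 * (v - u) * ((v - u) * (1 + C) + ?EA)" using uv C EA0 by simp
  then show ?thesis by (intro integral_real_le_of_nn(2)[OF _ _ nn]) auto
qed

text \<open>The inner product of the current error with the total noise, as a sum over the pairs \<open>(i, j)\<close>.\<close>

definition martingale_part :: "real \<Rightarrow> real \<Rightarrow> ('a \<Rightarrow> real ^ 'd::{finite,linorder}) \<Rightarrow> 'a \<Rightarrow> real" where
  "martingale_part u v y \<omega> = (\<Sum>p\<in>UNIV. (X u \<omega> - y \<omega>) $ fst p * noise u v y (fst p) (snd p) \<omega>)"

text \<open>What Young's inequality leaves of the squared norm of error plus perturbation once the martingale part
  is split off.\<close>

definition remainder :: "real \<Rightarrow> real \<Rightarrow> ('a \<Rightarrow> real ^ 'd::{finite,linorder}) \<Rightarrow> 'a \<Rightarrow> real" where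
  "remainder u v y \<omega> = (1 + 6 * CARD('d) * L\<^sup>2) * (v - u) * (norm (X u \<omega> - y \<omega>))\<^sup>2
     + 6 / (v - u) * (\<Sum>i\<in>UNIV. (drift_error u v i \<omega>)\<^sup>2)
     + 2 * CARD('d) * (\<Sum>p\<in>UNIV. (noise u v y (fst p) (snd p) \<omega>)\<^sup>2)"

definition rate_const :: real where
  "rate_const = 1 + 6 * CARD('d) * L\<^sup>2 + 6 * CARD('d) * (defect_const * (1 + 4 * C))
     + 16 * CARD('d) ^ 3 * L\<^sup>2 * (1 + C) + 16 * K\<^sup>2 * CARD('d) ^ 4"

text \<open>Both \<open>X v\<close> and \<open>y'\<close> result from an implicit step, starting from points whose difference is \<open>e + D + N\<close>:
  the current error, the perturbation by the drift and the noise. The implicit step is nonexpansive,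
  so the square of this vector remains to be expanded. The cross term of \<open>e\<close> and \<open>N\<close> has mean zero and
  is kept; the others are absorbed by Young's inequality.\<close>

lemma one_step_error:
  assumes uv: "0 \<le> u" "u < v" "v \<le> T" "v - u \<le> 1"
    and y'_chamber: "\<And>\<omega>. y' \<omega> \<in> ordered_chamber"
    and y': "\<And>\<omega> i. y' \<omega> $ i = y \<omega> $ i + (repulsion \<gamma> (y' \<omega>) i + b i (y \<omega>)) * (v - u)
        + (\<Sum>j\<in>UNIV. \<sigma> i j (y \<omega>) * (W v \<omega> $ j - W u \<omega> $ j))"
  shows "AE \<omega> in M. (norm (X v \<omega> - y' \<omega>))\<^sup>2 \<le>
    (norm (X u \<omega> - y \<omega>))\<^sup>2 + 2 * martingale_part u v y \<omega> + remainder u v y \<omega>"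
  using solution_increment[OF uv(1) less_imp_le[OF uv(2)] uv(3)]
proof eventually_elim
  case (elim \<omega>)
  define h where "h = v - u"
  have h: "0 < h" "h \<le> 1" using uv by (auto simp: h_def)
  define e where "e = X u \<omega> - y \<omega>"
  define D where "D = (\<chi> i. h * (b i (X u \<omega>) - b i (y \<omega>)) + drift_error u v i \<omega>)"
  define N where "N = (\<chi> i. \<Sum>j\<in>UNIV. noise u v y i j \<omega>)"
  define d where "d = real CARD('d)"
  (* The starting points of the implicit steps that end in X v and in the new iterate. *)
  define z where "z = (\<chi> i. X v \<omega> $ i - repulsion \<gamma> (X v \<omega>) i * h)"
  define z' where "z' = (\<chi> i. y' \<omega> $ i - repulsion \<gamma> (y' \<omega>) i * h)"
  have "norm (X v \<omega> - y' \<omega>) \<le> norm (z - z')"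
  proof (rule implicit_step_contraction[where \<gamma> = \<gamma> and h = h])
    show "\<gamma> i j = \<gamma> j i \<and> 0 \<le> \<gamma> i j" if "i \<noteq> j" for i j by (rule \<gamma>[OF that])
    show "X v \<omega> $ i = z $ i + repulsion \<gamma> (X v \<omega>) i * h" "y' \<omega> $ i = z' $ i + repulsion \<gamma> (y' \<omega>) i * h" for i
      by (simp_all add: z_def z'_def)
  qed (use h X_chamber y'_chamber in auto)
  also have "z - z' = e + D + N"
  proof (rule vec_eq_iff[THEN iffD2], rule allI)
    fix i
    have "(z - z') $ i = (X v \<omega> $ i - repulsion \<gamma> (X v \<omega>) i * h) - (y' \<omega> $ i - repulsion \<gamma> (y' \<omega>) i * h)"
      by (simp add: z_def z'_def)
    also have "\<dots> = (X u \<omega> $ i + h * b i (X u \<omega>) + drift_error u v i \<omega> + (\<Sum>j\<in>UNIV. I i j v \<omega> - I i j u \<omega>))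
        - (y \<omega> $ i + b i (y \<omega>) * h + (\<Sum>j\<in>UNIV. \<sigma> i j (y \<omega>) * (W v \<omega> $ j - W u \<omega> $ j)))"
      unfolding elim[rule_format, of i] y'[of \<omega> i] h_def[symmetric]
      by (simp only: distrib_left distrib_right mult.commute[of h])
    also have "\<dots> = (e + D + N) $ i"
    proof -
      have "N $ i = (\<Sum>j\<in>UNIV. I i j v \<omega> - I i j u \<omega>) - (\<Sum>j\<in>UNIV. \<sigma> i j (y \<omega>) * (W v \<omega> $ j - W u \<omega> $ j))"
        unfolding N_def vec_lambda_beta noise_def sum_subtractf[symmetric] ..
      then show ?thesis by (simp add: e_def D_def right_diff_distrib mult.commute[of h])
    qed
    finally show "(z - z') $ i = (e + D + N) $ i" .
  qed
  finally have "(norm (X v \<omega> - y' \<omega>))\<^sup>2 \<le> (norm (e + (D + N)))\<^sup>2"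
    by (intro power_mono) (auto simp: add.assoc)
  also have "\<dots> = (norm e)\<^sup>2 + 2 * (e \<bullet> N) + 2 * (e \<bullet> D) + (norm (D + N))\<^sup>2"
    by (simp add: power2_norm_eq_inner inner_add_left inner_add_right inner_commute)
  also have "\<dots> \<le> (norm e)\<^sup>2 + 2 * (e \<bullet> N) + (h * (norm e)\<^sup>2 + (norm D)\<^sup>2 / h) + (2 * (norm D)\<^sup>2 + 2 * (norm N)\<^sup>2)"
  proof (intro add_mono order_refl)
    have "0 \<le> (h * norm e - norm D)\<^sup>2" by simp
    then have "2 * (norm e * norm D) * h \<le> h * h * (norm e)\<^sup>2 + (norm D)\<^sup>2"
      by (simp add: power2_eq_square algebra_simps)
    then have "2 * (norm e * norm D) \<le> h * (norm e)\<^sup>2 + (norm D)\<^sup>2 / h"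
      using h by (simp add: field_simps)
    then show "2 * (e \<bullet> D) \<le> h * (norm e)\<^sup>2 + (norm D)\<^sup>2 / h"
      using norm_cauchy_schwarz[of e D] by linarith
    have "(norm (D + N))\<^sup>2 \<le> (norm D + norm N)\<^sup>2" by (intro power_mono norm_triangle_ineq) simp
    also have "\<dots> \<le> 2 * (norm D)\<^sup>2 + 2 * (norm N)\<^sup>2" by (rule sq_sum_le)
    finally show "(norm (D + N))\<^sup>2 \<le> 2 * (norm D)\<^sup>2 + 2 * (norm N)\<^sup>2" .
  qed
  also have "\<dots> \<le> (norm e)\<^sup>2 + 2 * (e \<bullet> N) + (h * (norm e)\<^sup>2 + (norm D)\<^sup>2 / h) + (2 * ((norm D)\<^sup>2 / h) + 2 * (norm N)\<^sup>2)"
  proof -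
    (* Since h is at most 1, the square of D joins the term that Young has produced. *)
    have "(norm D)\<^sup>2 \<le> (norm D)\<^sup>2 / h" using h by (simp add: le_divide_eq mult_left_le)
    then show ?thesis by linarith
  qed
  also have "\<dots> \<le> (norm e)\<^sup>2 + 2 * (e \<bullet> N) + (h * (norm e)\<^sup>2
      + 3 * (2 * d * L\<^sup>2 * h * (norm e)\<^sup>2 + 2 / h * (\<Sum>i\<in>UNIV. (drift_error u v i \<omega>)\<^sup>2)))
      + 2 * (d * (\<Sum>p\<in>UNIV. (noise u v y (fst p) (snd p) \<omega>)\<^sup>2))"
  proof -
    have "(D $ i)\<^sup>2 \<le> 2 * (L\<^sup>2 * h\<^sup>2 * (norm e)\<^sup>2) + 2 * (drift_error u v i \<omega>)\<^sup>2" for i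
    proof -
      have "(b i (X u \<omega>) - b i (y \<omega>))\<^sup>2 \<le> L\<^sup>2 * (norm e)\<^sup>2"
        using power_mono[OF b_lip[of i "X u \<omega>" "y \<omega>"], of 2] by (simp add: power_mult_distrib e_def)
      then have "h\<^sup>2 * (b i (X u \<omega>) - b i (y \<omega>))\<^sup>2 \<le> h\<^sup>2 * (L\<^sup>2 * (norm e)\<^sup>2)" by (rule mult_left_mono) simp
      then show ?thesis
        using sq_sum_le[of "h * (b i (X u \<omega>) - b i (y \<omega>))" "drift_error u v i \<omega>"]
        by (simp add: D_def power_mult_distrib mult_ac)
    qed
    then have "(norm D)\<^sup>2 \<le> (\<Sum>i\<in>(UNIV :: 'd set). 2 * (L\<^sup>2 * h\<^sup>2 * (norm e)\<^sup>2) + 2 * (drift_error u v i \<omega>)\<^sup>2)"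
      unfolding norm_vec_sq[of D] by (rule sum_mono)
    also have "\<dots> = 2 * d * L\<^sup>2 * h\<^sup>2 * (norm e)\<^sup>2 + 2 * (\<Sum>i\<in>UNIV. (drift_error u v i \<omega>)\<^sup>2)"
      by (simp add: sum.distrib sum_distrib_left d_def)
    finally have "(norm D)\<^sup>2 / h \<le> (2 * d * L\<^sup>2 * h\<^sup>2 * (norm e)\<^sup>2 + 2 * (\<Sum>i\<in>UNIV. (drift_error u v i \<omega>)\<^sup>2)) / h"
      using h by (intro divide_right_mono) auto
    also have "\<dots> = 2 * d * L\<^sup>2 * h * (norm e)\<^sup>2 + 2 / h * (\<Sum>i\<in>UNIV. (drift_error u v i \<omega>)\<^sup>2)"
      using h by (simp add: add_divide_distrib power2_eq_square)
    finally have D: "(norm D)\<^sup>2 / h \<le> 2 * d * L\<^sup>2 * h * (norm e)\<^sup>2 + 2 / h * (\<Sum>i\<in>UNIV. (drift_error u v i \<omega>)\<^sup>2)" .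
    have "(N $ i)\<^sup>2 \<le> d * (\<Sum>j\<in>UNIV. (noise u v y i j \<omega>)\<^sup>2)" for i
      using sum_squared_le_sum_of_squares[of "\<lambda>j. noise u v y i j \<omega>" UNIV] by (simp add: N_def d_def mult.commute)
    then have "(norm N)\<^sup>2 \<le> (\<Sum>i\<in>UNIV. d * (\<Sum>j\<in>UNIV. (noise u v y i j \<omega>)\<^sup>2))"
      unfolding norm_vec_sq[of N] by (rule sum_mono)
    also have "\<dots> = d * (\<Sum>p\<in>UNIV. (noise u v y (fst p) (snd p) \<omega>)\<^sup>2)"
      by (simp add: sum_distrib_left[symmetric] sum.cartesian_product case_prod_beta' UNIV_Times_UNIV)
    finally have N: "(norm N)\<^sup>2 \<le> d * (\<Sum>p\<in>UNIV. (noise u v y (fst p) (snd p) \<omega>)\<^sup>2)" .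
    have combine: "A + (E + p) + (2 * p + 2 * q) \<le> A + (E + 3 * p') + 2 * q'" if "p \<le> p'" "q \<le> q'"
      for A E p q p' q' :: real using that by linarith
    show ?thesis by (rule combine[OF D N])
  qed
  also have "e \<bullet> N = martingale_part u v y \<omega>"
    unfolding inner_eq_sum martingale_part_def N_def
    by (simp add: sum_distrib_left sum.cartesian_product case_prod_beta' UNIV_Times_UNIV e_def)
  finally show ?case
    unfolding remainder_def e_def[symmetric] h_def[symmetric] by (simp add: d_def algebra_simps)
qed

text \<open>The hypotheses of \<open>recursive_maximal_bound\<close>. With \<open>h = v - u\<close>, the Gronwall argument absorbs the multiples
  of \<open>h * EA\<close>, and the terms of order \<open>h\<^sup>2\<close> in the remainder sum up to order \<open>h\<close> over all steps.\<close>

lemma one_step_moments: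
  assumes uv: "0 \<le> u" "u < v" "v \<le> T" and y: "y \<in> borel_measurable (F u)"
    and int: "integrable M (\<lambda>\<omega>. (norm (X u \<omega> - y \<omega>))\<^sup>2)"
  defines "EA \<equiv> expectation (\<lambda>\<omega>. (norm (X u \<omega> - y \<omega>))\<^sup>2)"
  shows "mean_zero_given M (F u) (martingale_part u v y)"
    "martingale_part u v y \<in> borel_measurable (F v)"
    "integrable M (\<lambda>\<omega>. (martingale_part u v y \<omega>)\<^sup>2)"
    "expectation (\<lambda>\<omega>. (martingale_part u v y \<omega>)\<^sup>2) \<le> rate_const * (v - u) * EA"
    "integrable M (remainder u v y)"
    "expectation (remainder u v y) \<le> rate_const * ((v - u) * EA + (v - u)\<^sup>2)"
proof -
  define h where "h = v - u"
  have h: "0 < h" using uv by (simp add: h_def)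
  have EA0: "0 \<le> EA" by (simp add: EA_def)
  let ?e = "\<lambda>i \<omega>. (X u \<omega> - y \<omega>) $ i"
  let ?N = "\<lambda>p. noise u v y (fst p) (snd p)"
  have sub: "subalgebra M (F u)" "subalgebra M (F v)" "subalgebra (F v) (F u)"
    using uv by (auto intro!: usual_filtrationD[OF F])
  have Xu: "X u \<in> borel_measurable (F u)" using uv by (intro X_adapted) auto
  have eF: "?e i \<in> borel_measurable (F u)" for i
    by (rule measurable_compose[OF borel_measurable_diff[OF Xu y] vec_nth_measurable])
  have eM: "?e i \<in> borel_measurable M" for i by (rule measurable_from_subalg[OF sub(1) eF])
  have e2F: "(\<lambda>\<omega>. (?e i \<omega>)\<^sup>2) \<in> borel_measurable (F u)" for i by (rule borel_measurable_power[OF eF])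
  have e_le: "(?e i \<omega>)\<^sup>2 \<le> (norm (X u \<omega> - y \<omega>))\<^sup>2" for i \<omega>
    by (metis abs_ge_zero component_le_norm_cart power2_abs power_mono)
  have e2: "integrable M (\<lambda>\<omega>. (?e i \<omega>)\<^sup>2)" "expectation (\<lambda>\<omega>. (?e i \<omega>)\<^sup>2) \<le> EA" for i
  proof -
    show i: "integrable M (\<lambda>\<omega>. (?e i \<omega>)\<^sup>2)"
      by (rule Bochner_Integration.integrable_bound[OF int]) (use eM[of i] e_le in \<open>auto\<close>)
    show "expectation (\<lambda>\<omega>. (?e i \<omega>)\<^sup>2) \<le> EA" unfolding EA_def by (intro integral_mono i int e_le)
  qed
  have sq: "integrable M (\<lambda>\<omega>. (?e (fst p) \<omega> * ?N p \<omega>)\<^sup>2)"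
    "expectation (\<lambda>\<omega>. (?e (fst p) \<omega> * ?N p \<omega>)\<^sup>2) \<le> 16 * K\<^sup>2 * h * EA" for p
  proof -
    note w = noise_weighted_moment[OF uv y e2F _ e2(1), of "fst p" "fst p" "snd p"]
    show "integrable M (\<lambda>\<omega>. (?e (fst p) \<omega> * ?N p \<omega>)\<^sup>2)" using w(1) by (simp add: power_mult_distrib)
    have "expectation (\<lambda>\<omega>. (?e (fst p) \<omega> * ?N p \<omega>)\<^sup>2) \<le> 16 * K\<^sup>2 * h * expectation (\<lambda>\<omega>. (?e (fst p) \<omega>)\<^sup>2)"
      using w(2) by (simp add: power_mult_distrib h_def)
    also have "\<dots> \<le> 16 * K\<^sup>2 * h * EA" using e2(2)[of "fst p"] h by (intro mult_left_mono) auto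
    finally show "expectation (\<lambda>\<omega>. (?e (fst p) \<omega> * ?N p \<omega>)\<^sup>2) \<le> 16 * K\<^sup>2 * h * EA" .
  qed
  note sum = mean_zero_given_sum[where S = UNIV and \<xi> = "\<lambda>p. ?e (fst p)" and P = ?N, OF finite sub(1) eF
      noise_properties(3)[OF uv y] sq(1), folded martingale_part_def]
  show "mean_zero_given M (F u) (martingale_part u v y)"
    using sum(1) by (simp add: martingale_part_def[abs_def])
  show "integrable M (\<lambda>\<omega>. (martingale_part u v y \<omega>)\<^sup>2)" by (rule sum(2))
  show "martingale_part u v y \<in> borel_measurable (F v)"
    unfolding martingale_part_def[abs_def]
    by (intro borel_measurable_sum borel_measurable_times measurable_from_subalg[OF sub(3) eF] noise_properties(1)[OF uv y])
  define d where "d = real CARD('d)"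
  have d: "0 \<le> d" "real (card (UNIV :: ('d \<times> 'd) set)) = d * d" by (auto simp: d_def card_prod)
  have dc: "0 \<le> defect_const" by (simp add: defect_const_def)
  have rate: "rate_const = 1 + 6 * d * L\<^sup>2 + 6 * d * (defect_const * (1 + 4 * C)) + 16 * d ^ 3 * L\<^sup>2 * (1 + C) + 16 * K\<^sup>2 * d ^ 4"
    by (simp add: rate_const_def d_def)
  have rate_nonneg: "0 \<le> 6 * d * L\<^sup>2" "0 \<le> 6 * d * (defect_const * (1 + 4 * C))" "0 \<le> 16 * d ^ 3 * L\<^sup>2" "0 \<le> 16 * d ^ 3 * L\<^sup>2 * C" "0 \<le> 16 * K\<^sup>2 * d ^ 4"
    using d(1) dc C by auto
  have rate_split: "16 * d ^ 3 * L\<^sup>2 * (1 + C) = 16 * d ^ 3 * L\<^sup>2 + 16 * d ^ 3 * L\<^sup>2 * C" by (simp add: distrib_left)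
  have rate_ge: "16 * K\<^sup>2 * d ^ 4 \<le> rate_const" "1 + 6 * d * L\<^sup>2 + 16 * d ^ 3 * L\<^sup>2 \<le> rate_const"
    "6 * d * (defect_const * (1 + 4 * C)) + 16 * d ^ 3 * L\<^sup>2 * (1 + C) \<le> rate_const"
    unfolding rate rate_split using rate_nonneg by linarith+
  have "expectation (\<lambda>\<omega>. (martingale_part u v y \<omega>)\<^sup>2) \<le> (d * d) * (\<Sum>p\<in>(UNIV :: ('d \<times> 'd) set). expectation (\<lambda>\<omega>. (?e (fst p) \<omega> * ?N p \<omega>)\<^sup>2))"
    using sum(3) unfolding d(2) by simp
  also have "\<dots> \<le> (d * d) * (\<Sum>p\<in>(UNIV :: ('d \<times> 'd) set). 16 * K\<^sup>2 * h * EA)"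
    using d(1) by (intro mult_left_mono sum_mono sq(2)) auto
  also have "\<dots> = (16 * K\<^sup>2 * d ^ 4) * (h * EA)"
    unfolding sum_constant d(2) by (simp add: power4_eq_xxxx)
  also have "\<dots> \<le> rate_const * (h * EA)"
    using h EA0 by (intro mult_right_mono rate_ge) auto
  finally show "expectation (\<lambda>\<omega>. (martingale_part u v y \<omega>)\<^sup>2) \<le> rate_const * (v - u) * EA"
    by (simp add: h_def mult.assoc)
  note ints = int drift_error_moment(1)[OF uv] noise_properties(2)[OF uv y]
  show "integrable M (remainder u v y)"
    unfolding remainder_def[abs_def]
    by (intro Bochner_Integration.integrable_add integrable_mult_right Bochner_Integration.integrable_sum ints)
  have "expectation (remainder u v y) = (1 + 6 * d * L\<^sup>2) * h * EA
     + 6 / h * (\<Sum>i\<in>UNIV. expectation (\<lambda>\<omega>. (drift_error u v i \<omega>)\<^sup>2))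
     + 2 * d * (\<Sum>p\<in>UNIV. expectation (\<lambda>\<omega>. (?N p \<omega>)\<^sup>2))"
    unfolding remainder_def[abs_def] h_def[symmetric] EA_def
    using ints by (simp add: d_def Bochner_Integration.integral_sum Bochner_Integration.integrable_sum)
  also have "\<dots> \<le> (1 + 6 * d * L\<^sup>2) * h * EA
     + 6 / h * (\<Sum>i\<in>(UNIV :: 'd set). defect_const * (1 + 4 * C) * h ^ 3)
     + 2 * d * (\<Sum>p\<in>(UNIV :: ('d \<times> 'd) set). 8 * L\<^sup>2 * h * (h * (1 + C) + EA))"
    using d(1) h drift_error_moment(2)[OF uv] noise_moment[OF uv y int]
    by (intro add_mono mult_left_mono sum_mono order_refl) (auto simp: h_def EA_def)
  also have "\<dots> = (1 + 6 * d * L\<^sup>2) * h * EA + 6 * d * (defect_const * (1 + 4 * C)) * h\<^sup>2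
     + 16 * d ^ 3 * L\<^sup>2 * (1 + C) * h\<^sup>2 + 16 * d ^ 3 * L\<^sup>2 * (h * EA)"
    unfolding sum_constant d(2) d_def[symmetric]
    using h by (simp add: power3_eq_cube power2_eq_square field_simps)
  also have "\<dots> \<le> rate_const * (h * EA) + rate_const * h\<^sup>2"
  proof -
    have "(1 + 6 * d * L\<^sup>2 + 16 * d ^ 3 * L\<^sup>2) * (h * EA) \<le> rate_const * (h * EA)"
      using h EA0 by (intro mult_right_mono rate_ge) auto
    moreover have "(6 * d * (defect_const * (1 + 4 * C)) + 16 * d ^ 3 * L\<^sup>2 * (1 + C)) * h\<^sup>2 \<le> rate_const * h\<^sup>2"
      by (intro mult_right_mono rate_ge) auto
    ultimately show ?thesis by (simp add: algebra_simps)
  qed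
  finally show "expectation (remainder u v y) \<le> rate_const * ((v - u) * EA + (v - u)\<^sup>2)"
    by (simp add: h_def distrib_left)
qed

section \<open>Convergence of the scheme\<close>

lemma rate_const_nonneg: "0 \<le> rate_const"
  unfolding rate_const_def defect_const_def using C by simp

text \<open>The one-step estimates on the grid, put into the stochastic recursion with the squared errors as \<open>a k\<close>. The
  initial value \<open>X0\<close> is a separate variable because the scheme starts from the original solution, of
  which \<open>X\<close> is a modification.\<close>

lemma scheme_convergence:
  fixes X0 :: "'a \<Rightarrow> real ^ 'd::{finite,linorder}" and n :: nat
  assumes T: "0 < T" and n: "n \<ge> 1" "T / real n \<le> 1"
    and X0: "X0 \<in> borel_measurable (F 0)" "AE \<omega> in M. X0 \<omega> = X 0 \<omega>"
  defines "Y \<equiv> semi_implicit_EM \<gamma> b \<sigma> W T X0 n"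
    and "C1 \<equiv> T * rate_const * exp (T * rate_const)"
  shows "\<And>k. k \<le> n \<Longrightarrow> Y k \<in> borel_measurable M"
    and "\<And>k. k \<le> n \<Longrightarrow> integrable M (\<lambda>\<omega>. (norm (X (grid T n k) \<omega> - Y k \<omega>))\<^sup>2)"
    and "\<And>k. k \<le> n \<Longrightarrow> expectation (\<lambda>\<omega>. (norm (X (grid T n k) \<omega> - Y k \<omega>))\<^sup>2) \<le> C1 * (T / real n)"
    and "integrable M (\<lambda>\<omega>. SUP k\<in>{1..n}. (norm (X (grid T n k) \<omega> - Y k \<omega>))\<^sup>2)"
    and "expectation (\<lambda>\<omega>. SUP k\<in>{1..n}. (norm (X (grid T n k) \<omega> - Y k \<omega>))\<^sup>2)
      \<le> (4 * sqrt (T * rate_const * C1) + T * rate_const * (C1 + 1)) * sqrt (T / real n)"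
proof -
  define h where "h = T / real n"
  let ?t = "grid T n"
  have h: "0 < h" "h \<le> 1" using T n by (auto simp: h_def)
  have nh: "real n * h \<le> T" using n by (simp add: h_def)
  have t0: "0 \<le> ?t k" for k using T by (simp add: grid_def)
  have t_step: "?t (Suc k) - ?t k = h" for k by (simp add: grid_def h_def add_divide_distrib distrib_right)
  have t_less: "?t k < ?t (Suc k)" for k using t_step[of k] h by linarith
  have tT: "?t k \<le> T" if "k \<le> n" for k
  proof -
    have "real k * T \<le> real n * T" using that T by simp
    then show ?thesis using n by (simp add: grid_def divide_le_eq mult.commute)
  qed
  have sub: "subalgebra M (F (?t k))" for k by (rule usual_filtrationD(1)[OF F t0])
  have sub': "subalgebra (F (?t (Suc k))) (F (?t k))" for k
    by (rule usual_filtrationD(2)[OF F t0 less_imp_le[OF t_less]])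
  have WF: "W t \<in> borel_measurable (F t)" if "0 \<le> t" for t
    using W that by (simp add: brownian_motion_def)
  have W_coord: "(\<lambda>\<omega>. W t \<omega> $ j) \<in> borel_measurable (F t)" if "0 \<le> t" for t j
    by (rule measurable_compose[OF WF[OF that] vec_nth_measurable])
  define z where "z k \<omega> = (\<chi> i. Y k \<omega> $ i + b i (Y k \<omega>) * h
       + (\<Sum>j\<in>UNIV. \<sigma> i j (Y k \<omega>) * (W (?t (Suc k)) \<omega> $ j - W (?t k) \<omega> $ j)))" for k \<omega>
  have Y_Suc: "Y (Suc k) \<omega> = implicit_step \<gamma> h (z k \<omega>)" for k \<omega>
    unfolding Y_def z_def h_def by (rule semi_implicit_EM_Suc)
  have Y_chamber: "Y (Suc k) \<omega> \<in> ordered_chamber" for k \<omega>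
    unfolding Y_Suc by (rule implicit_step_solves[where \<gamma> = \<gamma>]) (fact \<gamma> \<gamma>_adj h)+
  have Y_eq: "Y (Suc k) \<omega> $ i = Y k \<omega> $ i + (repulsion \<gamma> (Y (Suc k) \<omega>) i + b i (Y k \<omega>)) * (?t (Suc k) - ?t k)
        + (\<Sum>j\<in>UNIV. \<sigma> i j (Y k \<omega>) * (W (?t (Suc k)) \<omega> $ j - W (?t k) \<omega> $ j))" for k \<omega> i
  proof -
    have "Y (Suc k) \<omega> $ i = z k \<omega> $ i + repulsion \<gamma> (Y (Suc k) \<omega>) i * h"
      unfolding Y_Suc by (rule implicit_step_solves[where \<gamma> = \<gamma>]) (fact \<gamma> \<gamma>_adj h)+
    then show ?thesis unfolding t_step z_def vec_lambda_beta by (simp add: distrib_right)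
  qed
  have YF: "Y k \<in> borel_measurable (F (?t k))" for k
  proof (induction k)
    case 0
    then show ?case using X0(1) by (simp add: Y_def grid_def)
  next
    case (Suc k)
    let ?G = "F (?t (Suc k))"
    have [measurable]: "Y k \<in> borel_measurable ?G" by (rule measurable_from_subalg[OF sub' Suc])
    have [measurable]: "(\<lambda>\<omega>. W (?t (Suc k)) \<omega> $ j) \<in> borel_measurable ?G" "(\<lambda>\<omega>. W (?t k) \<omega> $ j) \<in> borel_measurable ?G" for j
      by (rule W_coord[OF t0], rule measurable_from_subalg[OF sub' W_coord[OF t0]])
    have "(\<lambda>\<omega>. z k \<omega>) \<in> borel_measurable ?G"
    proof (rule borel_measurable_euclidean_space[THEN iffD2], rule ballI)
      fix e :: "real ^ 'd::{finite,linorder}" assume "e \<in> Basis"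
      then obtain i where "e = axis i 1" by (auto simp: Basis_vec_def)
      then have "(\<lambda>\<omega>. z k \<omega> \<bullet> e) = (\<lambda>\<omega>. Y k \<omega> $ i + b i (Y k \<omega>) * h
          + (\<Sum>j\<in>UNIV. \<sigma> i j (Y k \<omega>) * (W (?t (Suc k)) \<omega> $ j - W (?t k) \<omega> $ j)))"
        by (simp add: z_def inner_axis fun_eq_iff)
      then show "(\<lambda>\<omega>. z k \<omega> \<bullet> e) \<in> borel_measurable ?G" by simp
    qed
    moreover have "implicit_step \<gamma> h \<in> borel_measurable borel"
      by (rule implicit_step_measurable) (fact \<gamma> \<gamma>_adj h)+
    ultimately show ?case unfolding Y_Suc[abs_def] by (rule measurable_compose)
  qed
  show YM: "Y k \<in> borel_measurable M" for k by (rule measurable_from_subalg[OF sub YF])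
  define a where "a k \<omega> = (norm (X (?t k) \<omega> - Y k \<omega>))\<^sup>2" for k \<omega>
  define P where "P k = martingale_part (?t k) (?t (Suc k)) (Y k)" for k
  define Q where "Q k = remainder (?t k) (?t (Suc k)) (Y k)" for k
  have a: "a k \<in> borel_measurable M" for k unfolding a_def using YM[of k] X_meas by measurable
  have a_nonneg: "0 \<le> a k \<omega>" for k \<omega> by (simp add: a_def)
  have a0: "AE \<omega> in M. a 0 \<omega> = 0"
    using X0(2) by eventually_elim (simp add: a_def Y_def grid_def)
  have step: "AE \<omega> in M. a (Suc k) \<omega> \<le> a k \<omega> + 2 * P k \<omega> + Q k \<omega>" if "k < n" for k
    unfolding a_def P_def Q_def
    by (rule one_step_error[OF t0 t_less tT _ Y_chamber Y_eq]) (use that h in \<open>auto simp: t_step\<close>)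
  have mono: "sets (F (?t k)) \<subseteq> sets (F (?t (Suc k)))" for k
    using sub'[of k] by (simp add: subalgebra_def)
  have m: "mean_zero_given M (F (?t k)) (P k)"
    "integrable M (\<lambda>\<omega>. (P k \<omega>)\<^sup>2) \<and> expectation (\<lambda>\<omega>. (P k \<omega>)\<^sup>2) \<le> rate_const * h * expectation (a k)"
    "integrable M (Q k) \<and> expectation (Q k) \<le> rate_const * (h * expectation (a k) + h\<^sup>2)"
    if k: "k < n" and int: "integrable M (a k)" for k
    using one_step_moments[OF t0 t_less tT[OF Suc_leI[OF k]] YF] int
    unfolding P_def Q_def a_def[abs_def] t_step by auto
  have Q_nonneg: "0 \<le> Q k \<omega>" for k \<omega>
    unfolding Q_def remainder_def t_step using h by (intro add_nonneg_nonneg mult_nonneg_nonneg sum_nonneg) auto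
  have PF: "P k \<in> borel_measurable (F (?t (Suc k)))" if k: "k < n" for k
  proof -
    have tk: "?t k \<in> {0..T}" using t0 tT[of k] k by auto
    have up: "f \<in> borel_measurable (F (?t k)) \<Longrightarrow> f \<in> borel_measurable (F (?t (Suc k)))" for f :: "'a \<Rightarrow> real ^ 'd::{finite,linorder}"
      by (rule measurable_from_subalg[OF sub'])
    have e: "(\<lambda>\<omega>. (X (?t k) \<omega> - Y k \<omega>) $ i) \<in> borel_measurable (F (?t (Suc k)))" for i
      by (rule measurable_compose[OF borel_measurable_diff[OF up[OF X_adapted[OF tk]] up[OF YF]] vec_nth_measurable])
    show ?thesis unfolding P_def martingale_part_def[abs_def]
      by (intro borel_measurable_sum borel_measurable_times e noise_properties(1)[OF t0 t_less tT[OF Suc_leI[OF k]] YF])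
  qed
  note bound = recursive_maximal_bound[where a = a and P = P and Q = Q and G = "\<lambda>k. F (?t k)" and K = rate_const
      and h = h and \<tau> = T and n = n, folded C1_def]
  show "integrable M (\<lambda>\<omega>. (norm (X (grid T n k) \<omega> - Y k \<omega>))\<^sup>2)" if k: "k \<le> n" for k
    using bound(1)[OF n(1) rate_const_nonneg h nh sub mono a a_nonneg a0 PF m(1) m(2) Q_nonneg m(3) step k]
    unfolding a_def[abs_def] by simp
  show "expectation (\<lambda>\<omega>. (norm (X (grid T n k) \<omega> - Y k \<omega>))\<^sup>2) \<le> C1 * (T / real n)" if k: "k \<le> n" for k
    using bound(2)[OF n(1) rate_const_nonneg h nh sub mono a a_nonneg a0 PF m(1) m(2) Q_nonneg m(3) step k]
    unfolding a_def[abs_def] h_def by simp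
  show "integrable M (\<lambda>\<omega>. SUP k\<in>{1..n}. (norm (X (grid T n k) \<omega> - Y k \<omega>))\<^sup>2)"
    using bound(3)[OF n(1) rate_const_nonneg h nh sub mono a a_nonneg a0 PF m(1) m(2) Q_nonneg m(3) step]
    unfolding a_def[abs_def] by simp
  show "expectation (\<lambda>\<omega>. SUP k\<in>{1..n}. (norm (X (grid T n k) \<omega> - Y k \<omega>))\<^sup>2)
      \<le> (4 * sqrt (T * rate_const * C1) + T * rate_const * (C1 + 1)) * sqrt (T / real n)"
    using bound(4)[OF n(1) rate_const_nonneg h nh sub mono a a_nonneg a0 PF m(1) m(2) Q_nonneg m(3) step]
    unfolding a_def[abs_def] h_def by simp
qed

end

lemma gap_energy_moment:
  fixes X :: "'a \<Rightarrow> real ^ 'd::{finite,linorder}" and c :: real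
  assumes [measurable]: "X \<in> borel_measurable M"
    and pair: "\<And>a b. (a, b) \<in> adjacent \<Longrightarrow>
      (\<integral>\<^sup>+\<omega>. ennreal (\<bar>X \<omega> $ a - X \<omega> $ b\<bar> powi (-6)) \<partial>M) \<le> ennreal c"
    and c: "0 \<le> c"
  shows "(\<integral>\<^sup>+\<omega>. ennreal (gap_energy (X \<omega>)) \<partial>M) \<le> ennreal (card (adjacent :: ('d \<times> 'd) set) * c)"
proof -
  have powi: "\<bar>x :: real\<bar> powi (-6) = inverse (\<bar>x\<bar> ^ 6)" for x
    using power_int_minus[of "\<bar>x\<bar>" 6] by simp
  have "(\<integral>\<^sup>+\<omega>. ennreal (gap_energy (X \<omega>)) \<partial>M) =
      (\<integral>\<^sup>+\<omega>. (\<Sum>p\<in>adjacent. ennreal (inverse (\<bar>X \<omega> $ fst p - X \<omega> $ snd p\<bar> ^ 6))) \<partial>M)"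
    unfolding gap_energy_def case_prod_beta' by (intro nn_integral_cong sum_ennreal[symmetric]) auto
  also have "\<dots> = (\<Sum>p\<in>adjacent. \<integral>\<^sup>+\<omega>. ennreal (inverse (\<bar>X \<omega> $ fst p - X \<omega> $ snd p\<bar> ^ 6)) \<partial>M)"
    by (rule nn_integral_sum) measurable
  also have "\<dots> \<le> (\<Sum>p\<in>(adjacent :: ('d \<times> 'd) set). ennreal c)"
    using pair by (intro sum_mono) (auto simp: powi)
  also have "\<dots> = ennreal (card (adjacent :: ('d \<times> 'd) set) * c)"
    using c by (simp add: ennreal_mult ennreal_of_nat_eq_real_of_nat)
  finally show ?thesis .
qed

text \<open>A finite family of bounds has a common one; applied to Lipschitz constants and to suprema.\<close>

lemma bounded_family:
  fixes f :: "'i::finite \<Rightarrow> 'x \<Rightarrow> real"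
  assumes "\<And>i. \<exists>c. \<forall>x. \<bar>f i x\<bar> \<le> c * g x" "\<And>x. 0 \<le> g x"
  shows "\<exists>c\<ge>0. \<forall>i x. \<bar>f i x\<bar> \<le> c * g x"
proof -
  obtain c where c: "\<And>i x. \<bar>f i x\<bar> \<le> c i * g x" using assms(1) by metis
  have "\<bar>f i x\<bar> \<le> (\<Sum>i\<in>UNIV. \<bar>c i\<bar>) * g x" for i x
  proof -
    have "c i \<le> \<bar>c i\<bar>" by simp
    also have "\<dots> \<le> (\<Sum>i\<in>UNIV. \<bar>c i\<bar>)" by (rule member_le_sum) auto
    finally show ?thesis using c[of i x] assms(2)[of x] by (meson mult_right_mono order_trans)
  qed
  moreover have "0 \<le> (\<Sum>i\<in>UNIV. \<bar>c i\<bar>)" by (simp add: sum_nonneg)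
  ultimately show ?thesis by blast
qed

lemma lipschitz_bound:
  fixes f :: "'b::real_normed_vector \<Rightarrow> real"
  assumes "\<exists>L. L-lipschitz_on UNIV f"
  shows "\<exists>L. \<forall>x. \<bar>f (fst x) - f (snd x)\<bar> \<le> L * norm (fst x - snd x)"
proof -
  obtain L where "L-lipschitz_on UNIV f" using assms by blast
  then have "\<bar>f (fst x) - f (snd x)\<bar> \<le> L * norm (fst x - snd x)" for x
    using lipschitz_onD[of L UNIV f "fst x" "snd x"] by (simp add: dist_norm)
  then show ?thesis by blast
qed

lemma finite_index_sup_le:
  fixes f :: "nat \<Rightarrow> real"
  assumes "n \<ge> 1" "\<And>k. k \<in> {1..n} \<Longrightarrow> f k \<le> c"
  shows "(SUP k\<in>{1..n}. f k) \<le> c"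
  by (rule cSUP_least) (use assms in auto)

lemma powr_half_le:
  fixes x c h :: real
  assumes "0 \<le> x" "x \<le> c * h" "0 \<le> c" "0 \<le> h"
  shows "x powr (1 / 2) \<le> sqrt c * h powr (1 / 2)"
  using assms by (simp add: powr_half_sqrt real_sqrt_mult[symmetric])

theorem theorem2p10:
  fixes M :: "'a measure"
    and F :: "real \<Rightarrow> 'a measure"
    and W X :: "real \<Rightarrow> 'a \<Rightarrow> real ^ 'd::{finite,linorder}"
    and T C_hat :: real
    and \<gamma> :: "'d \<Rightarrow> 'd \<Rightarrow> real"
    and b :: "'d \<Rightarrow> real ^ 'd::{finite,linorder} \<Rightarrow> real"
    and \<sigma> :: "'d \<Rightarrow> 'd \<Rightarrow> real ^ 'd::{finite,linorder} \<Rightarrow> real"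
  assumes d: "CARD('d) \<ge> 2"
    and T: "T > 0"
    and M: "prob_space M"
    and F: "usual_filtration M F"
    and W: "brownian_motion M F W"
    and A1: "AE \<omega> in M. X 0 \<omega> \<in> ordered_chamber"
    and A2: "\<And>i j. i \<noteq> j \<Longrightarrow> \<gamma> i j = \<gamma> j i \<and> \<gamma> i j \<ge> 0"
            "\<And>i j. (i, j) \<in> adjacent \<Longrightarrow> \<gamma> i j > 0"
    and A3: "\<And>i. \<exists>L. L-lipschitz_on UNIV (b i)"
    and A4: "\<And>i j. \<exists>L. L-lipschitz_on UNIV (\<sigma> i j)"
            "\<And>i j. bounded (range (\<sigma> i j))"
    and X: "chamber_sde_solution M F W T \<gamma> b \<sigma> X"
    and C_hat: "0 < C_hat"
    and moments:
      "(SUP t\<in>{0..T}. \<integral>\<^sup>+\<omega>. ennreal (norm (X t \<omega>) ^ 6) \<partial>M)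
       + (MAX (i, j)\<in>adjacent. SUP t\<in>{0..T}. \<integral>\<^sup>+\<omega>. ennreal (\<bar>X t \<omega> $ i - X t \<omega> $ j\<bar> powi (-6)) \<partial>M)
       < ennreal C_hat"
    and increments:
      "\<And>s t. 0 \<le> s \<Longrightarrow> s < t \<Longrightarrow> t \<le> T \<Longrightarrow>
         (\<integral>\<^sup>+\<omega>. ennreal (norm (X t \<omega> - X s \<omega>) ^ 6) \<partial>M) \<le> ennreal (C_hat * \<bar>t - s\<bar> ^ 3)"
  shows "\<exists>C>0. \<forall>n::nat. n \<ge> 1 \<and> T / real n \<le> 1 \<longrightarrow>
     (let err = (\<lambda>k \<omega>. norm (X (grid T n k) \<omega> - semi_implicit_EM \<gamma> b \<sigma> W T (X 0) n k \<omega>)) in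
        (\<forall>k\<in>{1..n}. integrable M (\<lambda>\<omega>. (err k \<omega>)\<^sup>2)) \<and>
        (SUP k\<in>{1..n}. (LINT \<omega>|M. (err k \<omega>)\<^sup>2) powr (1 / 2)) \<le> C / real n powr (1 / 2) \<and>
        integrable M (\<lambda>\<omega>. SUP k\<in>{1..n}. (err k \<omega>)\<^sup>2) \<and>
        (LINT \<omega>|M. (SUP k\<in>{1..n}. (err k \<omega>)\<^sup>2)) powr (1 / 2) \<le> C / real n powr (1 / 4))"
proof -
  interpret prob_space M by (rule M)
  obtain I where ito: "\<And>i j. ito_integral M F T (\<lambda>t \<omega>. W t \<omega> $ j) (\<lambda>t \<omega>. \<sigma> i j (X t \<omega>)) (I i j)"
    and sde: "\<And>i. AE \<omega> in M. \<forall>t\<in>{0..T}. X t \<omega> $ i = X 0 \<omega> $ i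
               + (LINT r:{0..t}|lborel. repulsion \<gamma> (X r \<omega>) i + b i (X r \<omega>))
               + (\<Sum>j\<in>UNIV. I i j t \<omega>)"
    using X unfolding chamber_sde_solution_def by blast
  have X_F: "\<And>t. t \<in> {0..T} \<Longrightarrow> X t \<in> borel_measurable (F t)"
    and X_cont: "AE \<omega> in M. continuous_on {0..T} (\<lambda>t. X t \<omega>)"
    and X_chamber: "AE \<omega> in M. \<forall>t\<in>{0..T}. X t \<omega> \<in> ordered_chamber"
    using X unfolding chamber_sde_solution_def by blast+
  obtain X' where X': "\<And>t \<omega>. X' t \<omega> \<in> ordered_chamber" "\<And>\<omega>. continuous_on UNIV (\<lambda>t. X' t \<omega>)"
    "\<And>t. t \<in> {0..T} \<Longrightarrow> X' t \<in> borel_measurable (F t)" "\<And>t. X' t \<in> borel_measurable M"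
    and eq: "AE \<omega> in M. \<forall>t\<in>{0..T}. X' t \<omega> = X t \<omega>"
    using chamber_modification[OF F less_imp_le[OF T] X_F X_cont X_chamber] by blast
  have X_M: "X t \<in> borel_measurable M" if "t \<in> {0..T}" for t
    using that by (intro measurable_from_subalg[OF usual_filtrationD(1)[OF F] X_F]) auto
  obtain L1 where L1: "0 \<le> L1" "\<And>i x y. \<bar>b i x - b i y\<bar> \<le> L1 * norm (x - y)"
    using bounded_family[of "\<lambda>i x. b i (fst x) - b i (snd x)" "\<lambda>x. norm (fst x - snd x)"] lipschitz_bound[OF A3] by auto
  obtain L2 where L2: "0 \<le> L2" "\<And>i j x y. \<bar>\<sigma> i j x - \<sigma> i j y\<bar> \<le> L2 * norm (x - y)"
    using bounded_family[of "\<lambda>p x. \<sigma> (fst p) (snd p) (fst x) - \<sigma> (fst p) (snd p) (snd x)" "\<lambda>x. norm (fst x - snd x)"]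
      lipschitz_bound[OF A4(1)] by auto
  obtain K where K: "\<And>i j x. \<bar>\<sigma> i j x\<bar> \<le> K"
  proof -
    have "\<exists>c. \<forall>x. \<bar>\<sigma> (fst p) (snd p) x\<bar> \<le> c * 1" for p
      using A4(2)[of "fst p" "snd p"] by (auto simp: bounded_iff)
    then have "\<exists>c\<ge>0. \<forall>p x. \<bar>\<sigma> (fst p) (snd p) x\<bar> \<le> c * 1"
      by (intro bounded_family[where g = "\<lambda>_. 1"]) auto
    then obtain c where c: "\<forall>p x. \<bar>\<sigma> (fst p) (snd p) x\<bar> \<le> c * 1" by blast
    have "\<bar>\<sigma> i j x\<bar> \<le> c" for i j x using c[rule_format, of "(i, j)" x] by simp
    then show ?thesis by (rule that)
  qed
  obtain G where G: "\<And>i j. \<bar>\<gamma> i j\<bar> \<le> G"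
    using bounded_family[of "\<lambda>p (_ :: unit). \<gamma> (fst p) (snd p)" "\<lambda>_. 1"] by auto
  let ?gap = "\<lambda>(i, j). SUP t\<in>{0..T}. \<integral>\<^sup>+\<omega>. ennreal (\<bar>X t \<omega> $ i - X t \<omega> $ j\<bar> powi (-6)) \<partial>M"
  have pair: "(\<integral>\<^sup>+\<omega>. ennreal (\<bar>X t \<omega> $ i - X t \<omega> $ j\<bar> powi (-6)) \<partial>M) \<le> ennreal C_hat"
    if t: "t \<in> {0..T}" and ij: "(i, j) \<in> adjacent" for t i j
  proof -
    have "(\<integral>\<^sup>+\<omega>. ennreal (\<bar>X t \<omega> $ i - X t \<omega> $ j\<bar> powi (-6)) \<partial>M) \<le> ?gap (i, j)"
      unfolding prod.case by (rule SUP_upper[OF t])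
    also have "\<dots> \<le> (MAX p\<in>adjacent. ?gap p)" using ij by (intro Max_ge) auto
    also have "\<dots> \<le> (SUP t\<in>{0..T}. \<integral>\<^sup>+\<omega>. ennreal (norm (X t \<omega>) ^ 6) \<partial>M) + (MAX p\<in>adjacent. ?gap p)"
      by (rule add_increasing) auto
    also have "\<dots> \<le> ennreal C_hat" using moments by (rule less_imp_le)
    finally show ?thesis .
  qed
  (* One constant for the gap energy, a sum over all adjacent pairs, and for the increments. *)
  define C where "C = (1 + card (adjacent :: ('d \<times> 'd) set)) * C_hat"
  have C: "0 \<le> C" "card (adjacent :: ('d \<times> 'd) set) * C_hat \<le> C" "C_hat \<le> C"
    using C_hat by (auto simp: C_def distrib_right)
  interpret S: particle_system M F W X' T \<gamma> b \<sigma> "\<lambda>i j t \<omega>. \<sigma> i j (X t \<omega>)" I "L1 + L2" K G C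
  proof unfold_locales
    show "usual_filtration M F" "brownian_motion M F W" by fact+
    show "i \<noteq> j \<Longrightarrow> \<gamma> i j = \<gamma> j i \<and> 0 \<le> \<gamma> i j" for i j by (rule A2(1))
    show "(i, j) \<in> adjacent \<Longrightarrow> 0 < \<gamma> i j" for i j by (rule A2(2))
    show "\<bar>\<gamma> i j\<bar> \<le> G" for i j by (rule G)
    show "0 \<le> L1 + L2" using L1 L2 by simp
    show "\<bar>b i x - b i y\<bar> \<le> (L1 + L2) * norm (x - y)" for i x y
      using L1(2)[of i x y] mult_nonneg_nonneg[OF L2(1) norm_ge_zero[of "x - y"]] by (simp add: distrib_right)
    show "\<bar>\<sigma> i j x - \<sigma> i j y\<bar> \<le> (L1 + L2) * norm (x - y)" for i j x y
      using L2(2)[of i j x y] mult_nonneg_nonneg[OF L1(1) norm_ge_zero[of "x - y"]] by (simp add: distrib_right)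
    show "\<bar>\<sigma> i j x\<bar> \<le> K" for i j x by (rule K)
    show "X' t \<omega> \<in> ordered_chamber" for t \<omega> by (rule X'(1))
    show "continuous_on UNIV (\<lambda>t. X' t \<omega>)" for \<omega> by (rule X'(2))
    show "t \<in> {0..T} \<Longrightarrow> X' t \<in> borel_measurable (F t)" for t by (rule X'(3))
    show "X' t \<in> borel_measurable M" for t by (rule X'(4))
    show "ito_integral M F T (\<lambda>t \<omega>. W t \<omega> $ j) (\<lambda>t \<omega>. \<sigma> i j (X t \<omega>)) (I i j)" for i j by (rule ito)
    show "AE \<omega> in M. \<forall>r\<in>{0..T}. \<sigma> i j (X r \<omega>) = \<sigma> i j (X' r \<omega>)" for i j
      using eq by eventually_elim simp
    show "AE \<omega> in M. \<forall>t\<in>{0..T}. X' t \<omega> $ i = X' 0 \<omega> $ i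
        + (LINT r:{0..t}|lborel. repulsion \<gamma> (X' r \<omega>) i + b i (X' r \<omega>)) + (\<Sum>j\<in>UNIV. I i j t \<omega>)" for i
      using sde[of i] eq
    proof eventually_elim
      case (elim \<omega>)
      show ?case
      proof
        fix t assume t: "t \<in> {0..T}"
        have "(LINT r:{0..t}|lborel. repulsion \<gamma> (X' r \<omega>) i + b i (X' r \<omega>))
            = (LINT r:{0..t}|lborel. repulsion \<gamma> (X r \<omega>) i + b i (X r \<omega>))"
          using elim(2) t by (intro set_lebesgue_integral_cong) auto
        moreover have "X' t \<omega> = X t \<omega>" "X' 0 \<omega> = X 0 \<omega>" using elim(2) t by auto
        ultimately show "X' t \<omega> $ i = X' 0 \<omega> $ i
            + (LINT r:{0..t}|lborel. repulsion \<gamma> (X' r \<omega>) i + b i (X' r \<omega>)) + (\<Sum>j\<in>UNIV. I i j t \<omega>)"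
          using bspec[OF elim(1) t] by (simp only:)
      qed
    qed
    show "0 \<le> C" by (rule C)
    show "(\<integral>\<^sup>+\<omega>. ennreal (gap_energy (X' t \<omega>)) \<partial>M) \<le> ennreal C" if t: "t \<in> {0..T}" for t
    proof -
      have "(\<integral>\<^sup>+\<omega>. ennreal (gap_energy (X' t \<omega>)) \<partial>M) = (\<integral>\<^sup>+\<omega>. ennreal (gap_energy (X t \<omega>)) \<partial>M)"
        using eq t by (intro nn_integral_cong_AE) auto
      also have "\<dots> \<le> ennreal (card (adjacent :: ('d \<times> 'd) set) * C_hat)"
        by (rule gap_energy_moment[OF X_M[OF t] pair[OF t] less_imp_le[OF C_hat]])
      also have "\<dots> \<le> ennreal C" by (rule ennreal_leI[OF C(2)])
      finally show ?thesis .
    qed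
    have inc: "(\<integral>\<^sup>+\<omega>. ennreal (norm (X t \<omega> - X s \<omega>) ^ 6) \<partial>M) \<le> ennreal (C * \<bar>t - s\<bar> ^ 3)"
      if "0 \<le> s" "s < t" "t \<le> T" for s t
      by (rule order_trans[OF increments[OF that]]) (intro ennreal_leI mult_right_mono C(3), simp)
    show "(\<integral>\<^sup>+\<omega>. ennreal (norm (X' t \<omega> - X' s \<omega>) ^ 6) \<partial>M) \<le> ennreal (C * \<bar>t - s\<bar> ^ 3)"
      if s: "s \<in> {0..T}" and t: "t \<in> {0..T}" for s t
    proof -
      have "(\<integral>\<^sup>+\<omega>. ennreal (norm (X' t \<omega> - X' s \<omega>) ^ 6) \<partial>M) = (\<integral>\<^sup>+\<omega>. ennreal (norm (X t \<omega> - X s \<omega>) ^ 6) \<partial>M)"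
        using eq s t by (intro nn_integral_cong_AE) auto
      also have "\<dots> \<le> ennreal (C * \<bar>t - s\<bar> ^ 3)"
      proof (cases s t rule: linorder_cases)
        case less
        then show ?thesis using inc[of s t] s t by simp
      next
        case greater
        then show ?thesis using inc[of t s] s t by (simp add: norm_minus_commute abs_minus_commute)
      qed simp
      finally show ?thesis .
    qed
  qed
  define C1 where "C1 = T * S.rate_const * exp (T * S.rate_const)"
  define C2 where "C2 = 4 * sqrt (T * S.rate_const * C1) + T * S.rate_const * (C1 + 1)"
  have C12: "0 \<le> C1" "0 \<le> C2" using T S.rate_const_nonneg by (simp_all add: C1_def C2_def)
  (* The roots serve the two estimates, the 1 makes c positive. *)
  define c where "c = 1 + sqrt (C1 * T) + sqrt (C2 * sqrt T)"
  have c: "0 < c" "sqrt (C1 * T) \<le> c" "sqrt (C2 * sqrt T) \<le> c"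
  proof -
    have "0 \<le> sqrt (C1 * T)" "0 \<le> sqrt (C2 * sqrt T)" using C12 T by simp_all
    then show "0 < c" "sqrt (C1 * T) \<le> c" "sqrt (C2 * sqrt T) \<le> c" unfolding c_def by linarith+
  qed
  show ?thesis
  proof (intro exI[of _ c] conjI c(1) allI impI, elim conjE)
    fix n :: nat assume n: "n \<ge> 1" "T / real n \<le> 1"
    define err where "err k \<omega> = norm (X (grid T n k) \<omega> - semi_implicit_EM \<gamma> b \<sigma> W T (X 0) n k \<omega>)" for k \<omega>
    define err' where "err' k \<omega> = norm (X' (grid T n k) \<omega> - semi_implicit_EM \<gamma> b \<sigma> W T (X 0) n k \<omega>)" for k \<omega>
    have zero: "0 \<in> {0..T}" using T by simp
    have X0: "X 0 \<in> borel_measurable (F 0)" by (rule X_F[OF zero])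
    have X0': "AE \<omega> in M. X 0 \<omega> = X' 0 \<omega>" using eq by eventually_elim (use zero in auto)
    note conv = S.scheme_convergence[OF T n X0 X0', folded err'_def C1_def, folded C2_def]
    have grid_T: "grid T n k \<in> {0..T}" if "k \<le> n" for k
    proof -
      have "real k * T \<le> real n * T" using that T by simp
      then show ?thesis using n T by (simp add: grid_def divide_le_eq mult.commute)
    qed
    have meas: "err k \<in> borel_measurable M" "err' k \<in> borel_measurable M" if k: "k \<le> n" for k
      unfolding err_def[abs_def] err'_def[abs_def]
      using conv(1)[OF k] X_M[OF grid_T[OF k]] X'(4)[of "grid T n k"] by simp_all
    have err_eq: "AE \<omega> in M. \<forall>k\<in>{1..n}. err k \<omega> = err' k \<omega>"
      using eq by eventually_elim (use grid_T in \<open>auto simp: err_def err'_def\<close>)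
    have sq_int: "integrable M (\<lambda>\<omega>. (err k \<omega>)\<^sup>2)" "(LINT \<omega>|M. (err k \<omega>)\<^sup>2) \<le> C1 * (T / real n)" if k: "k \<in> {1..n}" for k
    proof -
      have kn: "k \<le> n" using k by simp
      have AE: "AE \<omega> in M. (err' k \<omega>)\<^sup>2 = (err k \<omega>)\<^sup>2" using err_eq by eventually_elim (use k in auto)
      show "integrable M (\<lambda>\<omega>. (err k \<omega>)\<^sup>2)"
        by (rule integrable_cong_AE_imp[OF conv(2)[OF kn]]) (use AE meas[OF kn] in auto)
      have "(LINT \<omega>|M. (err k \<omega>)\<^sup>2) = (LINT \<omega>|M. (err' k \<omega>)\<^sup>2)"
        by (rule integral_cong_AE) (use AE meas[OF kn] in auto)
      then show "(LINT \<omega>|M. (err k \<omega>)\<^sup>2) \<le> C1 * (T / real n)" using conv(3)[OF kn] by simp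
    qed
    have SUP_meas: "(\<lambda>\<omega>. SUP k\<in>{1..n}. (err k \<omega>)\<^sup>2) \<in> borel_measurable M" "(\<lambda>\<omega>. SUP k\<in>{1..n}. (err' k \<omega>)\<^sup>2) \<in> borel_measurable M"
      using meas by (auto intro!: borel_measurable_cSUP)
    have SUP_AE: "AE \<omega> in M. (SUP k\<in>{1..n}. (err' k \<omega>)\<^sup>2) = (SUP k\<in>{1..n}. (err k \<omega>)\<^sup>2)"
      using err_eq by eventually_elim (auto intro!: SUP_cong)
    have SUP_int: "integrable M (\<lambda>\<omega>. SUP k\<in>{1..n}. (err k \<omega>)\<^sup>2)"
      by (rule integrable_cong_AE_imp[OF conv(4)]) (use SUP_AE SUP_meas in auto)
    have "(LINT \<omega>|M. (SUP k\<in>{1..n}. (err k \<omega>)\<^sup>2)) = (LINT \<omega>|M. (SUP k\<in>{1..n}. (err' k \<omega>)\<^sup>2))"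
      by (rule integral_cong_AE) (use SUP_AE SUP_meas in auto)
    then have SUP_le: "(LINT \<omega>|M. (SUP k\<in>{1..n}. (err k \<omega>)\<^sup>2)) \<le> C2 * sqrt (T / real n)" using conv(5) by simp
    have SUP_nonneg: "0 \<le> (SUP k\<in>{1..n}. (err k \<omega>)\<^sup>2)" for \<omega>
      using n by (intro cSUP_upper2[where x = 1]) auto
    have first: "(LINT \<omega>|M. (err k \<omega>)\<^sup>2) powr (1 / 2) \<le> c / real n powr (1 / 2)" if k: "k \<in> {1..n}" for k
    proof -
      have "(LINT \<omega>|M. (err k \<omega>)\<^sup>2) \<le> (C1 * T) * (1 / real n)" using sq_int(2)[OF k] by simp
      then have "(LINT \<omega>|M. (err k \<omega>)\<^sup>2) powr (1 / 2) \<le> sqrt (C1 * T) * (1 / real n) powr (1 / 2)"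
        using C12 T by (intro powr_half_le) auto
      also have "\<dots> = sqrt (C1 * T) / real n powr (1 / 2)" using n by (simp add: powr_divide)
      also have "\<dots> \<le> c / real n powr (1 / 2)" using c(2) by (intro divide_right_mono) auto
      finally show ?thesis .
    qed
    have second: "(LINT \<omega>|M. (SUP k\<in>{1..n}. (err k \<omega>)\<^sup>2)) powr (1 / 2) \<le> c / real n powr (1 / 4)"
    proof -
      have "(LINT \<omega>|M. (SUP k\<in>{1..n}. (err k \<omega>)\<^sup>2)) \<le> (C2 * sqrt T) * (1 / sqrt (real n))"
        using SUP_le by (simp add: real_sqrt_divide)
      then have "(LINT \<omega>|M. (SUP k\<in>{1..n}. (err k \<omega>)\<^sup>2)) powr (1 / 2) \<le> sqrt (C2 * sqrt T) * (1 / sqrt (real n)) powr (1 / 2)"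
        using C12 T SUP_nonneg by (intro powr_half_le) auto
      also have "(1 / sqrt (real n)) powr (1 / 2) = 1 / real n powr (1 / 4)"
        using n by (simp add: powr_divide powr_half_sqrt[symmetric] powr_powr)
      also have "sqrt (C2 * sqrt T) * (1 / real n powr (1 / 4)) \<le> c / real n powr (1 / 4)"
        using c(3) by (simp add: divide_right_mono)
      finally show ?thesis .
    qed
    have "(SUP k\<in>{1..n}. (LINT \<omega>|M. (err k \<omega>)\<^sup>2) powr (1 / 2)) \<le> c / real n powr (1 / 2)"
      by (rule finite_index_sup_le[OF n(1) first])
    then show "let err = (\<lambda>k \<omega>. norm (X (grid T n k) \<omega> - semi_implicit_EM \<gamma> b \<sigma> W T (X 0) n k \<omega>)) in
        (\<forall>k\<in>{1..n}. integrable M (\<lambda>\<omega>. (err k \<omega>)\<^sup>2)) \<and>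
        (SUP k\<in>{1..n}. (LINT \<omega>|M. (err k \<omega>)\<^sup>2) powr (1 / 2)) \<le> c / real n powr (1 / 2) \<and>
        integrable M (\<lambda>\<omega>. SUP k\<in>{1..n}. (err k \<omega>)\<^sup>2) \<and>
        (LINT \<omega>|M. (SUP k\<in>{1..n}. (err k \<omega>)\<^sup>2)) powr (1 / 2) \<le> c / real n powr (1 / 4)"
      unfolding Let_def err_def[symmetric] using sq_int(1) SUP_int second by blast
  qed
qed

end
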